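(* Let $k\ge4$, $u\in W^{4,\infty}_{\rm loc}\cap K$ and $x\in\mathbb R^d$. Then $$\begin{aligned}\big|\operatorname{div}\mathsf S^{\rm a}(u;x)-\operatorname{div}\mathsf S^{\rm c}(u;x)\big|\lesssim\;&\sum_{\bm\rho\in\Lambda_*^4}\frac{m(\bm\rho)|\bm\rho|^3}{|\rho_1|}\prod_{j=2}^4\|\nabla^2u\|_{L^\infty(x+\nu_{\rho_1,\rho_j})}\\&+\sum_{\bm\rho\in\Lambda_*^3}\frac{m(\bm\rho)|\bm\rho|^3}{|\rho_1|}\|\nabla^3u\|_{L^\infty(x+\nu_{\rho_1,\rho_2})}\|\nabla^2u\|_{L^\infty(x+\nu_{\rho_1,\rho_3})}\\&+\sum_{\bm\rho\in\Lambda_*^2}\frac{m(\bm\rho)|\bm\rho|^3}{|\rho_1|}\|\nabla^4u\|_{L^\infty(x+\nu_{\rho_1,\rho_2})},\end{aligned}$$ where, for a suitable constant $c>0$ depending only on $d$ and $\zeta$, $\nu_{\rho,\sigma}:=\{y\in\mathbb R^d:\operatorname{dist}(y,\operatorname{conv}\{\pm2\rho\pm\sigma\})\le 2c\}$ for $\rho,\sigma\in\Lambda_*$.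
   Context: $d\in\mathbb N$, $\Lambda=\mathbb Z^d$, $\Lambda_*=\Lambda\setminus\{0\}$; $|\cdot|$ is the Euclidean (Frobenius) norm. $D_\rho v(\xi)=v(\xi+\rho)-v(\xi)$, $Dv(\xi)=(D_\rho v(\xi))_{\rho\in\Lambda_*}$. $(\operatorname{div}\mathsf S)_i=\sum_\alpha\partial_\alpha\mathsf S_{i\alpha}$. $\operatorname{conv}$ denotes the convex hull (here of the four points $\pm2\rho\pm\sigma$). $\zeta\in W^{1,\infty}(\mathbb R^d;\mathbb R)$ is fixed, with $\zeta(0)=1$, $\zeta(\xi)=0$ for $\xi\in\Lambda_*$, $\zeta\ge0$, compact support, $\zeta(-x)=\zeta(x)$, and $\sum_{\xi\in\Lambda}(a+b\cdot\xi)\zeta(x-\xi)=a+b\cdot x$ for all $a\in\mathbb R$, $b\in\mathbb R^d$. Potential: $\mathscr D=\{g=(g_\rho)_{\rho\in\Lambda_*}: g_\rho\in\mathbb R^d,\ \|g\|_{\mathscr D}:=\sup_\rho|g_\rho|/|\rho|<\infty\}$, $\mathscr D_\kappa=\{g\in\mathscr D:\|g\|_{\mathscr D}\le\kappa\}$. $V:\mathscr D\to\mathbb R\cup\{\pm\infty\}$ satisfies $V(0)=0$; $V((-g_{-\rho})_{\rho})=V(g)$ for all $g$; $V\in C^k(\mathscr D_\kappa)$ with $\kappa>0$ a fixed sufficiently small constant. For $\bm\rho=(\rho_1,\dots,\rho_j)\in\Lambda_*^j$, $V_{\bm\rho}(g)=\partial^jV(g)/\partial g_{\rho_1}\cdots\partial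 g_{\rho_j}$ is a $j$-linear form on $(\mathbb R^d)^j$, and $\delta^jV(g)[h_1,\dots,h_j]=\sum_{\bm\rho\in\Lambda_*^j}V_{\bm\rho}(g)[(h_1)_{\rho_1},\dots,(h_j)_{\rho_j}]$. $m(\bm\rho)=\prod_{i=1}^j|\rho_i|\,\sup_{g\in\mathscr D_\kappa}\|V_{\bm\rho}(g)\|$, where $\|\ell\|=\sup_{|h_1|=\dots=|h_j|=1}\ell[h_1,\dots,h_j]$; $|\bm\rho|=\sum_i|\rho_i|$. It is assumed that $M^{(j)}:=\sum_{\bm\rho\in\Lambda_*^j}m(\bm\rho)<\infty$ for $1\le j\le k$. $K=\{u\in W^{1,\infty}_{\rm loc}(\mathbb R^d;\mathbb R^d):\|\nabla u\|_{L^\infty}\le\kappa\}$. Stresses: the atomistic stress of (the restriction to $\Lambda$ of) $u$ is $\mathsf S^{\rm a}(u;x)=\sum_{\xi\in\Lambda}\sum_{\rho\in\Lambda_*}[V_\rho(Du(\xi))\otimes\rho]\,\chi_{\xi,\rho}(x)$, $\chi_{\xi,\rho}(x)=\int_0^1\zeta(\xi+t\rho-x)\,dt$; its divergence is given by $\operatorname{div}\mathsf S^{\rm a}(u;x)=\sum_{\rho\in\Lambda_*}\sum_{\xi\in\Lambda}V_\rho(Du(\xi))\,\nabla_\rho\chi_{\xi,\rho}(x)$ with $\nabla_\rho\chi_{\xi,\rho}(x)=\nabla\chi_{\xi,\rho}(x)\cdot\rho$. The Cauchy--Born stress is $\mathsf S^{\rm c}_{i\alpha}(u;x)=\partial W(\mathsf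 F)/\partial\mathsf F_{i\alpha}|_{\mathsf F=\nabla u(x)}$, where $W(\mathsf F)=V((\mathsf F\rho)_{\rho\in\Lambda_*})$. $a\lesssim b$ means $a\le Cb$ with a generic constant $C$ independent of the interaction potential, of any data in the model, and of any functions or points involved (it depends only on fixed quantities such as $d$ and $\zeta$). *)

theory Defs
  imports "HOL-Analysis.Analysis" "HOL-Probability.Essential_Supremum"
begin

section \<open>The lattice and the interaction space\<close>

text \<open>The dimension \<open>d\<close> is \<open>CARD('n)\<close>.\<close>

definition lattice :: "(real^'n) set" where
  "lattice = {\<xi>. \<forall>i. \<xi> $ i \<in> \<int>}"

definition lattice_star :: "(real^'n) set" where
  "lattice_star = lattice - {0}"

definition star_tuples :: "nat \<Rightarrow> (real^'n) list set" where
  "star_tuples j = {\<rho>s. length \<rho>s = j \<and> set \<rho>s \<subseteq> lattice_star}"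

lemma lattice_star_nonempty: "lattice_star \<noteq> ({} :: (real^'n) set)"
proof -
  have "(1 :: real^'n) \<in> lattice_star"
    by (simp add: lattice_star_def lattice_def vec_eq_iff)
  then show ?thesis by blast
qed

text \<open>A family \<open>(g\<^sub>\<rho>)\<close> indexed by \<^const>\<open>lattice_star\<close> is encoded as a function on the whole space
  that vanishes off \<^const>\<open>lattice_star\<close>.\<close>

typedef (overloaded) ('n::finite) stencil =
  "{g :: real^'n \<Rightarrow> real^'n. (\<forall>\<rho>. \<rho> \<notin> lattice_star \<longrightarrow> g \<rho> = 0) \<and>
      bdd_above ((\<lambda>\<rho>. norm (g \<rho>) / norm \<rho>) ` lattice_star)}"
  morphisms entry Abs_stencil
  by (intro exI[of _ "\<lambda>_. 0"]) auto

lemma entry_off: "\<rho> \<notin> lattice_star \<Longrightarrow> entry g \<rho> = 0"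
  using entry[of g] by auto

lemma entry_bdd: "bdd_above ((\<lambda>\<rho>. norm (entry g \<rho>) / norm \<rho>) ` lattice_star)"
  using entry[of g] by auto

lemma stencil_eqI: "(\<And>\<rho>. \<rho> \<in> lattice_star \<Longrightarrow> entry f \<rho> = entry g \<rho>) \<Longrightarrow> f = g"
  by (metis entry_inject entry_off ext)

instantiation stencil :: (finite) real_normed_vector
begin

definition zero_stencil :: "'a stencil" where
  "0 = Abs_stencil (\<lambda>_. 0)"
definition plus_stencil :: "'a stencil \<Rightarrow> 'a stencil \<Rightarrow> 'a stencil" where
  "f + g = Abs_stencil (\<lambda>\<rho>. entry f \<rho> + entry g \<rho>)"
definition scaleR_stencil :: "real \<Rightarrow> 'a stencil \<Rightarrow> 'a stencil" where
  "r *\<^sub>R f = Abs_stencil (\<lambda>\<rho>. r *\<^sub>R entry f \<rho>)"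
definition uminus_stencil :: "'a stencil \<Rightarrow> 'a stencil" where
  "- f = (-1) *\<^sub>R f" for f :: "'a stencil"
definition minus_stencil :: "'a stencil \<Rightarrow> 'a stencil \<Rightarrow> 'a stencil" where
  "f - g = f + (- g)" for f g :: "'a stencil"
definition norm_stencil :: "'a stencil \<Rightarrow> real" where
  "norm f = (SUP \<rho>\<in>lattice_star. norm (entry f \<rho>) / norm \<rho>)"
definition dist_stencil :: "'a stencil \<Rightarrow> 'a stencil \<Rightarrow> real" where
  "dist f g = norm (f - g)" for f g :: "'a stencil"
definition sgn_stencil :: "'a stencil \<Rightarrow> 'a stencil" where
  "sgn f = inverse (norm f) *\<^sub>R f" for f :: "'a stencil"
definition uniformity_stencil :: "('a stencil \<times> 'a stencil) filter" where
  "uniformity_stencil = (INF e\<in>{0<..}. principal {(f, g). dist f g < e})"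
definition open_stencil :: "'a stencil set \<Rightarrow> bool" where
  "open_stencil U \<longleftrightarrow> (\<forall>x\<in>U. \<forall>\<^sub>F (x', y) in uniformity. x' = x \<longrightarrow> y \<in> U)"

lemma entry_zero [simp]: "entry 0 \<rho> = 0"
  unfolding zero_stencil_def by (subst Abs_stencil_inverse) auto

lemma entry_plus [simp]: "entry (f + g) \<rho> = entry f \<rho> + entry g \<rho>"
  unfolding plus_stencil_def
proof (subst Abs_stencil_inverse)
  obtain A where A: "\<And>\<rho>. \<rho> \<in> lattice_star \<Longrightarrow> norm (entry f \<rho>) / norm \<rho> \<le> A"
    using entry_bdd[of f] by (auto simp: bdd_above_def)
  obtain B where B: "\<And>\<rho>. \<rho> \<in> lattice_star \<Longrightarrow> norm (entry g \<rho>) / norm \<rho> \<le> B"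
    using entry_bdd[of g] by (auto simp: bdd_above_def)
  have "norm (entry f \<rho> + entry g \<rho>) / norm \<rho> \<le> A + B" if "\<rho> \<in> lattice_star" for \<rho>
  proof -
    have "norm (entry f \<rho> + entry g \<rho>) / norm \<rho>
        \<le> (norm (entry f \<rho>) + norm (entry g \<rho>)) / norm \<rho>"
      by (intro divide_right_mono norm_triangle_ineq) auto
    then show ?thesis using A[OF that] B[OF that] by (simp add: add_divide_distrib)
  qed
  then show "(\<lambda>\<rho>. entry f \<rho> + entry g \<rho>) \<in> {g. (\<forall>\<rho>. \<rho> \<notin> lattice_star \<longrightarrow> g \<rho> = 0) \<and>
      bdd_above ((\<lambda>\<rho>. norm (g \<rho>) / norm \<rho>) ` lattice_star)}"
    by (auto simp: entry_off intro!: bdd_aboveI[of _ "A + B"])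
qed simp

lemma entry_scaleR [simp]: "entry (r *\<^sub>R f) \<rho> = r *\<^sub>R entry f \<rho>"
  unfolding scaleR_stencil_def
proof (subst Abs_stencil_inverse)
  obtain A where A: "\<And>\<rho>. \<rho> \<in> lattice_star \<Longrightarrow> norm (entry f \<rho>) / norm \<rho> \<le> A"
    using entry_bdd[of f] by (auto simp: bdd_above_def)
  have "norm (r *\<^sub>R entry f \<rho>) / norm \<rho> \<le> \<bar>r\<bar> * A" if "\<rho> \<in> lattice_star" for \<rho>
    using mult_left_mono[OF A[OF that], of "\<bar>r\<bar>"] by simp
  then show "(\<lambda>\<rho>. r *\<^sub>R entry f \<rho>) \<in> {g. (\<forall>\<rho>. \<rho> \<notin> lattice_star \<longrightarrow> g \<rho> = 0) \<and>
      bdd_above ((\<lambda>\<rho>. norm (g \<rho>) / norm \<rho>) ` lattice_star)}"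
    by (auto simp: entry_off intro!: bdd_aboveI[of _ "\<bar>r\<bar> * A"])
qed simp

lemma entry_uminus [simp]: "entry (- f) \<rho> = - entry f \<rho>"
  by (simp add: uminus_stencil_def)

lemma entry_minus [simp]: "entry (f - g) \<rho> = entry f \<rho> - entry g \<rho>"
  by (simp add: minus_stencil_def)

lemma entry_le_norm_stencil:
  "\<rho> \<in> lattice_star \<Longrightarrow> norm (entry f \<rho>) / norm \<rho> \<le> norm f"
  unfolding norm_stencil_def by (rule cSUP_upper[OF _ entry_bdd])

lemma norm_stencil_leI:
  "(\<And>\<rho>. \<rho> \<in> lattice_star \<Longrightarrow> norm (entry f \<rho>) / norm \<rho> \<le> B) \<Longrightarrow> norm f \<le> B"
  unfolding norm_stencil_def by (rule cSUP_least[OF lattice_star_nonempty])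

instance
proof
  fix f g h :: "'a stencil" and r s :: real and U :: "'a stencil set"
  show "f + g + h = f + (g + h)" "f + g = g + f" "0 + f = f" "- f + f = 0" "f - g = f + - g"
    "r *\<^sub>R (f + g) = r *\<^sub>R f + r *\<^sub>R g" "(r + s) *\<^sub>R f = r *\<^sub>R f + s *\<^sub>R f"
    "r *\<^sub>R s *\<^sub>R f = (r * s) *\<^sub>R f" "1 *\<^sub>R f = f"
    by (auto intro!: stencil_eqI simp: algebra_simps)
  show "dist f g = norm (f - g)" by (fact dist_stencil_def)
  show "sgn f = inverse (norm f) *\<^sub>R f" by (simp add: sgn_stencil_def)
  show "uniformity = (INF e\<in>{0<..}. principal {(x, y). dist x (y::'a stencil) < e})"
    by (fact uniformity_stencil_def)
  show "open U = (\<forall>x\<in>U. \<forall>\<^sub>F (x', y) in uniformity. x' = x \<longrightarrow> y \<in> U)"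
    by (fact open_stencil_def)
  obtain \<rho>0 :: "real^'a" where \<rho>0: "\<rho>0 \<in> lattice_star" using lattice_star_nonempty by blast
  have nonneg: "0 \<le> norm f" for f :: "'a stencil"
    by (rule order_trans[OF _ entry_le_norm_stencil[OF \<rho>0]]) simp
  show "norm f = 0 \<longleftrightarrow> f = 0"
  proof
    assume z: "norm f = 0"
    show "f = 0"
    proof (rule stencil_eqI)
      fix \<rho> :: "real^'a" assume \<rho>: "\<rho> \<in> lattice_star"
      then have "norm (entry f \<rho>) / norm \<rho> \<le> 0" using entry_le_norm_stencil[OF \<rho>, of f] z by simp
      moreover have "norm \<rho> > 0" using \<rho> by (simp add: lattice_star_def)
      ultimately show "entry f \<rho> = entry 0 \<rho>" by (simp add: divide_le_0_iff)
    qed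
  next
    assume "f = 0"
    then have "norm f \<le> 0" by (intro norm_stencil_leI) simp
    then show "norm f = 0" using nonneg[of f] by simp
  qed
  show "norm (f + g) \<le> norm f + norm g"
  proof (rule norm_stencil_leI)
    fix \<rho> :: "real^'a" assume \<rho>: "\<rho> \<in> lattice_star"
    have "norm (entry (f + g) \<rho>) / norm \<rho> \<le> (norm (entry f \<rho>) + norm (entry g \<rho>)) / norm \<rho>"
      by (simp add: divide_right_mono norm_triangle_ineq)
    also have "\<dots> \<le> norm f + norm g"
      using entry_le_norm_stencil[OF \<rho>, of f] entry_le_norm_stencil[OF \<rho>, of g]
      by (simp add: add_divide_distrib)
    finally show "norm (entry (f + g) \<rho>) / norm \<rho> \<le> norm f + norm g" .
  qed
  have le: "norm (r *\<^sub>R f) \<le> \<bar>r\<bar> * norm f" for r and f :: "'a stencil"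
  proof (rule norm_stencil_leI)
    fix \<rho> :: "real^'a" assume \<rho>: "\<rho> \<in> lattice_star"
    show "norm (entry (r *\<^sub>R f) \<rho>) / norm \<rho> \<le> \<bar>r\<bar> * norm f"
      using mult_left_mono[OF entry_le_norm_stencil[OF \<rho>, of f], of "\<bar>r\<bar>"] by simp
  qed
  show "norm (r *\<^sub>R f) = \<bar>r\<bar> * norm f"
  proof (cases "r = 0")
    case True
    then show ?thesis using le[of r f] nonneg[of "r *\<^sub>R f"] by simp
  next
    case False
    have "inverse r *\<^sub>R r *\<^sub>R f = f" using False by (auto intro!: stencil_eqI)
    then have "norm f \<le> \<bar>inverse r\<bar> * norm (r *\<^sub>R f)" using le[of "inverse r" "r *\<^sub>R f"] by simp
    then have "\<bar>r\<bar> * norm f \<le> norm (r *\<^sub>R f)" using False by (simp add: field_simps)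
    then show ?thesis using le[of r f] by simp
  qed
qed

end

definition family :: "(real^'n \<Rightarrow> real^'n) \<Rightarrow> 'n stencil" where
  "family f = Abs_stencil (\<lambda>\<rho>. if \<rho> \<in> lattice_star then f \<rho> else 0)"

definition reflect :: "'n::finite stencil \<Rightarrow> 'n stencil" where
  "reflect g = family (\<lambda>\<rho>. - entry g (- \<rho>))"

definition homogeneous :: "real^'n^'n \<Rightarrow> 'n stencil" where
  "homogeneous F = family (\<lambda>\<rho>. F *v \<rho>)"

definition differences :: "(real^'n \<Rightarrow> real^'n) \<Rightarrow> real^'n \<Rightarrow> 'n stencil" where
  "differences v \<xi> = family (\<lambda>\<rho>. v (\<xi> + \<rho>) - v \<xi>)"

definition single :: "real^'n \<Rightarrow> real^'n \<Rightarrow> 'n stencil" where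
  "single \<rho> h = family (\<lambda>\<sigma>. if \<sigma> = \<rho> then h else 0)"

abbreviation stencil_ball :: "real \<Rightarrow> 'n::finite stencil set" where
  "stencil_ball \<kappa> \<equiv> {g. norm g \<le> \<kappa>}"


section \<open>Higher derivatives on a convex set with nonempty interior\<close>

text \<open>\<open>nderiv S f [h\<^sub>1, \<dots>, h\<^sub>j] g\<close> is \<open>\<delta>\<^sup>jf(g)[h\<^sub>1, \<dots>, h\<^sub>j]\<close>. Derivatives are taken within \<open>S\<close>, so that
  they make sense at boundary points of the closed ball (where they are unique, the ball being
  convex with nonempty interior).\<close>

primrec nderiv :: "'a::real_normed_vector set \<Rightarrow> ('a \<Rightarrow> real) \<Rightarrow> 'a list \<Rightarrow> 'a \<Rightarrow> real" where
  "nderiv S f [] = f"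
| "nderiv S f (h # hs) = (\<lambda>g. frechet_derivative (nderiv S f hs) (at g within S) h)"

text \<open>\<open>f \<in> C\<^sup>k(S)\<close>: the derivatives up to order \<open>k\<close> exist and are continuous with respect to the
  operator norm of multilinear forms. By the mean value theorem on the convex set \<open>S\<close>, this
  continuity makes the differentiability uniform over unit directions \<open>hs\<close>, that is, it is Frechet
  differentiability of the multilinear-form-valued derivatives.\<close>

definition Ck_on :: "nat \<Rightarrow> 'a::real_normed_vector set \<Rightarrow> ('a \<Rightarrow> real) \<Rightarrow> bool" where
  "Ck_on k S f \<longleftrightarrow>
     (\<forall>hs. \<forall>g\<in>S. length hs < k \<longrightarrow> nderiv S f hs differentiable (at g within S)) \<and>
     (\<forall>j\<le>k. \<forall>g\<in>S. \<forall>\<epsilon>>0. \<exists>\<delta>>0. \<forall>g'\<in>S. norm (g' - g) < \<delta> \<longrightarrow>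
        (\<forall>hs. length hs = j \<and> (\<forall>h\<in>set hs. norm h \<le> 1) \<longrightarrow>
           \<bar>nderiv S f hs g' - nderiv S f hs g\<bar> \<le> \<epsilon>))"


section \<open>The interaction potential\<close>

text \<open>\<open>V_part \<kappa> V [\<rho>\<^sub>1, \<dots>, \<rho>\<^sub>j] g [h\<^sub>1, \<dots>, h\<^sub>j]\<close> is the partial derivative
  \<open>\<partial>\<^sup>jV(g) / \<partial>g\<^sub>\<rho>\<^sub>1 \<dots> \<partial>g\<^sub>\<rho>\<^sub>j\<close>, as a \<open>j\<close>-linear form: the derivative in directions
  supported on single entries. It is only used on the ball, where \<open>V\<close> is finite.\<close>

definition V_part :: "real \<Rightarrow> ('n::finite stencil \<Rightarrow> ereal) \<Rightarrow> (real^'n) list \<Rightarrow> 'n stencil \<Rightarrow>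
    (real^'n) list \<Rightarrow> real" where
  "V_part \<kappa> V \<rho>s g hs =
     nderiv (stencil_ball \<kappa>) (\<lambda>g. real_of_ereal (V g)) (map2 single \<rho>s hs) g"

text \<open>The first partial derivative, with the linear form identified with a vector.\<close>

definition V_grad :: "real \<Rightarrow> ('n::finite stencil \<Rightarrow> ereal) \<Rightarrow> real^'n \<Rightarrow> 'n stencil \<Rightarrow> real^'n" where
  "V_grad \<kappa> V \<rho> g = (\<chi> i. V_part \<kappa> V [\<rho>] g [axis i 1])"

text \<open>For nonempty \<open>\<rho>s\<close> the supremum is nonnegative by linearity in each slot, so the truncation
  of negative values by \<^const>\<open>ennreal\<close> is immaterial.\<close>

definition m_weight :: "real \<Rightarrow> ('n::finite stencil \<Rightarrow> ereal) \<Rightarrow> (real^'n) list \<Rightarrow> ennreal" where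
  "m_weight \<kappa> V \<rho>s =
     ennreal (\<Prod>\<rho>\<leftarrow>\<rho>s. norm \<rho>) *
     (SUP g\<in>stencil_ball \<kappa>.
        SUP hs\<in>{hs. length hs = length \<rho>s \<and> (\<forall>h\<in>set hs. norm h = 1)}. ennreal (V_part \<kappa> V \<rho>s g hs))"

definition admissible_potential :: "real \<Rightarrow> nat \<Rightarrow> ('n::finite stencil \<Rightarrow> ereal) \<Rightarrow> bool" where
  "admissible_potential \<kappa> k V \<longleftrightarrow>
     V 0 = 0 \<and>
     (\<forall>g. V (reflect g) = V g) \<and>
     (\<forall>g\<in>stencil_ball \<kappa>. \<bar>V g\<bar> \<noteq> \<infinity>) \<and>
     Ck_on k (stencil_ball \<kappa>) (\<lambda>g. real_of_ereal (V g)) \<and>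
     (\<forall>j\<in>{1..k}. (\<Sum>\<^sub>\<infinity>\<rho>s\<in>star_tuples j. m_weight \<kappa> V \<rho>s) < \<infinity>) \<and>
     (\<forall>j\<in>{1..k}. \<forall>g\<in>stencil_ball \<kappa>. \<forall>hs. length hs = j \<longrightarrow>
        ((\<lambda>\<rho>s. V_part \<kappa> V \<rho>s g (map2 entry hs \<rho>s)) has_sum
           nderiv (stencil_ball \<kappa>) (\<lambda>g. real_of_ereal (V g)) hs g) (star_tuples j))"


section \<open>Weak derivatives and Sobolev spaces\<close>

definition partial :: "'n \<Rightarrow> (real^'n \<Rightarrow> 'b::real_normed_vector) \<Rightarrow> real^'n \<Rightarrow> 'b" where
  "partial \<alpha> f x = frechet_derivative f (at x) (axis \<alpha> 1)"

primrec partials :: "'n list \<Rightarrow> (real^'n \<Rightarrow> 'b::real_normed_vector) \<Rightarrow> real^'n \<Rightarrow> 'b" where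
  "partials [] f = f"
| "partials (\<alpha> # \<alpha>s) f = partial \<alpha> (partials \<alpha>s f)"

definition test_function :: "(real^'n \<Rightarrow> real) \<Rightarrow> bool" where
  "test_function \<phi> \<longleftrightarrow>
     (\<forall>\<alpha>s. partials \<alpha>s \<phi> differentiable_on UNIV) \<and> compact (closure {x. \<phi> x \<noteq> 0})"

definition has_weak_deriv ::
    "'n list \<Rightarrow> (real^'n \<Rightarrow> 'b::euclidean_space) \<Rightarrow> (real^'n \<Rightarrow> 'b) \<Rightarrow> bool" where
  "has_weak_deriv \<alpha>s f g \<longleftrightarrow>
     (\<forall>A. compact A \<longrightarrow> f absolutely_integrable_on A \<and> g absolutely_integrable_on A) \<and>
     (\<forall>\<phi>. test_function \<phi> \<longrightarrow>
        (LINT x|lebesgue. partials \<alpha>s \<phi> x *\<^sub>R f x) =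
        (-1) ^ length \<alpha>s *\<^sub>R (LINT x|lebesgue. \<phi> x *\<^sub>R g x))"

definition Linf_norm :: "(real^'n) set \<Rightarrow> (real^'n \<Rightarrow> 'b::real_normed_vector) \<Rightarrow> ennreal" where
  "Linf_norm A f = esssup (restrict_space lebesgue A) (\<lambda>y. ennreal (norm (f y)))"

definition sobolev_inf :: "nat \<Rightarrow> (real^'n \<Rightarrow> 'b::euclidean_space) \<Rightarrow> bool" where
  "sobolev_inf k f \<longleftrightarrow>
     (\<forall>\<alpha>s. length \<alpha>s \<le> k \<longrightarrow> (\<exists>g. has_weak_deriv \<alpha>s f g \<and> Linf_norm UNIV g < \<infinity>))"

definition sobolev_inf_loc :: "nat \<Rightarrow> (real^'n \<Rightarrow> 'b::euclidean_space) \<Rightarrow> bool" where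
  "sobolev_inf_loc k f \<longleftrightarrow>
     (\<forall>\<alpha>s. length \<alpha>s \<le> k \<longrightarrow>
        (\<exists>g. has_weak_deriv \<alpha>s f g \<and> (\<forall>A. compact A \<longrightarrow> Linf_norm A g < \<infinity>)))"

text \<open>The choice is unique up to null sets, hence immaterial in \<^const>\<open>Linf_norm\<close>.\<close>

definition weak_deriv :: "'n list \<Rightarrow> (real^'n \<Rightarrow> 'b::euclidean_space) \<Rightarrow> real^'n \<Rightarrow> 'b" where
  "weak_deriv \<alpha>s f = (SOME g. has_weak_deriv \<alpha>s f g)"

text \<open>The pointwise Frobenius norm of the tensor \<open>\<nabla>\<^sup>jf\<close>, whose entries are indexed by
  \<open>j\<close>-tuples of coordinate directions.\<close>

definition grad_norm :: "nat \<Rightarrow> (real^'n \<Rightarrow> 'b::euclidean_space) \<Rightarrow> real^'n \<Rightarrow> real" where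
  "grad_norm j f y = L2_set (\<lambda>\<alpha>s. norm (weak_deriv \<alpha>s f y)) {\<alpha>s. length \<alpha>s = j}"

text \<open>An element of \<open>W\<^sup>1\<^sup>,\<^sup>\<infinity>\<^sub>l\<^sub>o\<^sub>c\<close> is evaluated at lattice points, and is therefore identified with its
  continuous representative; likewise for the kernel \<open>\<zeta>\<close> below.\<close>

definition K_set :: "real \<Rightarrow> (real^'n \<Rightarrow> real^'n) set" where
  "K_set \<kappa> = {u. continuous_on UNIV u \<and> sobolev_inf_loc 1 u \<and>
     Linf_norm UNIV (grad_norm 1 u) \<le> ennreal \<kappa>}"


section \<open>The kernel and the stresses\<close>

definition admissible_kernel :: "(real^'n \<Rightarrow> real) \<Rightarrow> bool" where
  "admissible_kernel \<zeta> \<longleftrightarrow>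
     continuous_on UNIV \<zeta> \<and> sobolev_inf 1 \<zeta> \<and>
     \<zeta> 0 = 1 \<and> (\<forall>\<xi>\<in>lattice_star. \<zeta> \<xi> = 0) \<and> (\<forall>x. 0 \<le> \<zeta> x) \<and>
     compact (closure {x. \<zeta> x \<noteq> 0}) \<and> (\<forall>x. \<zeta> (- x) = \<zeta> x) \<and>
     (\<forall>a b x. ((\<lambda>\<xi>. (a + b \<bullet> \<xi>) * \<zeta> (x - \<xi>)) has_sum (a + b \<bullet> x)) lattice)"

definition bond_kernel :: "(real^'n \<Rightarrow> real) \<Rightarrow> real^'n \<Rightarrow> real^'n \<Rightarrow> real^'n \<Rightarrow> real" where
  "bond_kernel \<zeta> \<xi> \<rho> x = integral {0..1} (\<lambda>t. \<zeta> (\<xi> + t *\<^sub>R \<rho> - x))"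

text \<open>\<open>\<nabla>\<^sub>\<rho> \<chi>\<^sub>\<xi>\<^sub>,\<^sub>\<rho>(x)\<close>. Since \<open>\<chi>\<^sub>\<xi>\<^sub>,\<^sub>\<rho>\<close> averages \<open>\<zeta>\<close> in direction \<open>\<rho>\<close>, this directional derivative exists
  at every \<open>x\<close>, even though the full gradient may only exist almost everywhere.\<close>

definition bond_kernel_deriv :: "(real^'n \<Rightarrow> real) \<Rightarrow> real^'n \<Rightarrow> real^'n \<Rightarrow> real^'n \<Rightarrow> real" where
  "bond_kernel_deriv \<zeta> \<xi> \<rho> x = deriv (\<lambda>s. bond_kernel \<zeta> \<xi> \<rho> (x + s *\<^sub>R \<rho>)) 0"

definition atomistic_stress :: "(real^'n \<Rightarrow> real) \<Rightarrow> real \<Rightarrow> ('n::finite stencil \<Rightarrow> ereal) \<Rightarrow>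
    (real^'n \<Rightarrow> real^'n) \<Rightarrow> real^'n \<Rightarrow> real^'n^'n" where
  "atomistic_stress \<zeta> \<kappa> V u x =
     (\<Sum>\<^sub>\<infinity>\<xi>\<in>lattice. \<Sum>\<^sub>\<infinity>\<rho>\<in>lattice_star.
        bond_kernel \<zeta> \<xi> \<rho> x *\<^sub>R (\<chi> i \<alpha>. V_grad \<kappa> V \<rho> (differences u \<xi>) $ i * \<rho> $ \<alpha>))"

text \<open>The row-wise divergence of \<^const>\<open>atomistic_stress\<close>, given by termwise differentiation so that it
  is defined at every point although the stress itself is in general only Lipschitz.\<close>

definition div_atomistic_stress :: "(real^'n \<Rightarrow> real) \<Rightarrow> real \<Rightarrow> ('n::finite stencil \<Rightarrow> ereal) \<Rightarrow>
    (real^'n \<Rightarrow> real^'n) \<Rightarrow> real^'n \<Rightarrow> real^'n" where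
  "div_atomistic_stress \<zeta> \<kappa> V u x =
     (\<Sum>\<^sub>\<infinity>\<rho>\<in>lattice_star. \<Sum>\<^sub>\<infinity>\<xi>\<in>lattice.
        bond_kernel_deriv \<zeta> \<xi> \<rho> x *\<^sub>R V_grad \<kappa> V \<rho> (differences u \<xi>))"

definition W_cb :: "('n::finite stencil \<Rightarrow> ereal) \<Rightarrow> real^'n^'n \<Rightarrow> ereal" where
  "W_cb V F = V (homogeneous F)"

text \<open>\<open>\<partial>W(F)/\<partial>F\<^sub>i\<^sub>\<alpha>\<close> at \<open>F = \<nabla>u(x)\<close>, where \<open>(\<nabla>u)\<^sub>i\<^sub>\<alpha> = \<partial>\<^sub>\<alpha>u\<^sub>i\<close>; the derivative is taken within the closed
  convex set of matrices on which \<open>W\<close> is known to be finite.\<close>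

definition cauchy_born_stress :: "real \<Rightarrow> ('n::finite stencil \<Rightarrow> ereal) \<Rightarrow>
    (real^'n \<Rightarrow> real^'n) \<Rightarrow> real^'n \<Rightarrow> real^'n^'n" where
  "cauchy_born_stress \<kappa> V u x = (\<chi> i \<alpha>.
     frechet_derivative (\<lambda>F. real_of_ereal (W_cb V F))
       (at (matrix (frechet_derivative u (at x))) within {F. homogeneous F \<in> stencil_ball \<kappa>})
       (axis i (axis \<alpha> 1)))"

definition divergence :: "(real^'n \<Rightarrow> real^'n^'n) \<Rightarrow> real^'n \<Rightarrow> real^'n" where
  "divergence S x = (\<chi> i. \<Sum>\<alpha>\<in>UNIV. partial \<alpha> (\<lambda>y. S y $ i $ \<alpha>) x)"

definition nu :: "real \<Rightarrow> real^'n \<Rightarrow> real^'n \<Rightarrow> (real^'n) set" where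
  "nu c \<rho> \<sigma> = {y. infdist y (convex hull
     {2 *\<^sub>R \<rho> + \<sigma>, 2 *\<^sub>R \<rho> - \<sigma>, - 2 *\<^sub>R \<rho> + \<sigma>, - 2 *\<^sub>R \<rho> - \<sigma>}) \<le> 2 * c}"

text \<open>\<open>\<parallel>\<nabla>\<^sup>ju\<parallel>\<close> in \<open>L\<^sup>\<infinity>(x + \<nu>\<^sub>\<rho>\<^sub>,\<^sub>\<sigma>)\<close>\<close>

definition local_grad_norm :: "nat \<Rightarrow> (real^'n \<Rightarrow> real^'n) \<Rightarrow> real \<Rightarrow> real^'n \<Rightarrow> real^'n \<Rightarrow> real^'n \<Rightarrow>
    ennreal" where
  "local_grad_norm j u c x \<rho> \<sigma> = Linf_norm ((\<lambda>y. x + y) ` nu c \<rho> \<sigma>) (grad_norm j u)"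

text \<open>\<open>m(\<rho>) |\<rho>|\<^sup>3 / |\<rho>\<^sub>1|\<close>; list indices start at \<open>0\<close>, so \<open>\<rho>\<^sub>1\<close> is \<open>\<rho>s ! 0\<close>.\<close>

definition m3 :: "real \<Rightarrow> ('n::finite stencil \<Rightarrow> ereal) \<Rightarrow> (real^'n) list \<Rightarrow> ennreal" where
  "m3 \<kappa> V \<rho>s = m_weight \<kappa> V \<rho>s * ennreal ((\<Sum>\<rho>\<leftarrow>\<rho>s. norm \<rho>) ^ 3 / norm (\<rho>s ! 0))"

end

theory Submission
  imports Defs
begin

text \<open>Why the estimate holds. The bond kernel is an average of \<open>\<zeta>\<close> along the bond, so its
  derivative in the bond direction is a difference of two values of \<open>\<zeta>\<close>, and summation by
  parts turns the atomistic divergence into the sum over \<open>\<rho>\<close> of weighted means over \<open>\<xi>\<close>,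
  with weights \<open>\<zeta>(\<xi> - x)\<close>, of \<open>V\<^sub>\<rho>(Du(\<xi>)) - V\<^sub>\<rho>(Du(\<xi> - \<rho>))\<close>. The Cauchy--Born
  divergence is the sum over \<open>\<rho>\<close> of \<open>\<Sum>\<^sub>\<sigma>
  V\<^sub>\<rho>\<^sub>\<sigma>(G)[\<nabla>\<^sub>\<rho>\<nabla>\<^sub>\<sigma>u(x)]\<close>, where
  \<open>G = (\<nabla>u(x)\<rho>)\<^sub>\<rho>\<close>.

  The leading errors are removed by point symmetry. Since \<open>V\<close> is invariant under reflection,
  adding the contributions of \<open>\<rho>\<close> and \<open>-\<rho>\<close> gives a signed sum of \<open>V\<^sub>\<rho>\<close> over four stencils
  (lemma \<open>symmetrized_bond_force\<close>). The entry at \<open>\<sigma>\<close> of each of them is a finite difference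
  \<open>u(y + \<sigma>) - u(y)\<close>; with \<open>z = \<xi> - x\<close> the midpoints of these four bonds, relative to \<open>x\<close>,
  are \<open>z + a\<close>, \<open>z - a\<close>, \<open>z + b\<close> and \<open>z - b\<close> with \<open>a = \<sigma>/2\<close> and
  \<open>b = \<sigma>/2 - \<rho>\<close>, and the bonds about \<open>z + a\<close> and \<open>z - a\<close>, as well as those about
  \<open>z + b\<close> and \<open>z - b\<close>, carry opposite signs. Any quadratic expression in the midpoints
  therefore leaves only terms linear in \<open>z\<close>, and these vanish in the mean because \<open>\<zeta>\<close>
  reproduces affine functions (lemmas \<open>kernel_bilinear_cancellation\<close> and \<open>avg_bilinear\<close>).

  Now \<open>V\<^sub>\<rho>\<close> is expanded to second order about \<open>G\<close>, with a third-order remainder, and the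
  entries of the stencils are expanded about \<open>x\<close>. In the terms of first order the affine
  part of the entries yields exactly twice the Cauchy--Born term (\<open>avg_linear_part\<close>), the
  quadratic part cancels, and the remainder is controlled by \<open>\<nabla>\<^sup>4u\<close> (\<open>first_order_le\<close>). In
  the terms of second order the product of the affine parts cancels and the rest is
  controlled by \<open>\<nabla>\<^sup>3u\<close> times \<open>\<nabla>\<^sup>2u\<close> (\<open>second_order_le\<close>). The Taylor remainder is
  controlled by three factors \<open>\<nabla>\<^sup>2u\<close> (\<open>taylor_remainder_le\<close>). The powers of the bond lengths
  are those of the distances in these Taylor expansions.

  The affine part of the stencil entries grows quadratically in \<open>\<sigma>\<close> and is in general not an
  element of the interaction space. The cancellations are therefore carried out separately
  for each tuple of partial derivatives of \<open>V\<close>, and only the resulting bounds are summed.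

  Two analytic ingredients are developed first. Mollification shows that a continuous function
  in \<open>W\<^sup>m\<^sup>,\<^sup>\<infinity>\<^sub>l\<^sub>o\<^sub>c\<close> has pointwise derivatives up to order \<open>m - 1\<close>, of which
  those of order \<open>m - 1\<close> are locally Lipschitz, with bounds given by the essential suprema
  of the weak derivatives (\<open>jet_has_derivative\<close>, \<open>norm_jet_le\<close>, \<open>jet_lipschitz\<close>). For the
  potential, derivatives relative to a convex set with interior points are unique,
  multilinear and symmetric (\<open>has_derivative_within_unique\<close>, \<open>linear_slot\<close>, \<open>schwarz\<close>).\<close>

section \<open>Linear forms and Taylor bounds along lines\<close>

lemma interval_mean_value_bound:
  fixes f :: "real \<Rightarrow> 'a::real_normed_vector"
  assumes "\<And>t. t \<in> {0..1} \<Longrightarrow> (f has_vector_derivative f' t) (at t within {0..1})"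
    and "\<And>t. t \<in> {0..1} \<Longrightarrow> norm (f' t) \<le> B" and t: "t \<in> {0..1}"
  shows "norm (f t - f 0) \<le> B"
proof -
  have "norm (f t - f 0) \<le> B * norm (t - 0)"
  proof (rule differentiable_bound)
    show "(f has_derivative (\<lambda>h. h *\<^sub>R f' s)) (at s within {0..1})" if "s \<in> {0..1}" for s
      using assms(1)[OF that] by (simp add: has_vector_derivative_def)
    show "onorm (\<lambda>h. h *\<^sub>R f' s) \<le> B" if "s \<in> {0..1}" for s
      using mult_left_mono[OF assms(2)[OF that], of "\<bar>x\<bar>" for x] by (intro onorm_le) (simp add: mult.commute)
  qed (use t in auto)
  also have "\<dots> \<le> B"
    using t order_trans[OF norm_ge_zero assms(2)[OF t]] by (simp add: mult_left_le)
  finally show ?thesis .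
qed

lemma taylor_second_order:
  fixes f :: "real \<Rightarrow> 'a::real_normed_vector"
  assumes f: "\<And>t. t \<in> {0..1} \<Longrightarrow> (f has_vector_derivative f' t) (at t within {0..1})"
    and f': "\<And>t. t \<in> {0..1} \<Longrightarrow> (f' has_vector_derivative f'' t) (at t within {0..1})"
    and B: "\<And>t. t \<in> {0..1} \<Longrightarrow> norm (f'' t) \<le> B"
  shows "norm (f 1 - f 0 - f' 0) \<le> B"
proof -
  have "norm ((f 1 - 1 *\<^sub>R f' 0) - (f 0 - 0 *\<^sub>R f' 0)) \<le> B"
  proof (rule interval_mean_value_bound[where f = "\<lambda>t. f t - t *\<^sub>R f' 0" and f' = "\<lambda>t. f' t - f' 0"])
    show "((\<lambda>t. f t - t *\<^sub>R f' 0) has_vector_derivative f' t - f' 0) (at t within {0..1})"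
      if "t \<in> {0..1}" for t
      using that by (auto intro!: derivative_eq_intros f)
    show "norm (f' t - f' 0) \<le> B" if "t \<in> {0..1}" for t
      by (rule interval_mean_value_bound[OF f' B that])
  qed auto
  then show ?thesis by (simp add: algebra_simps)
qed

lemma taylor_third_order:
  fixes f :: "real \<Rightarrow> 'a::real_normed_vector"
  assumes f: "\<And>t. t \<in> {0..1} \<Longrightarrow> (f has_vector_derivative f' t) (at t within {0..1})"
    and f': "\<And>t. t \<in> {0..1} \<Longrightarrow> (f' has_vector_derivative f'' t) (at t within {0..1})"
    and B: "\<And>t. t \<in> {0..1} \<Longrightarrow> norm (f'' t - f'' 0) \<le> B"
  shows "norm (f 1 - f 0 - f' 0 - (1/2) *\<^sub>R f'' 0) \<le> B"
proof -
  let ?g = "\<lambda>t. f t - (t^2 / 2) *\<^sub>R f'' 0" and ?g' = "\<lambda>t. f' t - t *\<^sub>R f'' 0"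
  have "norm (?g 1 - ?g 0 - ?g' 0) \<le> B"
  proof (rule taylor_second_order[where f' = ?g' and f'' = "\<lambda>t. f'' t - f'' 0"])
    show "(?g has_vector_derivative ?g' t) (at t within {0..1})"
      if "t \<in> {0..1}" for t
      using that by (auto intro!: derivative_eq_intros f)
    show "(?g' has_vector_derivative f'' t - f'' 0) (at t within {0..1})"
      if "t \<in> {0..1}" for t
      using that by (auto intro!: derivative_eq_intros f')
  qed (rule B)
  then show ?thesis by (simp add: algebra_simps)
qed

text \<open>The linear map with prescribed values on the coordinate axes; a derivative written in
  this form displays its partial derivatives.\<close>

definition lin :: "('n::finite \<Rightarrow> 'b::real_normed_vector) \<Rightarrow> real^'n \<Rightarrow> 'b" where
  "lin D h = (\<Sum>\<alpha>\<in>UNIV. h $ \<alpha> *\<^sub>R D \<alpha>)"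

lemma bounded_linear_lin: "bounded_linear (lin D)"
  unfolding lin_def
  by (intro bounded_linear_sum bounded_linear_compose[OF bounded_linear_scaleR_left bounded_linear_vec_nth])

lemma lin_axis [simp]: "lin D (axis \<alpha> 1) = D \<alpha>"
  unfolding lin_def axis_def by (simp add: if_distrib[of "\<lambda>x. x *\<^sub>R _"] cong: if_cong)

lemma norm_lin_le:
  assumes "\<And>\<alpha>. norm (D \<alpha>) \<le> B"
  shows "norm (lin D h) \<le> real CARD('n) * (norm (h::real^'n::finite) * B)"
proof -
  have "norm (lin D h) \<le> (\<Sum>\<alpha>\<in>(UNIV::'n set). norm h * B)"
    unfolding lin_def
    by (rule sum_norm_le) (auto intro!: mult_mono component_le_norm_cart assms)
  then show ?thesis by simp
qed

lemma lin_swap: "lin (\<lambda>\<alpha>. lin (\<lambda>\<beta>. D \<alpha> \<beta>) h) k = lin (\<lambda>\<beta>. lin (\<lambda>\<alpha>. D \<alpha> \<beta>) k) h"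
  unfolding lin_def scaleR_sum_right
  by (subst sum.swap) (simp add: mult.commute)

lemma lin_diff: "lin (\<lambda>\<alpha>. D \<alpha> - E \<alpha>) h = lin D h - lin E h"
  by (simp add: lin_def algebra_simps sum_subtractf)

lemma lin_has_derivative:
  assumes "\<And>\<alpha>. (D \<alpha> has_derivative D' \<alpha>) F"
  shows "((\<lambda>y. lin (\<lambda>\<alpha>. D \<alpha> y) k) has_derivative (\<lambda>h. lin (\<lambda>\<alpha>. D' \<alpha> h) k)) F"
  unfolding lin_def by (intro derivative_intros assms)

lemmas lin_simps = linear_add[OF bounded_linear.linear[OF bounded_linear_lin]]
  linear_diff[OF bounded_linear.linear[OF bounded_linear_lin]]
  linear_scale[OF bounded_linear.linear[OF bounded_linear_lin]]
  linear_0[OF bounded_linear.linear[OF bounded_linear_lin]]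
  linear_neg[OF bounded_linear.linear[OF bounded_linear_lin]]

lemma has_derivative_along_line:
  assumes "(f has_derivative f') (at (a + t *\<^sub>R h))"
  shows "((\<lambda>t. f (a + t *\<^sub>R h)) has_vector_derivative f' h) (at t within S)"
proof -
  have "((\<lambda>t. f (a + t *\<^sub>R h)) has_derivative (\<lambda>s. f' (s *\<^sub>R h))) (at t within S)"
    by (rule has_derivative_compose[where f = "\<lambda>t. a + t *\<^sub>R h" and g = f])
       (auto intro!: derivative_eq_intros assms)
  moreover have "f' (s *\<^sub>R h) = s *\<^sub>R f' h" for s
    using has_derivative_linear[OF assms] by (simp add: linear_scale)
  ultimately show ?thesis by (simp add: has_vector_derivative_def)
qed

text \<open>Second-order Taylor along the segment from \<open>y\<close> to \<open>y + h\<close>. Expressed through partial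
  derivatives, the second derivative costs the square of the dimension.\<close>

lemma linearization_error_bound:
  fixes f :: "real^'n::finite \<Rightarrow> 'b::real_normed_vector"
  assumes f: "\<And>y. y \<in> C \<Longrightarrow> (f has_derivative lin (\<lambda>\<alpha>. f1 \<alpha> y)) (at y)"
    and f1: "\<And>\<alpha> y. y \<in> C \<Longrightarrow> (f1 \<alpha> has_derivative lin (\<lambda>\<beta>. f2 \<beta> \<alpha> y)) (at y)"
    and B: "\<And>\<alpha> \<beta> y. y \<in> C \<Longrightarrow> norm (f2 \<beta> \<alpha> y) \<le> B"
    and C: "convex C" "y \<in> C" "y + h \<in> C"
  shows "norm (f (y + h) - f y - lin (\<lambda>\<alpha>. f1 \<alpha> y) h) \<le> real CARD('n) ^ 2 * B * norm h ^ 2"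
proof -
  have seg: "y + t *\<^sub>R h \<in> C" if "t \<in> {0..1}" for t
    using convexD[OF C(1) C(2) C(3), of "1 - t" t] that by (simp add: algebra_simps)
  have "norm (f (y + 1 *\<^sub>R h) - f (y + 0 *\<^sub>R h) - lin (\<lambda>\<alpha>. f1 \<alpha> (y + 0 *\<^sub>R h)) h)
      \<le> real CARD('n) * (norm h * (real CARD('n) * (norm h * B)))"
  proof (rule taylor_second_order)
    fix t :: real assume t: "t \<in> {0..1}"
    show "((\<lambda>t. f (y + t *\<^sub>R h)) has_vector_derivative lin (\<lambda>\<alpha>. f1 \<alpha> (y + t *\<^sub>R h)) h) (at t within {0..1})"
      by (intro has_derivative_along_line f seg t)
    show "((\<lambda>t. lin (\<lambda>\<alpha>. f1 \<alpha> (y + t *\<^sub>R h)) h) has_vector_derivative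
        lin (\<lambda>\<alpha>. lin (\<lambda>\<beta>. f2 \<beta> \<alpha> (y + t *\<^sub>R h)) h) h) (at t within {0..1})"
      by (rule has_derivative_along_line[of "\<lambda>z. lin (\<lambda>\<alpha>. f1 \<alpha> z) h"])
         (intro lin_has_derivative f1 seg t)
    show "norm (lin (\<lambda>\<alpha>. lin (\<lambda>\<beta>. f2 \<beta> \<alpha> (y + t *\<^sub>R h)) h) h)
        \<le> real CARD('n) * (norm h * (real CARD('n) * (norm h * B)))"
      by (intro norm_lin_le B seg t)
  qed
  then show ?thesis by (simp add: power2_eq_square mult_ac)
qed

lemma lin_eq_imp_partial:
  "(f has_derivative lin D) (at y) \<Longrightarrow> partial \<alpha> f y = D \<alpha>"
  unfolding partial_def by (metis frechet_derivative_at lin_axis)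


section \<open>Smooth functions of compact support\<close>

text \<open>The functions \<open>p(1/t) exp(-1/t)\<close>, extended by zero, are closed under differentiation,
  so that \<open>flat 1\<close> is smooth.\<close>

definition flat :: "real poly \<Rightarrow> real \<Rightarrow> real" where
  "flat p t = (if 0 < t then poly p (1 / t) * exp (- 1 / t) else 0)"

lemma poly_times_exp_tendsto_0: "((\<lambda>x. poly p x * exp (- x)) \<longlongrightarrow> 0) at_top" for p :: "real poly"
proof -
  have "((\<lambda>x. \<Sum>i\<le>degree p. coeff p i * (x ^ i / exp x)) \<longlongrightarrow> (\<Sum>i\<le>degree p. coeff p i * 0)) at_top"
    by (intro tendsto_intros tendsto_power_div_exp_0)
  then show ?thesis
    by (simp add: poly_altdef exp_minus sum_distrib_right sum_divide_distrib field_simps)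
qed

lemma flat_div_tendsto_0: "((\<lambda>t. flat p t / t) \<longlongrightarrow> 0) (at 0)"
proof (rule filterlim_split_at)
  have "((\<lambda>t. poly (pCons 0 p) (1 / t) * exp (- (1 / t))) \<longlongrightarrow> 0) (at_right 0)"
    using filterlim_compose[OF poly_times_exp_tendsto_0 filterlim_inverse_at_top_right, of "pCons 0 p"]
    by (simp add: inverse_eq_divide)
  moreover have "\<forall>\<^sub>F t in at_right 0. poly (pCons 0 p) (1 / t) * exp (- (1 / t)) = flat p t / t"
    using eventually_at_right_less[of 0] by eventually_elim (simp add: flat_def field_simps)
  ultimately show "((\<lambda>t. flat p t / t) \<longlongrightarrow> 0) (at_right 0)"
    by (rule Lim_transform_eventually)
  have "\<forall>\<^sub>F t in at_left 0. 0 = flat p t / t"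
    unfolding eventually_at_filter by (auto simp: flat_def)
  then show "((\<lambda>t. flat p t / t) \<longlongrightarrow> 0) (at_left 0)"
    by (rule Lim_transform_eventually[rotated]) simp
qed

lemma flat_has_derivative:
  "(flat p has_real_derivative flat ([:0, 0, 1:] * (p - pderiv p)) t) (at t)"
proof -
  consider "t < 0" | "t = 0" | "0 < t" by linarith
  then show ?thesis
  proof cases
    case 1
    have "((\<lambda>_. 0) has_real_derivative flat ([:0, 0, 1:] * (p - pderiv p)) t) (at t)"
      using 1 by (simp add: flat_def)
    then show ?thesis
      by (rule DERIV_cong_ev[THEN iffD1, rotated -1])
         (use 1 eventually_nhds_in_open[of "{..<0}" t] in \<open>auto simp: flat_def elim!: eventually_mono\<close>)
  next
    case 2
    show ?thesis unfolding 2 has_field_derivative_iff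
      using flat_div_tendsto_0[of p] by (simp add: flat_def[of _ 0])
  next
    case 3
    have "((\<lambda>t. poly p (1 / t) * exp (- 1 / t)) has_real_derivative
        flat ([:0, 0, 1:] * (p - pderiv p)) t) (at t)"
      using 3 by (auto intro!: derivative_eq_intros DERIV_compose_FDERIV[OF poly_DERIV]
          simp: flat_def field_simps power2_eq_square)
    then show ?thesis
      by (rule DERIV_cong_ev[THEN iffD1, rotated -1])
         (use 3 eventually_nhds_in_open[of "{0<..}" t] in \<open>auto simp: flat_def elim!: eventually_mono\<close>)
  qed
qed

text \<open>The algebra generated by these one-dimensional functions of the coordinates. Closure
  under partial derivatives can be read off the generators, which makes all its members
  smooth, while its products of coordinate functions include bumps with support in an
  arbitrarily small box.\<close>

inductive_set bumps :: "(real^'n::finite \<Rightarrow> real) set" where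
  flat: "(\<lambda>x. flat p (a * x $ i + b)) \<in> bumps"
| const: "(\<lambda>x. c) \<in> bumps"
| add: "\<lbrakk>f \<in> bumps; g \<in> bumps\<rbrakk> \<Longrightarrow> (\<lambda>x. f x + g x) \<in> bumps"
| mult: "\<lbrakk>f \<in> bumps; g \<in> bumps\<rbrakk> \<Longrightarrow> (\<lambda>x. f x * g x) \<in> bumps"

lemma bumps_derivative:
  fixes f :: "real^'n::finite \<Rightarrow> real"
  assumes "f \<in> bumps"
  shows "\<exists>D. (\<forall>\<alpha>. D \<alpha> \<in> bumps) \<and> (\<forall>x. (f has_derivative lin (\<lambda>\<alpha>. D \<alpha> x)) (at x))"
  using assms
proof induction
  case (flat p a i b)
  let ?q = "[:0, 0, 1:] * (p - pderiv p)"
  let ?D = "\<lambda>\<alpha> x. (if \<alpha> = i then a else 0) * flat ?q (a * x $ i + b)"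
  have "((\<lambda>x. flat p (a * x $ i + b)) has_derivative (\<lambda>h. (a * h $ i) * flat ?q (a * x $ i + b))) (at x)"
    for x
    by (rule DERIV_compose_FDERIV[OF flat_has_derivative]) (auto intro!: derivative_eq_intros bounded_linear_imp_has_derivative bounded_linear_vec_nth)
  moreover have "lin (\<lambda>\<alpha>. ?D \<alpha> x) = (\<lambda>h. (a * h $ i) * flat ?q (a * x $ i + b))" for x
    by (rule ext)
      (simp add: lin_def if_distrib[of "\<lambda>x. x * _"] if_distrib[of "(*) _"] mult.commute cong: if_cong)
  ultimately have "((\<lambda>x. flat p (a * x $ i + b)) has_derivative lin (\<lambda>\<alpha>. ?D \<alpha> x)) (at x)" for x
    by simp
  moreover have "?D \<alpha> \<in> bumps" for \<alpha>
    by (intro bumps.intros)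
  ultimately show ?case by (intro exI[of _ ?D]) blast
next
  case (const c)
  have "lin (\<lambda>\<alpha>. 0::real) = (\<lambda>h::real^'n. 0)" by (simp add: lin_def fun_eq_iff)
  then show ?case by (intro exI[of _ "\<lambda>_ _. 0"]) (auto intro: bumps.const)
next
  case (add f g)
  then obtain D E where D: "\<forall>\<alpha>. D \<alpha> \<in> bumps" "\<forall>x. (f has_derivative lin (\<lambda>\<alpha>. D \<alpha> x)) (at x)"
    and E: "\<forall>\<alpha>. E \<alpha> \<in> bumps" "\<forall>x. (g has_derivative lin (\<lambda>\<alpha>. E \<alpha> x)) (at x)" by blast
  have "((\<lambda>x. f x + g x) has_derivative lin (\<lambda>\<alpha>. D \<alpha> x + E \<alpha> x)) (at x)" for x
  proof -
    have "lin (\<lambda>\<alpha>. D \<alpha> x + E \<alpha> x) = (\<lambda>h. lin (\<lambda>\<alpha>. D \<alpha> x) h + lin (\<lambda>\<alpha>. E \<alpha> x) h)"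
      by (simp add: lin_def fun_eq_iff algebra_simps sum.distrib)
    then show ?thesis using D E by (auto intro: has_derivative_add)
  qed
  then show ?case using D E by (intro exI[of _ "\<lambda>\<alpha> x. D \<alpha> x + E \<alpha> x"]) (auto intro: bumps.add)
next
  case (mult f g)
  then obtain D E where D: "\<forall>\<alpha>. D \<alpha> \<in> bumps" "\<forall>x. (f has_derivative lin (\<lambda>\<alpha>. D \<alpha> x)) (at x)"
    and E: "\<forall>\<alpha>. E \<alpha> \<in> bumps" "\<forall>x. (g has_derivative lin (\<lambda>\<alpha>. E \<alpha> x)) (at x)" by blast
  have "((\<lambda>x. f x * g x) has_derivative lin (\<lambda>\<alpha>. f x * E \<alpha> x + D \<alpha> x * g x)) (at x)" for x
  proof -
    have "lin (\<lambda>\<alpha>. f x * E \<alpha> x + D \<alpha> x * g x)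
        = (\<lambda>h. f x * lin (\<lambda>\<alpha>. E \<alpha> x) h + lin (\<lambda>\<alpha>. D \<alpha> x) h * g x)"
      by (simp add: lin_def fun_eq_iff algebra_simps sum.distrib sum_distrib_left)
    then show ?thesis using D E by (auto intro: has_derivative_mult)
  qed
  then show ?case using D E mult.hyps
    by (intro exI[of _ "\<lambda>\<alpha> x. f x * E \<alpha> x + D \<alpha> x * g x"]) (auto intro!: bumps.add bumps.mult)
qed

lemma bumps_partial: "f \<in> bumps \<Longrightarrow> partial \<alpha> f \<in> bumps"
  and bumps_has_derivative: "f \<in> bumps \<Longrightarrow> (f has_derivative lin (\<lambda>\<alpha>. partial \<alpha> f x)) (at x)"
proof -
  assume f: "f \<in> bumps"
  obtain D where D: "\<forall>\<alpha>. D \<alpha> \<in> bumps" "\<forall>x. (f has_derivative lin (\<lambda>\<alpha>. D \<alpha> x)) (at x)"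
    using bumps_derivative[OF f] by blast
  have "partial \<alpha> f = D \<alpha>" for \<alpha> by (rule ext, rule lin_eq_imp_partial) (use D in blast)
  with D show "partial \<alpha> f \<in> bumps" "(f has_derivative lin (\<lambda>\<alpha>. partial \<alpha> f x)) (at x)" by auto
qed

lemma bumps_partials: "f \<in> bumps \<Longrightarrow> partials \<alpha>s f \<in> bumps"
  by (induction \<alpha>s) (auto intro: bumps_partial)

lemma bumps_continuous: "f \<in> bumps \<Longrightarrow> continuous_on A f"
  by (meson bumps_has_derivative continuous_at_imp_continuous_on has_derivative_continuous)

lemma bumps_reflect: "f \<in> bumps \<Longrightarrow> (\<lambda>z. f (y - z)) \<in> bumps"
proof (induction rule: bumps.induct)
  case (flat p a i b)
  show ?case using bumps.flat[of p "- a" i "a * y $ i + b"] by (simp add: algebra_simps)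
qed (auto intro: bumps.intros)

lemma bumps_prod: "finite I \<Longrightarrow> (\<And>i. i \<in> I \<Longrightarrow> f i \<in> bumps) \<Longrightarrow> (\<lambda>x. \<Prod>i\<in>I. f i x) \<in> bumps"
  by (induction I rule: finite_induct) (auto intro: bumps.intros)

text \<open>The signs produced here cancel those in the definition of weak derivatives.\<close>

lemma partials_reflect:
  assumes "f \<in> bumps"
  shows "partials \<alpha>s (\<lambda>z. f (y - z)) = (\<lambda>z. (-1) ^ length \<alpha>s * partials \<alpha>s f (y - z))"
proof (induction \<alpha>s)
  case (Cons \<alpha> \<alpha>s)
  let ?g = "partials \<alpha>s f"
  have "((\<lambda>z. (-1) ^ length \<alpha>s * ?g (y - z)) has_derivative
      lin (\<lambda>\<alpha>. (-1) ^ Suc (length \<alpha>s) * partial \<alpha> ?g (y - z))) (at z)" for z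
  proof -
    have "((\<lambda>z. ?g (y - z)) has_derivative (\<lambda>h. lin (\<lambda>\<alpha>. partial \<alpha> ?g (y - z)) (- h))) (at z)"
      by (rule has_derivative_compose[where g = ?g, OF _ bumps_has_derivative[OF bumps_partials[OF assms]]])
        (auto intro!: derivative_eq_intros)
    then have "((\<lambda>z. (-1) ^ length \<alpha>s * ?g (y - z)) has_derivative
        (\<lambda>h. (-1) ^ length \<alpha>s * lin (\<lambda>\<alpha>. partial \<alpha> ?g (y - z)) (- h))) (at z)"
      by (rule has_derivative_mult_right)
    moreover have "(\<lambda>h. (-1) ^ length \<alpha>s * lin (\<lambda>\<alpha>. partial \<alpha> ?g (y - z)) (- h))
        = lin (\<lambda>\<alpha>. (-1) ^ Suc (length \<alpha>s) * partial \<alpha> ?g (y - z))"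
      by (simp add: lin_def fun_eq_iff sum_negf sum_distrib_left mult_ac)
    ultimately show ?thesis by simp
  qed
  then have "partial \<alpha> (\<lambda>z. (-1) ^ length \<alpha>s * ?g (y - z)) = (\<lambda>z. (-1) ^ Suc (length \<alpha>s) * partial \<alpha> ?g (y - z))"
    by (intro ext lin_eq_imp_partial)
  then show ?case by (simp only: partials.simps Cons list.size add_0_right add_Suc_right)
qed simp

lemma partials_off_closed:
  assumes "closed A" "\<And>x. x \<notin> A \<Longrightarrow> f x = 0" "x \<notin> A"
  shows "partials \<alpha>s f x = 0"
  using assms(3)
proof (induction \<alpha>s arbitrary: x)
  case (Cons \<alpha> \<alpha>s)
  have "((\<lambda>_. 0) has_derivative (\<lambda>_. 0)) (at x)" by simp
  then have "(partials \<alpha>s f has_derivative (\<lambda>_. 0)) (at x)"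
    by (rule has_derivative_transform_within_open[OF _ open_Compl[OF assms(1)]])
      (use Cons in auto)
  then show ?case by (simp add: partial_def frechet_derivative_at[symmetric])
qed (use assms(2) in simp)

lemma test_function_bump:
  assumes "f \<in> bumps" "compact A" "\<And>x. x \<notin> A \<Longrightarrow> f x = 0"
  shows "test_function f"
  unfolding test_function_def
proof (intro conjI allI)
  show "partials \<alpha>s f differentiable_on UNIV" for \<alpha>s
    using bumps_has_derivative[OF bumps_partials[OF assms(1)]]
    by (auto simp: differentiable_on_def differentiable_def intro: has_derivative_at_withinI)
  have "closure {x. f x \<noteq> 0} \<subseteq> A"
    by (rule closure_minimal) (use assms(2,3) compact_imp_closed in auto)
  then show "compact (closure {x. f x \<noteq> 0})"
    using assms(2) by (metis closed_closure compact_Int_closed inf.absorb_iff2)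
qed

lemma bumps_bounded:
  assumes "f \<in> bumps" "compact A" "\<And>x. x \<notin> A \<Longrightarrow> f x = 0"
  shows "\<exists>B\<ge>0. \<forall>x. \<bar>f x\<bar> \<le> B"
proof -
  have "compact (f ` A)" by (intro compact_continuous_image bumps_continuous assms)
  then obtain B where "\<forall>x\<in>A. \<bar>f x\<bar> \<le> B"
    using compact_imp_bounded[of "f ` A"] by (auto simp: bounded_iff)
  then have "\<bar>f x\<bar> \<le> max B 0" for x using assms(3)[of x] by (cases "x \<in> A") auto
  then show ?thesis by (intro exI[of _ "max B 0"]) auto
qed

text \<open>The product over all coordinates of \<open>flat 1 (1 + x\<^sub>i/s) * flat 1 (1 - x\<^sub>i/s)\<close> is
  positive at the origin and vanishes unless all coordinates are smaller than \<open>s\<close> in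
  modulus; it is divided by its integral.\<close>

lemma exists_mollifier:
  assumes "0 < r"
  shows "\<exists>\<eta> :: real^'n::finite \<Rightarrow> real. \<eta> \<in> bumps \<and> (\<forall>x. 0 \<le> \<eta> x) \<and>
    (\<forall>x. x \<notin> cball 0 r \<longrightarrow> \<eta> x = 0) \<and> integrable lebesgue \<eta> \<and> (LINT x|lebesgue. \<eta> x) = 1"
proof -
  define s where "s = r / CARD('n)"
  have s: "0 < s" using assms by (simp add: s_def)
  define k :: "real^'n \<Rightarrow> real"
    where "k x = (\<Prod>i\<in>UNIV. flat 1 (1 / s * x $ i + 1) * flat 1 (- 1 / s * x $ i + 1))" for x
  have k: "k \<in> bumps" unfolding k_def by (intro bumps_prod bumps.intros) auto
  have nonneg: "0 \<le> k x" for x unfolding k_def by (intro prod_nonneg) (auto simp: flat_def)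
  have off: "k x = 0" if "x \<notin> cball 0 r" for x
  proof -
    have "\<not> (\<forall>i. \<bar>x $ i\<bar> \<le> s)"
    proof
      assume "\<forall>i. \<bar>x $ i\<bar> \<le> s"
      then have "(\<Sum>i\<in>UNIV. \<bar>x $ i\<bar>) \<le> (\<Sum>i\<in>(UNIV::'n set). s)" by (intro sum_mono) auto
      then show False using that norm_le_l1_cart[of x] by (simp add: s_def)
    qed
    then obtain i where i: "\<bar>x $ i\<bar> > s" by (auto simp: not_le)
    then have "flat 1 (1 / s * x $ i + 1) * flat 1 (- 1 / s * x $ i + 1) = 0"
      using s by (auto simp: flat_def field_simps abs_if split: if_splits)
    then show ?thesis unfolding k_def by (auto intro!: prod_zero)
  qed
  have supp: "{x. k x \<noteq> 0} \<subseteq> cball 0 r" using off by blast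
  have k_int: "integrable lebesgue k"
  proof -
    have "set_integrable lborel (cball 0 r) k"
      unfolding set_integrable_def by (rule borel_integrable_compact) (auto intro: bumps_continuous[OF k])
    moreover have "(\<lambda>x. indicator (cball 0 r) x *\<^sub>R k x) = k"
      using off by (auto simp: fun_eq_iff indicator_def)
    ultimately have "integrable lborel k" by (simp add: set_integrable_def)
    then show ?thesis by (simp add: integrable_completion)
  qed
  have "(LINT x|lebesgue. k x) > 0"
  proof -
    have "(LINT x|lebesgue. k x) \<noteq> 0"
    proof
      assume "(LINT x|lebesgue. k x) = 0"
      then have "AE x in lebesgue. k x = 0"
        using integral_nonneg_eq_0_iff_AE[OF k_int] nonneg by auto
      then have neg: "negligible {x. k x \<noteq> 0}"
        by (simp add: eventually_ae_filter_negligible) (metis (mono_tags, lifting) negligible_subset)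
      have op: "open {x. k x \<noteq> 0}"
        using open_Collect_neq[OF bumps_continuous[OF k] continuous_on_const[of _ 0]] by simp
      have "k 0 \<noteq> 0" by (simp add: k_def flat_def)
      with op neg show False using open_not_negligible by blast
    qed
    moreover have "(LINT x|lebesgue. k x) \<ge> 0" by (simp add: nonneg)
    ultimately show ?thesis by simp
  qed
  then show ?thesis
    using k nonneg off k_int
    by (intro exI[of _ "\<lambda>x. (1 / (LINT x|lebesgue. k x)) * k x"] conjI bumps.mult bumps.const) auto
qed


section \<open>Mollification\<close>

definition loc_integrable :: "(real^'n::finite \<Rightarrow> 'b::euclidean_space) \<Rightarrow> bool" where
  "loc_integrable w \<longleftrightarrow> (\<forall>A. compact A \<longrightarrow> w absolutely_integrable_on A)"

definition conv :: "(real^'n::finite \<Rightarrow> real) \<Rightarrow> (real^'n \<Rightarrow> 'b::euclidean_space) \<Rightarrow> real^'n \<Rightarrow> 'b" where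
  "conv f w y = (LINT z|lebesgue. f (y - z) *\<^sub>R w z)"

lemma continuous_imp_loc_integrable:
  fixes w :: "real^'n::finite \<Rightarrow> 'b::euclidean_space"
  shows "continuous_on UNIV w \<Longrightarrow> loc_integrable w"
  unfolding loc_integrable_def
proof (intro allI impI)
  fix A :: "(real^'n) set" assume w: "continuous_on UNIV w" and A: "compact A"
  have "set_integrable lborel A w"
    unfolding set_integrable_def using borel_integrable_compact[OF A] continuous_on_subset[OF w] by blast
  then show "w absolutely_integrable_on A"
    by (simp add: set_integrable_def integrable_completion borel_measurable_integrable)
qed

text \<open>Differentiability is obtained in this form throughout: a quadratic error bound
  survives both integration against a locally integrable function and pointwise limits.\<close>

lemma has_derivative_of_quadratic_error:
  assumes L: "bounded_linear L"
    and q: "\<And>h. norm h \<le> 1 \<Longrightarrow> norm (f (y + h) - f y - L h) \<le> K * norm h ^ 2"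
  shows "(f has_derivative L) (at y)"
  unfolding has_derivative_at
proof (intro conjI L)
  have "\<forall>\<^sub>F h in at 0. norm (norm (f (y + h) - f y - L h) / norm h) \<le> K * norm h"
    unfolding eventually_at
  proof (intro exI[of _ 1] conjI ballI impI)
    fix h :: 'a assume h: "h \<noteq> 0 \<and> dist h 0 < 1"
    then have "norm (f (y + h) - f y - L h) \<le> K * norm h * norm h"
      using q[of h] by (simp add: power2_eq_square mult.assoc)
    then show "norm (norm (f (y + h) - f y - L h) / norm h) \<le> K * norm h"
      using h by (simp add: pos_divide_le_eq)
  qed simp
  moreover have "((\<lambda>h::'a. K * norm h) \<longlongrightarrow> 0) (at 0)"
    by (auto intro!: tendsto_eq_intros)
  ultimately show "((\<lambda>h. norm (f (y + h) - f y - L h) / norm h) \<longlongrightarrow> 0) (at 0)"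
    by (rule Lim_null_comparison)
qed

lemma conv_integrable:
  fixes f :: "real^'n::finite \<Rightarrow> real"
  assumes f: "f \<in> bumps" "\<And>x. x \<notin> cball 0 r \<Longrightarrow> f x = 0" and w: "loc_integrable w"
  shows "integrable lebesgue (\<lambda>z. f (y - z) *\<^sub>R w z)"
proof -
  obtain B where B: "\<And>x. \<bar>f x\<bar> \<le> B" "0 \<le> B"
    using bumps_bounded[OF f(1) compact_cball f(2)] by blast
  have eq: "f (y - z) *\<^sub>R w z = f (y - z) *\<^sub>R (indicator (cball y r) z *\<^sub>R w z)" for z
    using f(2)[of "y - z"] by (auto simp: indicator_def dist_norm norm_minus_commute)
  have int: "integrable lebesgue (\<lambda>z. indicator (cball y r) z *\<^sub>R w z)"
    using w unfolding loc_integrable_def set_integrable_def by auto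
  have [measurable]: "(\<lambda>z. f (y - z)) \<in> borel_measurable lebesgue"
    using borel_measurable_continuous_onI[OF bumps_continuous[OF bumps_reflect[OF f(1), of y]]]
    by (simp add: measurable_completion)
  have [measurable]: "(\<lambda>z. indicator (cball y r) z *\<^sub>R w z) \<in> borel_measurable lebesgue"
    using int by auto
  have "integrable lebesgue (\<lambda>z. f (y - z) *\<^sub>R (indicator (cball y r) z *\<^sub>R w z))"
  proof (rule Bochner_Integration.integrable_bound)
    show "integrable lebesgue (\<lambda>z. B *\<^sub>R (indicator (cball y r) z *\<^sub>R w z))"
      using int by (rule integrable_scaleR_right)
    show "AE z in lebesgue. norm (f (y - z) *\<^sub>R (indicator (cball y r) z *\<^sub>R w z))
        \<le> norm (B *\<^sub>R (indicator (cball y r) z *\<^sub>R w z))"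
      using B by (intro AE_I2) (auto simp: abs_mult mult.assoc intro!: mult_right_mono)
  qed measurable
  then show ?thesis by (simp only: eq[symmetric])
qed

lemma bump_partials_off_ball:
  assumes "f \<in> bumps" "\<And>x. x \<notin> cball 0 r \<Longrightarrow> f x = 0" "x \<notin> cball 0 r"
  shows "partials \<alpha>s f x = 0"
  by (rule partials_off_closed[where A = "cball 0 r"]) (use assms in auto)

text \<open>The kernel has bounded second derivatives, so its linearization error is quadratic
  uniformly in the position, and integration against \<open>w\<close> over a fixed ball preserves this.\<close>

lemma conv_has_derivative:
  fixes f :: "real^'n::finite \<Rightarrow> real"
  assumes f: "f \<in> bumps" "\<And>x. x \<notin> cball 0 r \<Longrightarrow> f x = 0" and w: "loc_integrable w"
  shows "(conv f w has_derivative lin (\<lambda>\<alpha>. conv (partial \<alpha> f) w y)) (at y)"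
proof -
  note off = bump_partials_off_ball[OF f]
  have "\<exists>B\<ge>0. \<forall>x. \<bar>partials [\<beta>, \<alpha>] f x\<bar> \<le> B" for \<alpha> \<beta>
    by (rule bumps_bounded[OF bumps_partials[OF f(1)] compact_cball off])
  then have "\<forall>\<alpha>. \<exists>b. \<forall>\<beta>. b \<beta> \<ge> 0 \<and> (\<forall>x. \<bar>partials [\<beta>, \<alpha>] f x\<bar> \<le> b \<beta>)"
    by (intro allI choice) blast
  then have "\<exists>B. \<forall>\<alpha> \<beta>. B \<alpha> \<beta> \<ge> 0 \<and> (\<forall>x. \<bar>partials [\<beta>, \<alpha>] f x\<bar> \<le> B \<alpha> \<beta>)"
    by (rule choice)
  then obtain B where B: "\<And>\<alpha> \<beta>. B \<alpha> \<beta> \<ge> 0" "\<And>\<alpha> \<beta> x. \<bar>partials [\<beta>, \<alpha>] f x\<bar> \<le> B \<alpha> \<beta>"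
    by blast
  define M where "M = (\<Sum>\<alpha>\<in>UNIV. \<Sum>\<beta>\<in>UNIV. B \<alpha> \<beta>)"
  have M: "\<bar>partials [\<beta>, \<alpha>] f x\<bar> \<le> M" for \<alpha> \<beta> x
  proof -
    have "B \<alpha> \<beta> \<le> (\<Sum>\<beta>\<in>UNIV. B \<alpha> \<beta>)" by (rule member_le_sum) (auto simp: B)
    also have "\<dots> \<le> M" unfolding M_def by (rule member_le_sum) (auto simp: B sum_nonneg)
    finally show ?thesis using B(2) order_trans by blast
  qed
  have M0: "0 \<le> M" using order_trans[OF abs_ge_zero M] .
  have lip: "\<bar>f (a + h) - f a - lin (\<lambda>\<alpha>. partial \<alpha> f a) h\<bar> \<le> real CARD('n) ^ 2 * M * norm h ^ 2" for a h
  proof -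
    have "norm (f (a + h) - f a - lin (\<lambda>\<alpha>. partial \<alpha> f a) h) \<le> real CARD('n) ^ 2 * M * norm h ^ 2"
      by (rule linearization_error_bound[where C = UNIV and ?f2.0 = "\<lambda>\<beta> \<alpha>. partial \<beta> (partial \<alpha> f)"])
        (use M f(1) in \<open>auto intro!: bumps_has_derivative bumps_partial\<close>)
    then show ?thesis by simp
  qed
  define I where "I = (LINT z|lebesgue. norm (indicator (cball y (r + 1)) z *\<^sub>R w z))"
  have int: "integrable lebesgue (\<lambda>z. indicator (cball y (r + 1)) z *\<^sub>R w z)"
    using w unfolding loc_integrable_def set_integrable_def by auto
  show ?thesis
  proof (rule has_derivative_of_quadratic_error[OF bounded_linear_lin])
    fix h :: "real^'n" assume h: "norm h \<le> 1"
    define e where "e z = (f (y + h - z) - f (y - z) - lin (\<lambda>\<alpha>. partial \<alpha> f (y - z)) h) *\<^sub>R w z" for z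
    have i1: "integrable lebesgue (\<lambda>z. f (y - z) *\<^sub>R w z)" for y
      by (rule conv_integrable[OF f w])
    have i2: "integrable lebesgue (\<lambda>z. partial \<alpha> f (y - z) *\<^sub>R w z)" for \<alpha> y
      by (rule conv_integrable[OF bumps_partial[OF f(1)] _ w]) (use off[where \<alpha>s = "[\<alpha>]"] in auto)
    have i3: "integrable lebesgue (\<lambda>z. lin (\<lambda>\<alpha>. partial \<alpha> f (y - z)) h *\<^sub>R w z)"
      unfolding lin_def scaleR_sum_left using i2
      by (auto intro!: Bochner_Integration.integrable_sum simp flip: scaleR_scaleR)
    have "lin (\<lambda>\<alpha>. conv (partial \<alpha> f) w y) h = (LINT z|lebesgue. lin (\<lambda>\<alpha>. partial \<alpha> f (y - z)) h *\<^sub>R w z)"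
      unfolding lin_def scaleR_sum_left conv_def using i2
      by (subst Bochner_Integration.integral_sum) (auto simp flip: scaleR_scaleR)
    then have "conv f w (y + h) - conv f w y - lin (\<lambda>\<alpha>. conv (partial \<alpha> f) w y) h = (LINT z|lebesgue. e z)"
      unfolding conv_def e_def scaleR_diff_left using i1 i3 by simp
    also have "norm \<dots> \<le> (LINT z|lebesgue. (real CARD('n) ^ 2 * M * norm h ^ 2) * norm (indicator (cball y (r + 1)) z *\<^sub>R w z))"
    proof (rule order_trans[OF integral_norm_bound integral_mono])
      show "integrable lebesgue (\<lambda>z. norm (e z))" unfolding e_def scaleR_diff_left using i1 i3 by simp
      show "integrable lebesgue (\<lambda>z. (real CARD('n) ^ 2 * M * norm h ^ 2) * norm (indicator (cball y (r + 1)) z *\<^sub>R w z))"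
        by (intro integrable_mult_right integrable_norm int)
      fix z
      show "norm (e z) \<le> (real CARD('n) ^ 2 * M * norm h ^ 2) * norm (indicator (cball y (r + 1)) z *\<^sub>R w z)"
      proof (cases "z \<in> cball y (r + 1)")
        case True
        then show ?thesis
          using mult_right_mono[OF lip[of "y - z" h] norm_ge_zero[of "w z"]]
          by (simp add: e_def diff_add_eq True[unfolded mem_cball])
      next
        case False
        then have 1: "norm (y - z) > r + 1" by (simp add: dist_norm)
        have 2: "norm (y + h - z) > r"
          using norm_triangle_ineq4[of "y + h - z" h] 1 h by (simp add: algebra_simps)
        have "partial \<alpha> f (y - z) = 0" for \<alpha> using off[where x = "y - z" and \<alpha>s = "[\<alpha>]"] 1 by auto
        then show ?thesis using f(2)[of "y - z"] f(2)[of "y + h - z"] 1 2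
          using M0 by (simp add: e_def lin_def)
      qed
    qed
    also have "\<dots> = (real CARD('n) ^ 2 * M * I) * norm h ^ 2"
      by (simp add: I_def)
    finally show "norm (conv f w (y + h) - conv f w y - lin (\<lambda>\<alpha>. conv (partial \<alpha> f) w y) h)
        \<le> (real CARD('n) ^ 2 * M * I) * norm h ^ 2" .
  qed
qed

lemma partials_conv:
  assumes f: "f \<in> bumps" "\<And>x. x \<notin> cball 0 r \<Longrightarrow> f x = 0" and w: "loc_integrable w"
  shows "partials \<alpha>s (conv f w) = conv (partials \<alpha>s f) w"
proof (induction \<alpha>s)
  case (Cons \<alpha> \<alpha>s)
  have "partial \<alpha> (conv (partials \<alpha>s f) w) = conv (partial \<alpha> (partials \<alpha>s f)) w"
    by (intro ext lin_eq_imp_partial conv_has_derivative[OF bumps_partials[OF f(1)] _ w]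
        bump_partials_off_ball[OF f])
  then show ?case by (simp add: Cons)
qed simp

text \<open>For fixed \<open>y\<close> the reflected kernel \<open>z \<mapsto> f (y - z)\<close> is a test function, so derivatives
  of the convolution are convolutions with the weak derivative.\<close>

lemma conv_weak_deriv:
  assumes f: "f \<in> bumps" "\<And>x. x \<notin> cball 0 r \<Longrightarrow> f x = 0" and g: "has_weak_deriv \<alpha>s w g"
  shows "conv (partials \<alpha>s f) w y = conv f g y"
proof -
  have "test_function (\<lambda>z. f (y - z))"
    by (rule test_function_bump[OF bumps_reflect[OF f(1)], of "cball y r"])
      (use f(2) in \<open>auto simp: dist_norm norm_minus_commute\<close>)
  then have "(LINT z|lebesgue. partials \<alpha>s (\<lambda>z. f (y - z)) z *\<^sub>R w z) =
      (-1) ^ length \<alpha>s *\<^sub>R (LINT z|lebesgue. f (y - z) *\<^sub>R g z)"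
    using g unfolding has_weak_deriv_def by blast
  then have "(-1) ^ length \<alpha>s *\<^sub>R conv (partials \<alpha>s f) w y = (-1) ^ length \<alpha>s *\<^sub>R conv f g y"
    by (simp add: partials_reflect[OF f(1)] conv_def flip: scaleR_scaleR)
  then show ?thesis by simp
qed

definition mollifier :: "real \<Rightarrow> (real^'n::finite \<Rightarrow> real) \<Rightarrow> bool" where
  "mollifier r \<eta> \<longleftrightarrow> \<eta> \<in> bumps \<and> (\<forall>x. 0 \<le> \<eta> x) \<and> (\<forall>x. x \<notin> cball 0 r \<longrightarrow> \<eta> x = 0) \<and>
    (\<forall>y. integrable lebesgue (\<lambda>z. \<eta> (y - z)) \<and> (LINT z|lebesgue. \<eta> (y - z)) = 1)"

lemma mollifier_exists: "0 < r \<Longrightarrow> \<exists>\<eta> :: real^'n::finite \<Rightarrow> real. mollifier r \<eta>"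
proof -
  assume "0 < r"
  then obtain \<eta> :: "real^'n::finite \<Rightarrow> real" where \<eta>: "\<eta> \<in> bumps" "\<forall>x. 0 \<le> \<eta> x"
    "\<forall>x. x \<notin> cball 0 r \<longrightarrow> \<eta> x = 0" "integrable lebesgue \<eta>" "(LINT x|lebesgue. \<eta> x) = 1"
    using exists_mollifier by blast
  have [measurable]: "\<eta> \<in> borel_measurable borel"
    using borel_measurable_continuous_onI bumps_continuous[OF \<eta>(1)] by blast
  have 1: "(\<lambda>z. \<eta> (y - z)) \<in> borel_measurable borel" for y by measurable
  have lb: "lborel = distr lborel borel (\<lambda>z::real^'n. y - z)" for y :: "real^'n"
    using lborel_affine[of "-1" y] by (simp add: density_1)
  have "(LINT z|lebesgue. \<eta> (y - z)) = 1 \<and> integrable lebesgue (\<lambda>z. \<eta> (y - z))" for y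
  proof -
    have "(LINT z|lebesgue. \<eta> (y - z)) = (LINT z|lborel. \<eta> (y - z))"
      by (rule integral_completion) (simp add: 1)
    also have "\<dots> = (LINT z|distr lborel borel (\<lambda>z. y - z). \<eta> z)"
      by (subst integral_distr) auto
    also have "\<dots> = (LINT z|lborel. \<eta> z)" using lb[of y] by simp
    also have "\<dots> = 1" using \<eta>(5) by (simp add: integral_completion)
    finally have int1: "(LINT z|lebesgue. \<eta> (y - z)) = 1" .
    then have "integrable lebesgue (\<lambda>z. \<eta> (y - z))"
      using not_integrable_integral_eq by fastforce
    with int1 show ?thesis by simp
  qed
  then show ?thesis using \<eta> unfolding mollifier_def by blast
qed

lemma mollifier_bumps: "mollifier r \<eta> \<Longrightarrow> \<eta> \<in> bumps"
  and mollifier_off: "mollifier r \<eta> \<Longrightarrow> x \<notin> cball 0 r \<Longrightarrow> \<eta> x = 0"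
  by (auto simp: mollifier_def)

text \<open>A mollification is an average, so essential bounds become pointwise bounds.\<close>

lemma norm_conv_mollifier_le:
  assumes \<eta>: "mollifier r \<eta>" and w: "loc_integrable w"
    and B: "AE z in lebesgue. z \<in> cball y r \<longrightarrow> norm (w z) \<le> B"
  shows "norm (conv \<eta> w y) \<le> B"
proof -
  have "norm (conv \<eta> w y) \<le> (LINT z|lebesgue. norm (\<eta> (y - z) *\<^sub>R w z))"
    unfolding conv_def by (rule integral_norm_bound)
  also have "\<dots> \<le> (LINT z|lebesgue. B * \<eta> (y - z))"
  proof (rule integral_mono_AE)
    show "integrable lebesgue (\<lambda>z. norm (\<eta> (y - z) *\<^sub>R w z))"
      by (rule integrable_norm[OF conv_integrable[OF mollifier_bumps[OF \<eta>] mollifier_off[OF \<eta>] w]])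
    show "integrable lebesgue (\<lambda>z. B * \<eta> (y - z))"
      using \<eta> by (auto simp: mollifier_def)
    show "AE z in lebesgue. norm (\<eta> (y - z) *\<^sub>R w z) \<le> B * \<eta> (y - z)"
      using B
    proof eventually_elim
      case (elim z)
      show ?case
      proof (cases "z \<in> cball y r")
        case True
        then have "norm (w z) \<le> B" using elim by blast
        moreover have "0 \<le> \<eta> (y - z)" using \<eta> by (simp add: mollifier_def)
        ultimately show ?thesis by (simp add: mult.commute mult_right_mono)
      next
        case False
        then have "\<eta> (y - z) = 0" by (intro mollifier_off[OF \<eta>]) (simp add: dist_norm norm_minus_commute)
        then show ?thesis by simp
      qed
    qed
  qed
  also have "\<dots> = B" using \<eta> by (simp add: mollifier_def)
  finally show ?thesis .
qed

lemma conv_mollifier_tendsto: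
  assumes \<eta>: "\<And>n. mollifier (inverse (real (Suc n))) (\<eta> n)" and w: "continuous_on UNIV w"
  shows "(\<lambda>n. conv (\<eta> n) w y) \<longlonglongrightarrow> w y"
proof (rule LIMSEQ_I)
  fix e :: real assume e: "0 < e"
  obtain d where d: "d > 0" "\<And>z. dist z y < d \<Longrightarrow> dist (w z) (w y) < e / 2"
    using w[unfolded continuous_on_iff] e by (metis UNIV_I half_gt_zero)
  obtain N where N: "inverse (real (Suc N)) < d" using reals_Archimedean[OF d(1)] by blast
  show "\<exists>N. \<forall>n\<ge>N. norm (conv (\<eta> n) w y - w y) < e"
  proof (intro exI allI impI)
    fix n assume "N \<le> n"
    then have r: "inverse (real (Suc n)) < d"
      using N by (smt (verit, best) le_imp_inverse_le of_nat_0_less_iff of_nat_mono Suc_le_mono zero_less_Suc)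
    have lw: "loc_integrable w" by (rule continuous_imp_loc_integrable[OF w])
    have lc: "loc_integrable (\<lambda>z. w y)" "loc_integrable (\<lambda>z. w z - w y)"
      by (intro continuous_imp_loc_integrable continuous_intros w)+
    have "conv (\<eta> n) (\<lambda>z. w z - w y) y = conv (\<eta> n) w y - (LINT z|lebesgue. \<eta> n (y - z)) *\<^sub>R w y"
      unfolding conv_def scaleR_diff_right
      using conv_integrable[OF mollifier_bumps[OF \<eta>[of n]] mollifier_off[OF \<eta>[of n]]] lw lc(1)
      \<eta>[of n] by (subst Bochner_Integration.integral_diff) (auto simp: mollifier_def)
    then have "conv (\<eta> n) w y - w y = conv (\<eta> n) (\<lambda>z. w z - w y) y"
      using \<eta>[of n] by (simp add: mollifier_def)
    also have "norm \<dots> \<le> e / 2"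
    proof (rule norm_conv_mollifier_le[OF \<eta> lc(2)], intro AE_I2 impI)
      fix z assume "z \<in> cball y (inverse (real (Suc n)))"
      then have "dist z y < d" using r by (simp add: dist_commute)
      then show "norm (w z - w y) \<le> e / 2" using d(2)[of z] by (simp add: dist_norm)
    qed
    also have "\<dots> < e" using e by simp
    finally show "norm (conv (\<eta> n) w y - w y) < e" .
  qed
qed

text \<open>A bound on second derivatives makes difference quotients approximate first derivatives
  uniformly in \<open>n\<close>. Pointwise convergence of the functions therefore forces the first
  derivatives to be Cauchy, and the quadratic error bound passes to the limit.\<close>

lemma limit_of_derivatives:
  fixes f :: "nat \<Rightarrow> real^'n::finite \<Rightarrow> 'b::banach"
  assumes f: "\<And>n y. (f n has_derivative lin (\<lambda>\<alpha>. f1 n \<alpha> y)) (at y)"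
    and f1: "\<And>n \<alpha> y. (f1 n \<alpha> has_derivative lin (\<lambda>\<beta>. f2 n \<beta> \<alpha> y)) (at y)"
    and lim: "\<And>z. (\<lambda>n. f n z) \<longlonglongrightarrow> g z"
    and M: "\<And>n \<alpha> \<beta> z. z \<in> cball y 1 \<Longrightarrow> norm (f2 n \<beta> \<alpha> z) \<le> M"
  shows "convergent (\<lambda>n. f1 n \<alpha> y)"
    and "(g has_derivative lin (\<lambda>\<alpha>. Lim sequentially (\<lambda>n. f1 n \<alpha> y))) (at y)"
proof -
  define K where "K = real CARD('n) ^ 2 * M"
  have "norm (f2 undefined undefined undefined y) \<le> M" by (rule M) simp
  then have M0: "0 \<le> M" using norm_ge_zero order_trans by blast
  then have K0: "0 \<le> K" by (simp add: K_def)
  have err: "norm (f n (y + h) - f n y - lin (\<lambda>\<alpha>. f1 n \<alpha> y) h) \<le> K * norm h ^ 2" if "norm h \<le> 1" for n h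
    unfolding K_def
    by (rule linearization_error_bound[where C = "cball y 1", OF f f1 M]) (use that in \<open>auto simp: dist_norm\<close>)
  show conv: "convergent (\<lambda>n. f1 n \<alpha> y)" for \<alpha>
  proof (rule Cauchy_convergent, rule CauchyI)
    fix e :: real assume e: "0 < e"
    \<comment> \<open>The step length makes the error of the difference quotient at most \<open>e / 4\<close>.\<close>
    define t where "t = min 1 (e / (4 * (K + 1)))"
    have t: "0 < t" "t \<le> 1" "K * t \<le> e / 4"
    proof -
      show "0 < t" "t \<le> 1" using e K0 by (auto simp: t_def)
      have "K * t \<le> (K + 1) * (e / (4 * (K + 1)))"
        using K0 e by (intro mult_mono) (auto simp: t_def)
      also have "\<dots> = e / 4" using K0 by (simp add: field_simps)
      finally show "K * t \<le> e / 4" .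
    qed
    define d where "d = (\<lambda>n. f n (y + t *\<^sub>R axis \<alpha> 1) - f n y)"
    have "Cauchy d"
      unfolding d_def by (rule LIMSEQ_imp_Cauchy[OF tendsto_diff[OF lim lim]])
    then obtain N where N: "\<And>m n. m \<ge> N \<Longrightarrow> n \<ge> N \<Longrightarrow> norm (d m - d n) < t * (e / 4)"
      using e t by (metis CauchyD mult_pos_pos zero_less_divide_iff zero_less_numeral)
    have "norm (f1 m \<alpha> y - f1 n \<alpha> y) < e" if mn: "m \<ge> N" "n \<ge> N" for m n
    proof -
      have ax: "norm (t *\<^sub>R axis \<alpha> 1 :: real^'n) = t" using t by simp
      have *: "norm (d n - t *\<^sub>R f1 n \<alpha> y) \<le> t * (e / 4)" for n
      proof -
        have "norm (d n - t *\<^sub>R f1 n \<alpha> y) \<le> K * t ^ 2"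
          using err[of "t *\<^sub>R axis \<alpha> 1" n] t unfolding ax by (simp add: d_def lin_simps)
        also have "\<dots> \<le> t * (e / 4)"
          using mult_left_mono[OF t(3), of t] t by (simp add: power2_eq_square mult_ac)
        finally show ?thesis .
      qed
      have "norm (t *\<^sub>R f1 m \<alpha> y - t *\<^sub>R f1 n \<alpha> y)
          = norm ((d m - d n) - (d m - t *\<^sub>R f1 m \<alpha> y) + (d n - t *\<^sub>R f1 n \<alpha> y))" by simp
      also have "\<dots> \<le> norm (d m - d n) + norm (d m - t *\<^sub>R f1 m \<alpha> y) + norm (d n - t *\<^sub>R f1 n \<alpha> y)"
        by (meson add_mono_thms_linordered_semiring(3) norm_triangle_ineq norm_triangle_ineq4 order_trans)
      also have "\<dots> < t * (e / 4) + t * (e / 4) + t * (e / 4)"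
        using N[OF mn] *[of m] *[of n] by linarith
      also have "\<dots> \<le> t * e" using e t by (simp add: field_simps)
      finally show ?thesis using t by (simp flip: scaleR_diff_right)
    qed
    then show "\<exists>N. \<forall>m\<ge>N. \<forall>n\<ge>N. norm (f1 m \<alpha> y - f1 n \<alpha> y) < e" by blast
  qed
  define g1 where "g1 = (\<lambda>\<alpha>. Lim sequentially (\<lambda>n. f1 n \<alpha> y))"
  have l1: "(\<lambda>n. f1 n \<alpha> y) \<longlonglongrightarrow> g1 \<alpha>" for \<alpha>
    using conv[of \<alpha>] by (simp add: g1_def convergent_LIMSEQ_iff)
  show "(g has_derivative lin (\<lambda>\<alpha>. Lim sequentially (\<lambda>n. f1 n \<alpha> y))) (at y)"
    unfolding g1_def[symmetric]
  proof (rule has_derivative_of_quadratic_error[OF bounded_linear_lin])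
    fix h :: "real^'n" assume h: "norm h \<le> 1"
    have "(\<lambda>n. norm (f n (y + h) - f n y - lin (\<lambda>\<alpha>. f1 n \<alpha> y) h)) \<longlonglongrightarrow> norm (g (y + h) - g y - lin g1 h)"
      unfolding lin_def by (intro tendsto_intros lim l1)
    then show "norm (g (y + h) - g y - lin g1 h) \<le> K * norm h ^ 2"
      by (rule LIMSEQ_le_const2) (use err[OF h] in auto)
  qed
qed


section \<open>Pointwise derivatives of Sobolev functions\<close>

lemma Linf_norm_AE:
  assumes A: "A \<in> sets lebesgue" and B: "0 \<le> B" "Linf_norm A f \<le> ennreal B"
  shows "AE z in lebesgue. z \<in> A \<longrightarrow> norm (f z) \<le> B"
proof -
  have "AE z in restrict_space lebesgue A. ennreal (norm (f z)) \<le> Linf_norm A f"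
    unfolding Linf_norm_def by (rule esssup_AE)
  then have "AE z in restrict_space lebesgue A. norm (f z) \<le> B"
  proof eventually_elim
    case (elim z)
    then have "ennreal (norm (f z)) \<le> ennreal B" using B(2) by (rule order_trans)
    then show ?case using B(1) by simp
  qed
  then show ?thesis using A by (subst (asm) AE_restrict_space_iff) auto
qed

text \<open>The partial derivatives of the mollifications of \<open>u\<close>, and their pointwise limits,
  which will turn out to be the classical partial derivatives of \<open>u\<close>.\<close>

definition mollified :: "(nat \<Rightarrow> real^'n \<Rightarrow> real) \<Rightarrow> (real^'n::finite \<Rightarrow> 'b::euclidean_space) \<Rightarrow>
    'n list \<Rightarrow> nat \<Rightarrow> real^'n \<Rightarrow> 'b" where
  "mollified \<eta> u \<alpha>s n = partials \<alpha>s (conv (\<eta> n) u)"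

definition jet :: "(nat \<Rightarrow> real^'n \<Rightarrow> real) \<Rightarrow> (real^'n::finite \<Rightarrow> 'b::euclidean_space) \<Rightarrow> 'n list \<Rightarrow> real^'n \<Rightarrow> 'b" where
  "jet \<eta> u \<alpha>s y = Lim sequentially (\<lambda>n. mollified \<eta> u \<alpha>s n y)"

context
  fixes \<eta> :: "nat \<Rightarrow> real^'n::finite \<Rightarrow> real" and u :: "real^'n \<Rightarrow> 'b::euclidean_space"
  assumes \<eta>: "\<And>n. mollifier (inverse (real (Suc n))) (\<eta> n)"
    and u: "continuous_on UNIV u"
begin

lemma mollified_has_derivative:
  "(mollified \<eta> u \<alpha>s n has_derivative lin (\<lambda>\<alpha>. mollified \<eta> u (\<alpha> # \<alpha>s) n y)) (at y)"
proof -
  note mo = mollifier_bumps[OF \<eta>[of n]] mollifier_off[OF \<eta>[of n]]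
  have off: "x \<notin> cball 0 (inverse (real (Suc n))) \<Longrightarrow> partials \<alpha>s (\<eta> n) x = 0" for x \<alpha>s
    by (rule bump_partials_off_ball[OF mo])
  have lu: "loc_integrable u" by (rule continuous_imp_loc_integrable[OF u])
  have "mollified \<eta> u \<alpha>s n = conv (partials \<alpha>s (\<eta> n)) u" for \<alpha>s
    unfolding mollified_def by (rule partials_conv[OF mo lu])
  then show ?thesis
    using conv_has_derivative[OF bumps_partials[OF mo(1)] off lu] by simp
qed

lemma mollified_eq_conv:
  "has_weak_deriv \<alpha>s u g \<Longrightarrow> mollified \<eta> u \<alpha>s n y = conv (\<eta> n) g y"
  unfolding mollified_def
  using partials_conv[OF mollifier_bumps[OF \<eta>[of n]] mollifier_off[OF \<eta>[of n]] continuous_imp_loc_integrable[OF u]]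
  conv_weak_deriv[OF mollifier_bumps[OF \<eta>[of n]] mollifier_off[OF \<eta>[of n]]] by metis

lemma norm_mollified_le:
  assumes g: "has_weak_deriv \<alpha>s u g" and B: "AE z in lebesgue. z \<in> A \<longrightarrow> norm (g z) \<le> B"
    and A: "cball y (inverse (real (Suc n))) \<subseteq> A"
  shows "norm (mollified \<eta> u \<alpha>s n y) \<le> B"
  unfolding mollified_eq_conv[OF g]
proof (rule norm_conv_mollifier_le[OF \<eta>])
  show "loc_integrable g" using g by (auto simp: loc_integrable_def has_weak_deriv_def)
  show "AE z in lebesgue. z \<in> cball y (inverse (real (Suc n))) \<longrightarrow> norm (g z) \<le> B"
    using B by eventually_elim (use A in auto)
qed

text \<open>Qualitative bounds use the locally bounded weak derivative provided by the Sobolev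
  space. The quantitative bounds further below concern the weak derivative chosen in
  \<^const>\<open>weak_deriv\<close>; since both have the same mollifications, they bound the same
  limits.\<close>

lemma mollified_loc_bounded:
  assumes u4: "sobolev_inf_loc m u" and l: "length \<alpha>s \<le> m"
  shows "\<exists>M. \<forall>n. \<forall>z\<in>cball y 1. norm (mollified \<eta> u \<alpha>s n z) \<le> M"
proof -
  obtain g where g: "has_weak_deriv \<alpha>s u g" "\<And>A. compact A \<Longrightarrow> Linf_norm A g < \<infinity>"
    using u4 l unfolding sobolev_inf_loc_def by blast
  define B where "B = enn2real (Linf_norm (cball y 2) g)"
  have AE: "AE z in lebesgue. z \<in> cball y 2 \<longrightarrow> norm (g z) \<le> B"
    by (rule Linf_norm_AE) (use g(2)[of "cball y 2"] in \<open>auto simp: B_def ennreal_enn2real_if\<close>)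
  have "norm (mollified \<eta> u \<alpha>s n z) \<le> B" if z: "z \<in> cball y 1" for n z
  proof (rule norm_mollified_le[OF g(1) AE])
    have "inverse (real (Suc n)) \<le> 1" by (simp add: inverse_le_1_iff)
    moreover have "dist y w \<le> dist y z + dist z w" for w by (rule dist_triangle)
    ultimately show "cball z (inverse (real (Suc n))) \<subseteq> cball y 2"
      using z by (auto simp: subset_iff) (smt (verit))
  qed
  then show ?thesis by blast
qed

lemma mollified_loc_bounded_uniform:
  assumes u4: "sobolev_inf_loc m u" and l: "length \<alpha>s + 2 \<le> m"
  shows "\<exists>M. \<forall>n \<alpha> \<beta>. \<forall>z\<in>cball y 1. norm (mollified \<eta> u (\<beta> # \<alpha> # \<alpha>s) n z) \<le> M"
proof -
  have "\<forall>p. \<exists>M. \<forall>n. \<forall>z\<in>cball y 1. norm (mollified \<eta> u (fst p # snd p # \<alpha>s) n z) \<le> M"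
    using mollified_loc_bounded[OF u4] l by simp
  then obtain M where M: "\<And>p n z. z \<in> cball y 1 \<Longrightarrow> norm (mollified \<eta> u (fst p # snd p # \<alpha>s) n z) \<le> M p"
    by (metis (no_types))
  have "norm (mollified \<eta> u (\<beta> # \<alpha> # \<alpha>s) n z) \<le> (\<Sum>p\<in>UNIV. \<bar>M p\<bar>)" if "z \<in> cball y 1" for n \<alpha> \<beta> z
  proof -
    have "norm (mollified \<eta> u (\<beta> # \<alpha> # \<alpha>s) n z) \<le> \<bar>M (\<beta>, \<alpha>)\<bar>"
      using order_trans[OF M[where p = "(\<beta>, \<alpha>)" and n = n, OF that] abs_ge_self] by simp
    also have "\<dots> \<le> (\<Sum>p\<in>UNIV. \<bar>M p\<bar>)" by (rule member_le_sum) auto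
    finally show ?thesis .
  qed
  then show ?thesis by blast
qed

lemma jet_Nil: "jet \<eta> u [] = u"
  unfolding jet_def mollified_def
  using conv_mollifier_tendsto[OF \<eta> u] by (auto intro!: tendsto_Lim)

text \<open>By induction on the order: convergence of a derivative of the next order follows from
  convergence of the present one and bounds on the order after it.\<close>

lemma jet_tendsto:
  assumes u4: "sobolev_inf_loc m u"
  shows "length \<alpha>s < m \<Longrightarrow> (\<lambda>n. mollified \<eta> u \<alpha>s n y) \<longlonglongrightarrow> jet \<eta> u \<alpha>s y"
proof (induction \<alpha>s arbitrary: y)
  case Nil
  then show ?case using conv_mollifier_tendsto[OF \<eta> u] jet_Nil by (simp add: mollified_def)
next
  case (Cons \<alpha> \<alpha>s)
  obtain M where M: "\<forall>n \<alpha> \<beta>. \<forall>z\<in>cball y 1. norm (mollified \<eta> u (\<beta> # \<alpha> # \<alpha>s) n z) \<le> M"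
    using mollified_loc_bounded_uniform[OF u4, of \<alpha>s y] Cons.prems by (metis add_2_eq_Suc' length_Cons less_eq_Suc_le)
  have "convergent (\<lambda>n. mollified \<eta> u (\<alpha> # \<alpha>s) n y)"
    by (rule limit_of_derivatives(1)[where f = "mollified \<eta> u \<alpha>s" and ?f1.0 = "\<lambda>n \<alpha>. mollified \<eta> u (\<alpha> # \<alpha>s) n"
          and ?f2.0 = "\<lambda>n \<beta> \<alpha>. mollified \<eta> u (\<beta> # \<alpha> # \<alpha>s) n" and M = M])
      (use M Cons in \<open>auto intro: mollified_has_derivative\<close>)
  then show ?case by (simp add: jet_def convergent_LIMSEQ_iff)
qed

lemma jet_has_derivative:
  assumes u4: "sobolev_inf_loc m u" and l: "length \<alpha>s + 2 \<le> m"
  shows "(jet \<eta> u \<alpha>s has_derivative lin (\<lambda>\<alpha>. jet \<eta> u (\<alpha> # \<alpha>s) y)) (at y)"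
proof -
  obtain M where M: "\<forall>n \<alpha> \<beta>. \<forall>z\<in>cball y 1. norm (mollified \<eta> u (\<beta> # \<alpha> # \<alpha>s) n z) \<le> M"
    using mollified_loc_bounded_uniform[OF u4 l] by metis
  show ?thesis
    unfolding jet_def[of \<eta> u "_ # _"]
    by (rule limit_of_derivatives(2)[where f = "mollified \<eta> u \<alpha>s" and ?f1.0 = "\<lambda>n \<alpha>. mollified \<eta> u (\<alpha> # \<alpha>s) n"
          and ?f2.0 = "\<lambda>n \<beta> \<alpha>. mollified \<eta> u (\<beta> # \<alpha> # \<alpha>s) n" and M = M])
      (use M l in \<open>auto intro: mollified_has_derivative jet_tendsto[OF u4]\<close>)
qed

lemma weak_deriv_works:
  assumes u4: "sobolev_inf_loc m u" and l: "length \<alpha>s \<le> m"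
  shows "has_weak_deriv \<alpha>s u (weak_deriv \<alpha>s u)"
  unfolding weak_deriv_def using u4 l unfolding sobolev_inf_loc_def by (metis someI_ex)

lemma weak_deriv_AE_le:
  assumes "closed A" "0 \<le> B" "Linf_norm A (grad_norm (length \<alpha>s) u) \<le> ennreal B"
  shows "AE z in lebesgue. z \<in> A \<longrightarrow> norm (weak_deriv \<alpha>s u z) \<le> B"
proof -
  have fin: "finite {\<alpha>s' :: 'n list. length \<alpha>s' = length \<alpha>s}"
    using finite_lists_length_eq[of "UNIV :: 'n set"] by simp
  have A: "A \<in> sets lebesgue" using assms(1) by auto
  show ?thesis
    using Linf_norm_AE[OF A assms(2,3)]
  proof eventually_elim
    case (elim z)
    have "norm (weak_deriv \<alpha>s u z) \<le> grad_norm (length \<alpha>s) u z"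
      unfolding grad_norm_def by (rule member_le_L2_set[OF fin]) simp
    then show ?case using elim by auto
  qed
qed

lemma eventually_cball_subset:
  assumes "0 < r" "cball y r \<subseteq> A"
  shows "\<forall>\<^sub>F n in sequentially. cball y (inverse (real (Suc n))) \<subseteq> A"
proof -
  have "\<forall>\<^sub>F n in sequentially. inverse (real (Suc n)) < r"
    using order_tendstoD(2)[OF LIMSEQ_inverse_real_of_nat assms(1)] .
  then show ?thesis
    by eventually_elim (use assms(2) in \<open>auto intro: less_imp_le order_trans\<close>)
qed

lemma norm_jet_le:
  assumes u4: "sobolev_inf_loc m u" and l: "length \<alpha>s < m"
    and A: "closed A" "0 < r" "cball y r \<subseteq> A"
    and B: "0 \<le> B" "Linf_norm A (grad_norm (length \<alpha>s) u) \<le> ennreal B"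
  shows "norm (jet \<eta> u \<alpha>s y) \<le> B"
proof (rule tendsto_upperbound[OF tendsto_norm[OF jet_tendsto[OF u4 l]]])
  show "\<forall>\<^sub>F n in sequentially. norm (mollified \<eta> u \<alpha>s n y) \<le> B"
    using eventually_cball_subset[OF A(2,3)]
    by eventually_elim
      (rule norm_mollified_le[OF weak_deriv_works[OF u4 less_imp_le[OF l]] weak_deriv_AE_le[OF A(1) B]])
qed simp

lemma jet_lipschitz:
  assumes u4: "sobolev_inf_loc (Suc (length \<alpha>s)) u"
    and A: "closed A" "0 < r" "\<And>z. z \<in> closed_segment y y' \<Longrightarrow> cball z r \<subseteq> A"
    and B: "0 \<le> B" "Linf_norm A (grad_norm (Suc (length \<alpha>s)) u) \<le> ennreal B"
  shows "norm (jet \<eta> u \<alpha>s y' - jet \<eta> u \<alpha>s y) \<le> real CARD('n) * (norm (y' - y) * B)"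
proof (rule tendsto_upperbound)
  show "(\<lambda>n. norm (mollified \<eta> u \<alpha>s n y' - mollified \<eta> u \<alpha>s n y))
      \<longlonglongrightarrow> norm (jet \<eta> u \<alpha>s y' - jet \<eta> u \<alpha>s y)"
    by (intro tendsto_intros jet_tendsto[OF u4]) auto
  have "\<forall>\<^sub>F n in sequentially. inverse (real (Suc n)) < r"
    using order_tendstoD(2)[OF LIMSEQ_inverse_real_of_nat A(2)] .
  then show "\<forall>\<^sub>F n in sequentially. norm (mollified \<eta> u \<alpha>s n y' - mollified \<eta> u \<alpha>s n y)
      \<le> real CARD('n) * (norm (y' - y) * B)"
  proof eventually_elim
    case (elim n)
    have bd: "norm (mollified \<eta> u (\<alpha> # \<alpha>s) n z) \<le> B" if "z \<in> closed_segment y y'" for z \<alpha>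
    proof (rule norm_mollified_le[OF weak_deriv_works[OF u4] weak_deriv_AE_le[OF A(1) B(1)]])
      show "cball z (inverse (real (Suc n))) \<subseteq> A"
        using A(3)[OF that] elim by (auto intro: less_imp_le order_trans)
    qed (use B in auto)
    have "norm (mollified \<eta> u \<alpha>s n (y + 1 *\<^sub>R (y' - y)) - mollified \<eta> u \<alpha>s n (y + 0 *\<^sub>R (y' - y)))
        \<le> real CARD('n) * (norm (y' - y) * B)"
    proof (rule interval_mean_value_bound)
      fix t :: real assume t: "t \<in> {0..1}"
      show "((\<lambda>t. mollified \<eta> u \<alpha>s n (y + t *\<^sub>R (y' - y))) has_vector_derivative
          lin (\<lambda>\<alpha>. mollified \<eta> u (\<alpha> # \<alpha>s) n (y + t *\<^sub>R (y' - y))) (y' - y)) (at t within {0..1})"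
        by (rule has_derivative_along_line[OF mollified_has_derivative])
      have "y + t *\<^sub>R (y' - y) \<in> closed_segment y y'"
        using t by (auto simp: in_segment algebra_simps intro!: exI[of _ t])
      then show "norm (lin (\<lambda>\<alpha>. mollified \<eta> u (\<alpha> # \<alpha>s) n (y + t *\<^sub>R (y' - y))) (y' - y))
          \<le> real CARD('n) * (norm (y' - y) * B)"
        by (intro norm_lin_le bd)
    qed simp
    then show ?case by simp
  qed
qed simp

text \<open>Here the sharp constant matters, since it keeps the gradient inside the ball on which
  \<open>V\<close> is smooth. The Cauchy--Schwarz inequality is applied under the integral, to the
  Frobenius norm of the weak gradient.\<close>

lemma norm_gradient_le:
  assumes u1: "sobolev_inf_loc m u" "1 < m" and \<kappa>: "0 \<le> \<kappa>" "Linf_norm UNIV (grad_norm 1 u) \<le> ennreal \<kappa>"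
  shows "norm (lin (\<lambda>\<alpha>. jet \<eta> u [\<alpha>] y) h) \<le> \<kappa> * norm h"
proof (rule tendsto_upperbound)
  show "(\<lambda>n. norm (lin (\<lambda>\<alpha>. mollified \<eta> u [\<alpha>] n y) h)) \<longlonglongrightarrow> norm (lin (\<lambda>\<alpha>. jet \<eta> u [\<alpha>] y) h)"
    unfolding lin_def by (intro tendsto_intros jet_tendsto[OF u1(1)]) (use u1 in auto)
  have wd: "has_weak_deriv [\<alpha>] u (weak_deriv [\<alpha>] u)" for \<alpha>
    by (rule weak_deriv_works[OF u1(1)]) (use u1 in auto)
  then have li: "loc_integrable (weak_deriv [\<alpha>] u)" for \<alpha>
    by (auto simp: loc_integrable_def has_weak_deriv_def)
  have "norm (lin (\<lambda>\<alpha>. mollified \<eta> u [\<alpha>] n y) h) \<le> \<kappa> * norm h" for n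
  proof -
    have "lin (\<lambda>\<alpha>. mollified \<eta> u [\<alpha>] n y) h = conv (\<eta> n) (\<lambda>z. lin (\<lambda>\<alpha>. weak_deriv [\<alpha>] u z) h) y"
    proof -
      have int: "integrable lebesgue (\<lambda>z. \<eta> n (y - z) *\<^sub>R weak_deriv [\<alpha>] u z)" for \<alpha>
        by (rule conv_integrable[OF mollifier_bumps[OF \<eta>] mollifier_off[OF \<eta>] li])
      have "conv (\<eta> n) (\<lambda>z. lin (\<lambda>\<alpha>. weak_deriv [\<alpha>] u z) h) y
          = (LINT z|lebesgue. (\<Sum>\<alpha>\<in>UNIV. h $ \<alpha> *\<^sub>R (\<eta> n (y - z) *\<^sub>R weak_deriv [\<alpha>] u z)))"
        unfolding conv_def lin_def by (simp add: scaleR_sum_right mult.commute)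
      also have "\<dots> = lin (\<lambda>\<alpha>. mollified \<eta> u [\<alpha>] n y) h"
        unfolding mollified_eq_conv[OF wd] lin_def conv_def
        using int by (subst Bochner_Integration.integral_sum) (auto simp del: scaleR_scaleR)
      finally show ?thesis by simp
    qed
    also have "norm \<dots> \<le> \<kappa> * norm h"
    proof (rule norm_conv_mollifier_le[OF \<eta>])
      show "loc_integrable (\<lambda>z. lin (\<lambda>\<alpha>. weak_deriv [\<alpha>] u z) h)"
        using li unfolding loc_integrable_def lin_def
        by (auto intro!: absolutely_integrable_sum absolutely_integrable_scaleR_left)
      have "AE z in lebesgue. z \<in> UNIV \<longrightarrow> norm (grad_norm 1 u z) \<le> \<kappa>"
        by (rule Linf_norm_AE[OF _ \<kappa>]) simp
      then show "AE z in lebesgue. z \<in> cball y (inverse (real (Suc n))) \<longrightarrow>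
          norm (lin (\<lambda>\<alpha>. weak_deriv [\<alpha>] u z) h) \<le> \<kappa> * norm h"
      proof (eventually_elim, intro impI)
        fix z assume z: "z \<in> UNIV \<longrightarrow> norm (grad_norm 1 u z) \<le> \<kappa>"
        have bij: "bij_betw (\<lambda>\<alpha>. [\<alpha>]) (UNIV :: 'n set) {\<alpha>s. length \<alpha>s = 1}"
          by (rule bij_betwI[where g = hd]) (auto simp: length_Suc_conv)
        have "norm (lin (\<lambda>\<alpha>. weak_deriv [\<alpha>] u z) h) \<le> (\<Sum>\<alpha>\<in>UNIV. \<bar>h $ \<alpha>\<bar> * \<bar>norm (weak_deriv [\<alpha>] u z)\<bar>)"
          unfolding lin_def by (rule sum_norm_le) simp
        also have "\<dots> \<le> L2_set (\<lambda>\<alpha>. h $ \<alpha>) UNIV * L2_set (\<lambda>\<alpha>. norm (weak_deriv [\<alpha>] u z)) UNIV"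
          by (rule L2_set_mult_ineq)
        also have "L2_set (\<lambda>\<alpha>. norm (weak_deriv [\<alpha>] u z)) UNIV = grad_norm 1 u z"
          unfolding grad_norm_def L2_set_def using sum.reindex_bij_betw[OF bij, of "\<lambda>\<alpha>s. (norm (weak_deriv \<alpha>s u z))\<^sup>2"]
          by simp
        also have "L2_set (\<lambda>\<alpha>. h $ \<alpha>) UNIV = norm h" by (simp add: norm_vec_def L2_set_def)
        also have "norm h * grad_norm 1 u z \<le> \<kappa> * norm h"
          using mult_left_mono[of "grad_norm 1 u z" \<kappa> "norm h"] z by (simp add: mult.commute)
        finally show "norm (lin (\<lambda>\<alpha>. weak_deriv [\<alpha>] u z) h) \<le> \<kappa> * norm h" .
      qed
    qed
    finally show ?thesis .
  qed
  then show "\<forall>\<^sub>F n in sequentially. norm (lin (\<lambda>\<alpha>. mollified \<eta> u [\<alpha>] n y) h) \<le> \<kappa> * norm h" by simp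
qed simp

end


section \<open>Higher derivatives on convex sets\<close>

text \<open>Two derivatives at \<open>g\<close> agree on \<open>y - g\<close> for every \<open>y \<in> S\<close>, as derivatives along the
  segment from \<open>g\<close> to \<open>y\<close>. Differences of such vectors exhaust all directions because \<open>S\<close>
  contains a ball. This applies to the ball in the interaction space as well as to the set
  of matrices on which the Cauchy--Born energy is differentiated.\<close>

lemma has_derivative_within_unique:
  assumes S: "convex S" "ball g0 r \<subseteq> S" "0 < r" and g: "g \<in> S"
    and D: "(f has_derivative D) (at g within S)" and E: "(f has_derivative E) (at g within S)"
  shows "D = E"
proof -
  have linD: "linear D" and linE: "linear E" using D E has_derivative_linear by auto
  have eq: "D (y - g) = E (y - g)" if y: "y \<in> S" for y
  proof -
    let ?p = "\<lambda>t::real. g + t *\<^sub>R (y - g)"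
    have p: "?p ` {0..1} \<subseteq> S"
    proof clarify
      fix t :: real assume "t \<in> {0..1}"
      then show "?p t \<in> S"
        using convexD[OF S(1) g y, of "1 - t" t] by (simp add: algebra_simps)
    qed
    have path: "((\<lambda>t. f (?p t)) has_vector_derivative L (y - g)) (at 0 within {0..1})"
      if "(f has_derivative L) (at g within S)" for L
    proof -
      have "(?p has_derivative (\<lambda>s. s *\<^sub>R (y - g))) (at 0 within {0..1})"
        by (auto intro!: derivative_eq_intros)
      moreover have "(f has_derivative L) (at (?p 0) within ?p ` {0..1})"
        using has_derivative_subset[OF that p] by simp
      ultimately have "((\<lambda>t. f (?p t)) has_derivative (\<lambda>s. L (s *\<^sub>R (y - g)))) (at 0 within {0..1})"
        by (rule has_derivative_in_compose)
      then show ?thesis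
        using has_derivative_linear[OF that] by (simp add: has_vector_derivative_def linear_scale)
    qed
    show ?thesis
      by (rule vector_derivative_unique_within[OF _ path[OF D] path[OF E]])
        (simp add: trivial_limit_within islimpt_Icc)
  qed
  show "D = E"
  proof
    fix h
    show "D h = E h"
    proof (cases "h = 0")
      case False
      define e where "e = r / (2 * norm h)"
      have e: "0 < e" "norm (e *\<^sub>R h) < r" using S(3) False by (auto simp: e_def)
      have "g0 + e *\<^sub>R h \<in> S" "g0 \<in> S" using S(2,3) e by (auto simp: subset_iff dist_norm)
      then have "D ((g0 + e *\<^sub>R h - g) - (g0 - g)) = E ((g0 + e *\<^sub>R h - g) - (g0 - g))"
        using linear_diff[OF linD, of "g0 + e *\<^sub>R h - g" "g0 - g"] linear_diff[OF linE, of "g0 + e *\<^sub>R h - g" "g0 - g"]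
        by (simp add: eq)
      then have "e *\<^sub>R D h = e *\<^sub>R E h" by (simp add: linear_scale linD linE)
      then show ?thesis using e by simp
    qed (simp add: linear_0 linD linE)
  qed
qed

declare nderiv.simps(2) [simp del]

text \<open>An interior point makes derivatives within the convex set unique, also at its boundary
  points. The instance of interest is the closed ball in the interaction space.\<close>

locale smooth_on_convex =
  fixes S :: "'a::real_normed_vector set" and f :: "'a \<Rightarrow> real" and k :: nat and g0 :: 'a and r :: real
  assumes convex: "convex S" and ball: "ball g0 r \<subseteq> S" and r: "0 < r"
    and smooth: "Ck_on k S f"
begin

abbreviation N where "N \<equiv> nderiv S f"

lemma has_derivative:
  assumes "length hs < k" "g \<in> S"
  shows "(N hs has_derivative (\<lambda>h. N (h # hs) g)) (at g within S)"
  using smooth assms unfolding Ck_on_def by (simp add: nderiv.simps(2) frechet_derivative_works[symmetric])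

lemma derivative_unique:
  "g \<in> S \<Longrightarrow> (F has_derivative D) (at g within S) \<Longrightarrow> (F has_derivative E) (at g within S) \<Longrightarrow> D = E"
  using has_derivative_within_unique[OF convex ball r] by blast

lemma Cons_eqI:
  assumes "length hs < k" "g \<in> S" "(F has_derivative D) (at g within S)" "\<And>g. g \<in> S \<Longrightarrow> N hs g = F g"
  shows "N (h # hs) g = D h"
proof -
  have "(N hs has_derivative D) (at g within S)"
    using has_derivative_transform[OF assms(2,4,3)] .
  then show ?thesis using derivative_unique[OF assms(2) has_derivative[OF assms(1,2)]] by metis
qed

text \<open>Derivatives within \<open>S\<close> only see the values on \<open>S\<close>, so identities between inner
  derivatives on \<open>S\<close> persist under further differentiation.\<close>

lemma append_cong:
  assumes "\<And>g. g \<in> S \<Longrightarrow> N hs g = N hs' g" "length hs = length hs'"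
  shows "length (as @ hs) \<le> k \<Longrightarrow> g \<in> S \<Longrightarrow> N (as @ hs) g = N (as @ hs') g"
proof (induction as arbitrary: g)
  case (Cons a as)
  show ?case unfolding append_Cons
    by (rule Cons_eqI[where D = "\<lambda>h. N (h # as @ hs') g" and F = "N (as @ hs')"])
      (use Cons assms(2) in \<open>auto intro: has_derivative\<close>)
qed (use assms in auto)

lemma linear_slot:
  "length as + length bs < k \<Longrightarrow> g \<in> S \<Longrightarrow> linear (\<lambda>h. N (as @ h # bs) g)"
proof (induction as arbitrary: g)
  case Nil
  then show ?case using has_derivative_linear[OF has_derivative[of bs g]] by simp
next
  case (Cons a as)
  have IH: "linear (\<lambda>h. N (as @ h # bs) g)" if "g \<in> S" for g using Cons that by simp
  have d: "(N (as @ h # bs) has_derivative (\<lambda>a. N (a # as @ h # bs) g)) (at g within S)" for h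
    using has_derivative[of "as @ h # bs" g] Cons by simp
  show ?case
  proof (rule linearI)
    fix h h' show "N ((a # as) @ (h + h') # bs) g = N ((a # as) @ h # bs) g + N ((a # as) @ h' # bs) g"
      unfolding append_Cons
      by (rule Cons_eqI[OF _ _ has_derivative_add[OF d d]]) (use Cons.prems linear_add[OF IH] in auto)
  next
    fix c h show "N ((a # as) @ (c *\<^sub>R h) # bs) g = c *\<^sub>R N ((a # as) @ h # bs) g"
      unfolding append_Cons
      by (rule Cons_eqI[OF _ _ has_derivative_scaleR_right[OF d]]) (use Cons.prems linear_scale[OF IH] in auto)
  qed
qed

lemma map2_scaleR:
  assumes "length cs = length hs" "length as + length hs \<le> k" "g \<in> S"
  shows "N (as @ map2 scaleR cs hs) g = prod_list cs * N (as @ hs) g"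
  using assms
proof (induction cs hs arbitrary: as rule: list_induct2)
  case (Cons c cs h hs)
  have "N (as @ map2 scaleR (c # cs) (h # hs)) g = c * N (as @ h # map2 scaleR cs hs) g"
    using linear_scale[OF linear_slot[of as "map2 scaleR cs hs" g], of c h] Cons by simp
  also have "N (as @ h # map2 scaleR cs hs) g = prod_list cs * N ((as @ [h]) @ hs) g"
    using Cons.IH[of "as @ [h]"] Cons.prems by simp
  finally show ?case by simp
qed simp

lemma map_scaleR:
  assumes "length hs \<le> k" "g \<in> S"
  shows "N (map (scaleR c) hs) g = c ^ length hs * N hs g"
proof -
  have "map2 scaleR (replicate (length hs) c) hs = map (scaleR c) hs"
    by (induction hs) auto
  then show ?thesis using map2_scaleR[of "replicate (length hs) c" hs "[]" g] assms by simp
qed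

text \<open>The continuity demanded by \<^const>\<open>Ck_on\<close> concerns directions in the unit ball;
  multilinearity rescales arbitrary directions into it.\<close>

lemma continuous:
  assumes "length hs \<le> k"
  shows "continuous_on S (N hs)"
  unfolding continuous_on_iff
proof (intro ballI allI impI)
  fix g and e :: real assume g: "g \<in> S" and e: "0 < e"
  obtain C where C: "C > 0" "\<And>h. h \<in> set hs \<Longrightarrow> norm h \<le> C"
    using finite_imp_bounded[OF finite_set[of hs]] by (auto simp: bounded_pos)
  define c where "c = 1 / C"
  have c: "0 < c" using C by (simp add: c_def)
  have small: "norm h \<le> 1" if h: "h \<in> set (map (scaleR c) hs)" for h
  proof -
    obtain h' where h': "h' \<in> set hs" "h = c *\<^sub>R h'" using h unfolding set_map by blast
    then show ?thesis using C(1) C(2)[OF h'(1)] by (simp add: c_def)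
  qed
  have "0 < c ^ length hs * (e / 2)" using c e by simp
  then obtain d where d: "d > 0" "\<And>g'. g' \<in> S \<Longrightarrow> norm (g' - g) < d \<Longrightarrow>
      \<bar>N (map (scaleR c) hs) g' - N (map (scaleR c) hs) g\<bar> \<le> c ^ length hs * (e / 2)"
    using smooth g assms small unfolding Ck_on_def by (metis length_map)
  show "\<exists>d>0. \<forall>g'\<in>S. dist g' g < d \<longrightarrow> dist (N hs g') (N hs g) < e"
  proof (intro exI[of _ d] conjI ballI impI)
    fix g' assume g': "g' \<in> S" "dist g' g < d"
    have "\<bar>c ^ length hs * (N hs g' - N hs g)\<bar> \<le> c ^ length hs * (e / 2)"
      using d(2)[of g'] g g' map_scaleR[OF assms] by (simp add: dist_norm right_diff_distrib)
    then have "\<bar>N hs g' - N hs g\<bar> \<le> e / 2" using c by (simp add: abs_mult)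
    then show "dist (N hs g') (N hs g) < e" using e by (simp add: dist_real_def)
  qed (rule d)
qed

lemma nderiv_along_line:
  assumes k: "length hs < k" and seg: "\<And>t. t \<in> {0..1} \<Longrightarrow> g + t *\<^sub>R h \<in> S" and t: "t \<in> {0..1}"
  shows "((\<lambda>t. N hs (g + t *\<^sub>R h)) has_vector_derivative N (h # hs) (g + t *\<^sub>R h)) (at t within {0..1})"
proof -
  have "((\<lambda>t. N hs (g + t *\<^sub>R h)) has_derivative (\<lambda>s. N ((s *\<^sub>R h) # hs) (g + t *\<^sub>R h))) (at t within {0..1})"
  proof (rule has_derivative_in_compose[where g = "N hs" and f = "\<lambda>t. g + t *\<^sub>R h"])
    show "((\<lambda>t. g + t *\<^sub>R h) has_derivative (\<lambda>s. s *\<^sub>R h)) (at t within {0..1})"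
      by (auto intro!: derivative_eq_intros)
    show "(N hs has_derivative (\<lambda>h'. N (h' # hs) (g + t *\<^sub>R h)))
        (at (g + t *\<^sub>R h) within (\<lambda>t. g + t *\<^sub>R h) ` {0..1})"
      by (rule has_derivative_subset[OF has_derivative[OF k seg[OF t]]]) (use seg in auto)
  qed
  moreover have "N ((s *\<^sub>R h) # hs) (g + t *\<^sub>R h) = s *\<^sub>R N (h # hs) (g + t *\<^sub>R h)" for s
    using linear_scale[OF linear_slot[of "[]" hs]] k seg[OF t] by simp
  ultimately show ?thesis by (simp add: has_vector_derivative_def)
qed

lemma schwarz_interior:
  assumes k: "length hs + 2 \<le> k" and b: "ball g d \<subseteq> S" "0 < d"
  shows "N (a # b # hs) g = N (b # a # hs) g"
proof (rule ccontr)
  assume ne: "N (a # b # hs) g \<noteq> N (b # a # hs) g"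
  define e where "e = \<bar>N (a # b # hs) g - N (b # a # hs) g\<bar> / 4"
  have e: "0 < e" using ne by (simp add: e_def)
  have gS: "g \<in> S" using b by auto
  have "\<exists>d>0. \<forall>g'\<in>S. dist g' g < d \<longrightarrow> dist (N hs' g') (N hs' g) < e" if "length hs' \<le> k" for hs'
    using continuous[OF that] gS e unfolding continuous_on_iff by blast
  then obtain d1 d2 where d12: "d1 > 0" "d2 > 0"
    "\<And>g'. g' \<in> S \<Longrightarrow> dist g' g < d1 \<Longrightarrow> dist (N (a # b # hs) g') (N (a # b # hs) g) < e"
    "\<And>g'. g' \<in> S \<Longrightarrow> dist g' g < d2 \<Longrightarrow> dist (N (b # a # hs) g') (N (b # a # hs) g) < e"
    using k by (metis add_2_eq_Suc' length_Cons)
  define n where "n = 1 + norm a + norm b"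
  have n: "0 < n" unfolding n_def using norm_ge_zero[of a] norm_ge_zero[of b] by linarith
  define D where "D = min d (min d1 d2)"
  have D: "0 < D" using b d12 by (simp add: D_def)
  \<comment> \<open>The parallelogram with sides \<open>t a\<close> and \<open>t b\<close> stays where both mixed derivatives vary by less than \<open>e\<close>.\<close>
  define t where "t = D / (2 * n)"
  have t: "0 < t" unfolding t_def using n D by simp
  have tb: "t * norm a + t * norm b < D"
  proof -
    have "t * norm a + t * norm b \<le> t * n" using t by (simp add: n_def distrib_left)
    also have "\<dots> = D / 2" using n by (simp add: t_def)
    also have "\<dots> < D" using D by simp
    finally show ?thesis .
  qed
  have near: "dist (g + s *\<^sub>R t *\<^sub>R a + s' *\<^sub>R t *\<^sub>R b) g < D" if "s \<in> {0..1}" "s' \<in> {0..1}" for s s'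
  proof -
    have "dist (g + s *\<^sub>R t *\<^sub>R a + s' *\<^sub>R t *\<^sub>R b) g \<le> norm (s *\<^sub>R t *\<^sub>R a) + norm (s' *\<^sub>R t *\<^sub>R b)"
      using norm_triangle_ineq[of "s *\<^sub>R t *\<^sub>R a" "s' *\<^sub>R t *\<^sub>R b"]
      by (simp add: dist_norm add.assoc del: scaleR_scaleR norm_scaleR)
    also have "\<dots> \<le> t * norm a + t * norm b"
      using that t mult_right_mono[of s 1 "t * norm a"] mult_right_mono[of s' 1 "t * norm b"]
      by (intro add_mono) (auto simp: abs_mult mult.assoc)
    also note tb
    finally show ?thesis .
  qed
  have inS: "g + s *\<^sub>R t *\<^sub>R a + s' *\<^sub>R t *\<^sub>R b \<in> S" if "s \<in> {0..1}" "s' \<in> {0..1}" for s s'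
    using near[OF that] b(1) by (auto simp: subset_iff dist_commute D_def simp del: scaleR_scaleR)
  define \<Delta> where "\<Delta> = N hs (g + t *\<^sub>R a + t *\<^sub>R b) - N hs (g + t *\<^sub>R a) - N hs (g + t *\<^sub>R b) + N hs g"
  \<comment> \<open>The second difference is symmetric in the two directions, and two applications of the mean
    value bound show that it is close to the mixed derivative taken in either order.\<close>
  have key: "\<bar>\<Delta> - t ^ 2 * N (y # x # hs) g\<bar> \<le> t ^ 2 * e"
    if xy: "\<And>s s'. s \<in> {0..1} \<Longrightarrow> s' \<in> {0..1} \<Longrightarrow> g + s *\<^sub>R t *\<^sub>R x + s' *\<^sub>R t *\<^sub>R y \<in> S"
      and close: "\<And>s s'. s \<in> {0..1} \<Longrightarrow> s' \<in> {0..1} \<Longrightarrow>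
        \<bar>N (y # x # hs) (g + s *\<^sub>R t *\<^sub>R x + s' *\<^sub>R t *\<^sub>R y) - N (y # x # hs) g\<bar> \<le> e"
      and \<Delta>: "\<Delta> = N hs (g + t *\<^sub>R x + t *\<^sub>R y) - N hs (g + t *\<^sub>R x) - N hs (g + t *\<^sub>R y) + N hs g" for x y
  proof -
    have sc: "N ((t *\<^sub>R x) # hs) g' = t * N (x # hs) g'"
      "N (y' # (t *\<^sub>R x) # hs) g' = t * N (y' # x # hs) g'"
      "N ((t *\<^sub>R y) # x # hs) g' = t * N (y # x # hs) g'" if "g' \<in> S" for g' y'
      using linear_scale[OF linear_slot[of "[]" hs]] linear_scale[OF linear_slot[of "[y']" hs]]
        linear_scale[OF linear_slot[of "[]" "x # hs"]] k that by auto
    define F where "F = (\<lambda>s. N hs ((g + t *\<^sub>R y) + s *\<^sub>R t *\<^sub>R x) - N hs (g + s *\<^sub>R t *\<^sub>R x) - s *\<^sub>R (t ^ 2 * N (y # x # hs) g))"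
    have "norm (F 1 - F 0) \<le> t ^ 2 * e"
    proof (rule interval_mean_value_bound[where f = F])
      fix s :: real assume s: "s \<in> {0..1}"
      have i1: "g + s *\<^sub>R t *\<^sub>R x \<in> S" "g + t *\<^sub>R y + s *\<^sub>R t *\<^sub>R x \<in> S" if "s \<in> {0..1}" for s
        using xy[OF that, of 0] xy[OF that, of 1] by (auto simp: algebra_simps)
      show "(F has_vector_derivative N ((t *\<^sub>R x) # hs) (g + t *\<^sub>R y + s *\<^sub>R t *\<^sub>R x)
          - N ((t *\<^sub>R x) # hs) (g + s *\<^sub>R t *\<^sub>R x) - t ^ 2 * N (y # x # hs) g) (at s within {0..1})"
        unfolding F_def using k s i1
        by (auto intro!: has_vector_derivative_diff nderiv_along_line derivative_eq_intros simp del: scaleR_scaleR)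
      define G where "G = (\<lambda>s'. N (x # hs) ((g + s *\<^sub>R t *\<^sub>R x) + s' *\<^sub>R t *\<^sub>R y) - s' *\<^sub>R (t * N (y # x # hs) g))"
      have "norm (G 1 - G 0) \<le> t * e"
      proof (rule interval_mean_value_bound[where f = G])
        fix s' :: real assume s': "s' \<in> {0..1}"
        show "(G has_vector_derivative N ((t *\<^sub>R y) # x # hs) ((g + s *\<^sub>R t *\<^sub>R x) + s' *\<^sub>R t *\<^sub>R y)
            - t * N (y # x # hs) g) (at s' within {0..1})"
          unfolding G_def using k s' xy[OF s]
          by (auto intro!: has_vector_derivative_diff nderiv_along_line derivative_eq_intros simp del: scaleR_scaleR)
        have "\<bar>t * (N (y # x # hs) (g + s *\<^sub>R t *\<^sub>R x + s' *\<^sub>R t *\<^sub>R y) - N (y # x # hs) g)\<bar> \<le> t * e"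
          using close[OF s s'] t by (simp add: abs_mult del: scaleR_scaleR)
        then show "norm (N ((t *\<^sub>R y) # x # hs) ((g + s *\<^sub>R t *\<^sub>R x) + s' *\<^sub>R t *\<^sub>R y)
            - t * N (y # x # hs) g) \<le> t * e"
          using sc(3)[OF xy[OF s s']] by (simp add: right_diff_distrib del: scaleR_scaleR)
      qed simp
      then have "\<bar>t * (G 1 - G 0)\<bar> \<le> t * (t * e)" using t by (simp add: abs_mult)
      moreover have "t * (G 1 - G 0) = N ((t *\<^sub>R x) # hs) (g + t *\<^sub>R y + s *\<^sub>R t *\<^sub>R x)
          - N ((t *\<^sub>R x) # hs) (g + s *\<^sub>R t *\<^sub>R x) - t ^ 2 * N (y # x # hs) g"
        using sc(1)[OF i1(1)[OF s]] sc(1)[OF i1(2)[OF s]]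
        by (simp add: G_def algebra_simps power2_eq_square)
      ultimately show "norm (N ((t *\<^sub>R x) # hs) (g + t *\<^sub>R y + s *\<^sub>R t *\<^sub>R x)
          - N ((t *\<^sub>R x) # hs) (g + s *\<^sub>R t *\<^sub>R x) - t ^ 2 * N (y # x # hs) g) \<le> t ^ 2 * e"
        by (simp add: power2_eq_square mult.assoc)
    qed simp
    moreover have "F 1 - F 0 = \<Delta> - t ^ 2 * N (y # x # hs) g"
      by (simp add: F_def \<Delta> algebra_simps)
    ultimately show ?thesis by simp
  qed
  have 1: "\<bar>\<Delta> - t ^ 2 * N (b # a # hs) g\<bar> \<le> t ^ 2 * e"
  proof (rule key)
    show "g + s *\<^sub>R t *\<^sub>R a + s' *\<^sub>R t *\<^sub>R b \<in> S" if "s \<in> {0..1}" "s' \<in> {0..1}" for s s'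
      by (rule inS[OF that])
    show "\<bar>N (b # a # hs) (g + s *\<^sub>R t *\<^sub>R a + s' *\<^sub>R t *\<^sub>R b) - N (b # a # hs) g\<bar> \<le> e"
      if "s \<in> {0..1}" "s' \<in> {0..1}" for s s'
      using d12(4)[OF inS[OF that]] near[OF that] by (simp add: dist_real_def D_def del: scaleR_scaleR)
  qed (simp add: \<Delta>_def)
  have 2: "\<bar>\<Delta> - t ^ 2 * N (a # b # hs) g\<bar> \<le> t ^ 2 * e"
  proof (rule key)
    have sw: "g + s *\<^sub>R t *\<^sub>R b + s' *\<^sub>R t *\<^sub>R a = g + s' *\<^sub>R t *\<^sub>R a + s *\<^sub>R t *\<^sub>R b" for s s'
      by (simp only: ac_simps)
    show "g + s *\<^sub>R t *\<^sub>R b + s' *\<^sub>R t *\<^sub>R a \<in> S" if "s \<in> {0..1}" "s' \<in> {0..1}" for s s'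
      unfolding sw by (rule inS[OF that(2,1)])
    show "\<bar>N (a # b # hs) (g + s *\<^sub>R t *\<^sub>R b + s' *\<^sub>R t *\<^sub>R a) - N (a # b # hs) g\<bar> \<le> e"
      if "s \<in> {0..1}" "s' \<in> {0..1}" for s s'
      unfolding sw using d12(3)[OF inS[OF that(2,1)]] near[OF that(2,1)] by (simp add: dist_real_def D_def del: scaleR_scaleR)
  qed (simp add: \<Delta>_def algebra_simps)
  have "\<bar>t ^ 2 * (N (a # b # hs) g - N (b # a # hs) g)\<bar> \<le> t ^ 2 * (2 * e)"
    using 1 2 unfolding right_diff_distrib by linarith
  then have "\<bar>N (a # b # hs) g - N (b # a # hs) g\<bar> \<le> 2 * e" using t by (simp add: abs_mult)
  then show False using e by (simp add: e_def)
qed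

text \<open>Boundary points are limits of interior points along the segment towards \<open>g0\<close>, and
  mixed derivatives are continuous.\<close>

lemma schwarz:
  assumes k: "length hs + 2 \<le> k" and g: "g \<in> S"
  shows "N (a # b # hs) g = N (b # a # hs) g"
proof -
  define p where "p = (\<lambda>t::real. g + t *\<^sub>R (g0 - g))"
  have g0: "g0 \<in> S" using ball r by auto
  have pS: "p ` {0..1} \<subseteq> S"
  proof clarify
    fix t :: real assume "t \<in> {0..1}"
    then show "p t \<in> S" using convexD[OF convex g g0, of "1 - t" t] by (simp add: p_def algebra_simps)
  qed
  have lim: "((\<lambda>t. N hs' (p t)) \<longlongrightarrow> N hs' (p 0)) (at 0 within {0..1})" if "length hs' \<le> k" for hs'
  proof -
    have "continuous_on {0..1} (\<lambda>t. N hs' (p t))"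
      by (rule continuous_on_compose2[OF continuous[OF that] _ pS]) (auto simp: p_def intro!: continuous_intros)
    then show ?thesis unfolding continuous_on by (rule bspec) simp
  qed
  have eq: "N (a # b # hs) (p t) = N (b # a # hs) (p t)" if t: "t \<in> {0<..1}" for t
  proof (rule schwarz_interior[OF k])
    show "ball (p t) (t * r) \<subseteq> S"
    proof
      fix y assume y: "y \<in> ball (p t) (t * r)"
      define z where "z = g0 + (1 / t) *\<^sub>R (y - p t)"
      have "norm (y - p t) < t * r" using y by (simp add: dist_norm norm_minus_commute)
      then have "norm ((1 / t) *\<^sub>R (y - p t)) < r"
        using t unfolding norm_scaleR by (simp add: field_simps)
      then have "z \<in> S" using ball by (auto simp: z_def subset_iff dist_norm)
      moreover have "y = (1 - t) *\<^sub>R g + t *\<^sub>R z" using t by (simp add: z_def p_def algebra_simps)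
      ultimately show "y \<in> S" using convexD[OF convex g, of z "1 - t" t] t by simp
    qed
    show "0 < t * r" using t r by simp
  qed
  have ev: "\<forall>\<^sub>F t in at 0 within {0..1}. N (a # b # hs) (p t) = N (b # a # hs) (p t)"
    unfolding eventually_at by (intro exI[of _ 1]) (use eq in auto)
  have "((\<lambda>t. N (b # a # hs) (p t)) \<longlongrightarrow> N (a # b # hs) (p 0)) (at 0 within {0..1})"
    using Lim_transform_eventually[OF lim ev] k by simp
  moreover have "at (0::real) within {0..1} \<noteq> bot"
    by (simp add: trivial_limit_within islimpt_Icc)
  ultimately have "N (a # b # hs) (p 0) = N (b # a # hs) (p 0)"
    using lim[of "b # a # hs"] k by (metis tendsto_unique add_2_eq_Suc' length_Cons)
  then show ?thesis by (simp add: p_def)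
qed

text \<open>Taylor expansion of the first derivative in direction \<open>s\<close> produces derivatives in
  which \<open>s\<close> is the innermost direction; the weights in the estimate distinguish the first
  entry of a tuple, so \<open>s\<close> is moved there.\<close>

lemma move_to_front:
  "length hs < k \<Longrightarrow> g \<in> S \<Longrightarrow> N (hs @ [s]) g = N (s # hs) g"
proof (induction hs arbitrary: g)
  case (Cons h hs)
  have "N ([h] @ (hs @ [s])) g = N ([h] @ (s # hs)) g"
    by (rule append_cong) (use Cons in auto)
  also have "\<dots> = N (s # h # hs) g" using schwarz[of hs g] Cons.prems by simp
  finally show ?case by simp
qed simp

lemma taylor:
  assumes k: "3 < k" and g: "g \<in> S" "g + d \<in> S"
    and B: "\<And>g'. g' \<in> S \<Longrightarrow> \<bar>N [s, d, d, d] g'\<bar> \<le> B"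
  shows "\<bar>N [s] (g + d) - N [s] g - N [s, d] g - N [s, d, d] g / 2\<bar> \<le> B"
proof -
  have seg: "g + t *\<^sub>R d \<in> S" if "t \<in> {0..1}" for t
    using convexD[OF convex g, of "1 - t" t] that by (simp add: algebra_simps)
  have "norm (N [s] (g + 1 *\<^sub>R d) - N [s] (g + 0 *\<^sub>R d) - N [d, s] (g + 0 *\<^sub>R d)
      - (1/2) *\<^sub>R N [d, d, s] (g + 0 *\<^sub>R d)) \<le> B"
  proof (rule taylor_third_order)
    fix t :: real assume t: "t \<in> {0..1}"
    show "((\<lambda>t. N [s] (g + t *\<^sub>R d)) has_vector_derivative N [d, s] (g + t *\<^sub>R d)) (at t within {0..1})"
      by (rule nderiv_along_line[OF _ seg t]) (use k in auto)
    show "((\<lambda>t. N [d, s] (g + t *\<^sub>R d)) has_vector_derivative N [d, d, s] (g + t *\<^sub>R d)) (at t within {0..1})"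
      by (rule nderiv_along_line[OF _ seg t]) (use k in auto)
    show "norm (N [d, d, s] (g + t *\<^sub>R d) - N [d, d, s] (g + 0 *\<^sub>R d)) \<le> B"
    proof (rule interval_mean_value_bound[OF _ _ t])
      fix t :: real assume t: "t \<in> {0..1}"
      show "((\<lambda>t. N [d, d, s] (g + t *\<^sub>R d)) has_vector_derivative N [d, d, d, s] (g + t *\<^sub>R d)) (at t within {0..1})"
        by (rule nderiv_along_line[OF _ seg t]) (use k in auto)
      show "norm (N [d, d, d, s] (g + t *\<^sub>R d)) \<le> B"
        using move_to_front[of "[d, d, d]" "g + t *\<^sub>R d" s] B seg t k by simp
    qed
  qed
  then show ?thesis
    using move_to_front[of "[d]" g s] move_to_front[of "[d, d]" g s] g k by simp
qed

end


section \<open>Stencils and the potential\<close>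

lemma norm_lattice_star_ge_1: "\<rho> \<in> lattice_star \<Longrightarrow> 1 \<le> norm \<rho>"
proof -
  assume \<rho>: "\<rho> \<in> lattice_star"
  then obtain i where i: "\<rho> $ i \<noteq> 0" by (auto simp: lattice_star_def vec_eq_iff)
  moreover have "\<rho> $ i \<in> \<int>" using \<rho> by (simp add: lattice_star_def lattice_def)
  ultimately have "1 \<le> \<bar>\<rho> $ i\<bar>" using Ints_nonzero_abs_ge1 by blast
  then show ?thesis using component_le_norm_cart[of \<rho> i] by simp
qed

lemma lattice_star_norm_pos: "\<rho> \<in> lattice_star \<Longrightarrow> 0 < norm \<rho>"
  using norm_lattice_star_ge_1[of \<rho>] by linarith

lemma uminus_lattice_star [simp]: "- \<rho> \<in> lattice_star \<longleftrightarrow> \<rho> \<in> lattice_star"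
  by (auto simp: lattice_star_def lattice_def)

lemma entry_family:
  assumes "\<And>\<rho>. \<rho> \<in> lattice_star \<Longrightarrow> norm (f \<rho>) \<le> C * norm \<rho>"
  shows "entry (family f) \<rho> = (if \<rho> \<in> lattice_star then f \<rho> else 0)"
  unfolding family_def
proof (subst Abs_stencil_inverse)
  have "norm (f \<rho>) / norm \<rho> \<le> C" if "\<rho> \<in> lattice_star" for \<rho>
    using assms[OF that] lattice_star_norm_pos[OF that] by (simp add: pos_divide_le_eq)
  then show "(\<lambda>\<rho>. if \<rho> \<in> lattice_star then f \<rho> else 0) \<in> {g. (\<forall>\<rho>. \<rho> \<notin> lattice_star \<longrightarrow> g \<rho> = 0) \<and>
      bdd_above ((\<lambda>\<rho>. norm (g \<rho>) / norm \<rho>) ` lattice_star)}"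
    by (auto intro!: bdd_aboveI[of _ C])
qed simp

lemma entry_single: "\<rho> \<in> lattice_star \<Longrightarrow> entry (single \<rho> h) \<sigma> = (if \<sigma> = \<rho> then h else 0)"
proof -
  assume \<rho>: "\<rho> \<in> lattice_star"
  have "norm (if \<sigma> = \<rho> then h else 0) \<le> norm h * norm \<sigma>" if "\<sigma> \<in> lattice_star" for \<sigma>
    using mult_left_mono[OF norm_lattice_star_ge_1[OF that], of "norm h"] by auto
  then show ?thesis unfolding single_def using \<rho> by (subst entry_family[where C = "norm h"]) auto
qed

lemma norm_entry_le: "norm (entry g \<rho>) \<le> norm g * norm \<rho>"
proof (cases "\<rho> \<in> lattice_star")
  case True
  then show ?thesis
    using entry_le_norm_stencil[OF True, of g] lattice_star_norm_pos[OF True] by (simp add: pos_divide_le_eq)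
qed (simp add: entry_off)

lemma entry_reflect: "entry (reflect g) \<rho> = - entry g (- \<rho>)"
proof -
  have "norm (- entry g (- \<rho>)) \<le> norm g * norm \<rho>" for \<rho> using norm_entry_le[of g "- \<rho>"] by simp
  then show ?thesis unfolding reflect_def by (subst entry_family) (auto simp: entry_off)
qed

lemma entry_homogeneous:
  "entry (homogeneous F) \<rho> = (if \<rho> \<in> lattice_star then F *v \<rho> else 0)"
  unfolding homogeneous_def
  by (rule entry_family[where C = "onorm ((*v) F)"]) (simp add: onorm matrix_vector_mul_bounded_linear)

lemma norm_stencil_le_iff:
  "norm g \<le> B \<longleftrightarrow> (\<forall>\<rho>\<in>lattice_star. norm (entry g \<rho>) \<le> B * norm \<rho>)"
proof
  assume "norm g \<le> B"
  then show "\<forall>\<rho>\<in>lattice_star. norm (entry g \<rho>) \<le> B * norm \<rho>"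
    using order_trans[OF norm_entry_le mult_right_mono] by fastforce
next
  assume B: "\<forall>\<rho>\<in>lattice_star. norm (entry g \<rho>) \<le> B * norm \<rho>"
  show "norm g \<le> B"
    by (rule norm_stencil_leI) (use B in \<open>auto simp: pos_divide_le_eq[OF lattice_star_norm_pos]\<close>)
qed

lemma single_scaleR: "\<rho> \<in> lattice_star \<Longrightarrow> single \<rho> (c *\<^sub>R h) = c *\<^sub>R single \<rho> h"
  by (rule stencil_eqI) (simp add: entry_single)

lemma single_0: "\<rho> \<in> lattice_star \<Longrightarrow> single \<rho> 0 = 0"
  by (rule stencil_eqI) (simp add: entry_single)

lemma reflect_reflect [simp]: "reflect (reflect g) = g"
  by (rule stencil_eqI) (simp add: entry_reflect)

lemma norm_reflect: "norm (reflect g) = norm (g :: 'n::finite stencil)"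
proof -
  have "norm (reflect g) \<le> norm g" for g :: "'n stencil"
    unfolding norm_stencil_le_iff[of "reflect g"]
  proof
    fix \<rho> show "norm (entry (reflect g) \<rho>) \<le> norm g * norm \<rho>"
      using norm_entry_le[of g "- \<rho>"] by (simp add: entry_reflect)
  qed
  from this[of g] this[of "reflect g"] show ?thesis by simp
qed

lemma bounded_linear_reflect: "bounded_linear reflect"
  by (rule bounded_linear_intro[where K = 1])
    (auto intro!: stencil_eqI simp: entry_reflect norm_reflect)

lemma ennreal_summable: "(B :: 'i \<Rightarrow> ennreal) summable_on A"
  by (rule nonneg_summable_on_complete) simp

text \<open>All estimates between infinite sums take place in \<^typ>\<open>ennreal\<close>. There all sums
  exist, and the weights may be infinite.\<close>

lemma has_sum_ennreal_bound:
  fixes f :: "'i \<Rightarrow> real"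
  assumes f: "(f has_sum x) A" and B: "\<And>i. i \<in> A \<Longrightarrow> ennreal \<bar>f i\<bar> \<le> B i"
  shows "ennreal \<bar>x\<bar> \<le> infsum B A"
proof (rule tendsto_upperbound)
  show "((\<lambda>F. ennreal \<bar>sum f F\<bar>) \<longlongrightarrow> ennreal \<bar>x\<bar>) (finite_subsets_at_top A)"
    using f unfolding has_sum_def by (intro tendsto_ennrealI tendsto_rabs)
  show "\<forall>\<^sub>F F in finite_subsets_at_top A. ennreal \<bar>sum f F\<bar> \<le> infsum B A"
  proof (rule eventually_finite_subsets_at_top_weakI)
    fix F assume F: "finite F" "F \<subseteq> A"
    have "ennreal \<bar>sum f F\<bar> \<le> ennreal (\<Sum>i\<in>F. \<bar>f i\<bar>)" by (intro ennreal_leI sum_abs)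
    also have "\<dots> = (\<Sum>i\<in>F. ennreal \<bar>f i\<bar>)" by simp
    also have "\<dots> \<le> sum B F" using F B by (intro sum_mono) auto
    also have "\<dots> = infsum B F" using F by simp
    also have "\<dots> \<le> infsum B A" using F by (intro infsum_mono_neutral ennreal_summable) auto
    finally show "ennreal \<bar>sum f F\<bar> \<le> infsum B A" .
  qed
qed simp

lemma star_tuples_Suc: "star_tuples (Suc j) = (\<Union>\<rho>\<in>lattice_star. (#) \<rho> ` star_tuples j)"
  by (auto simp: star_tuples_def length_Suc_conv image_iff)

lemma infsum_star_tuples_Suc:
  fixes B :: "(real^'n::finite) list \<Rightarrow> ennreal"
  shows "(\<Sum>\<^sub>\<infinity>\<rho>\<in>lattice_star. \<Sum>\<^sub>\<infinity>\<sigma>s\<in>star_tuples j. B (\<rho> # \<sigma>s)) \<le> (\<Sum>\<^sub>\<infinity>\<rho>s\<in>star_tuples (Suc j). B \<rho>s)"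
proof -
  have fin: "(\<Sum>\<rho>\<in>F. \<Sum>\<^sub>\<infinity>\<sigma>s\<in>star_tuples j. B (\<rho> # \<sigma>s)) = infsum B (\<Union>\<rho>\<in>F. (#) \<rho> ` star_tuples j)"
    if "finite F" for F :: "(real^'n) set"
    using that
  proof induction
    case (insert \<rho> F)
    have "infsum B (\<Union>\<rho>\<in>insert \<rho> F. (#) \<rho> ` star_tuples j)
        = infsum B ((#) \<rho> ` star_tuples j) + infsum B (\<Union>\<rho>\<in>F. (#) \<rho> ` star_tuples j)"
      unfolding UN_insert
    proof (rule infsum_Un_disjoint)
      show "(#) \<rho> ` star_tuples j \<inter> (\<Union>\<rho>\<in>F. (#) \<rho> ` star_tuples j) = {}" using insert(2) by auto
    qed (rule ennreal_summable)+
    also have "infsum B ((#) \<rho> ` star_tuples j) = (\<Sum>\<^sub>\<infinity>\<sigma>s\<in>star_tuples j. B (\<rho> # \<sigma>s))"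
      by (subst infsum_reindex) (simp_all add: o_def)
    finally show ?case unfolding sum.insert[OF insert(1,2)] insert(3) by simp
  qed simp
  have "(\<Sum>\<^sub>\<infinity>\<rho>\<in>lattice_star. \<Sum>\<^sub>\<infinity>\<sigma>s\<in>star_tuples j. B (\<rho> # \<sigma>s))
      = (SUP F\<in>{F. finite F \<and> F \<subseteq> lattice_star}. \<Sum>\<rho>\<in>F. \<Sum>\<^sub>\<infinity>\<sigma>s\<in>star_tuples j. B (\<rho> # \<sigma>s))"
    by (rule nonneg_infsum_complete) simp
  also have "\<dots> \<le> (\<Sum>\<^sub>\<infinity>\<rho>s\<in>star_tuples (Suc j). B \<rho>s)"
  proof (rule SUP_least)
    fix F :: "(real^'n) set" assume "F \<in> {F. finite F \<and> F \<subseteq> lattice_star}"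
    then show "(\<Sum>\<rho>\<in>F. \<Sum>\<^sub>\<infinity>\<sigma>s\<in>star_tuples j. B (\<rho> # \<sigma>s)) \<le> (\<Sum>\<^sub>\<infinity>\<rho>s\<in>star_tuples (Suc j). B \<rho>s)"
      unfolding star_tuples_Suc by (subst fin) (auto intro!: infsum_mono_neutral ennreal_summable)
  qed
  finally show ?thesis .
qed

locale potential =
  fixes \<kappa> :: real and k :: nat and V :: "'n::finite stencil \<Rightarrow> ereal"
  assumes \<kappa>: "0 < \<kappa>" and k: "4 \<le> k" and V: "admissible_potential \<kappa> k V"
begin

abbreviation S where "S \<equiv> stencil_ball \<kappa> :: 'n stencil set"
abbreviation f where "f \<equiv> \<lambda>g. real_of_ereal (V g)"

sublocale smooth_on_convex S f k 0 \<kappa>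
proof
  have "S = cball 0 \<kappa>" by (auto simp: dist_norm)
  then show "convex S" by simp
  show "ball 0 \<kappa> \<subseteq> S" by (auto simp: dist_norm)
  show "0 < \<kappa>" by (rule \<kappa>)
  show "Ck_on k S f" using V by (simp add: admissible_potential_def)
qed

text \<open>The weight \<^const>\<open>m_weight\<close> without its factors \<open>\<bar>\<rho>\<^sub>i\<bar>\<close>.\<close>

definition part_sup :: "(real^'n) list \<Rightarrow> ennreal" where
  "part_sup \<rho>s = (SUP g\<in>S. SUP hs\<in>{hs. length hs = length \<rho>s \<and> (\<forall>h\<in>set hs. norm h = 1)}.
     ennreal (V_part \<kappa> V \<rho>s g hs))"

lemma m_weight_eq: "m_weight \<kappa> V \<rho>s = ennreal (\<Prod>\<rho>\<leftarrow>\<rho>s. norm \<rho>) * part_sup \<rho>s"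
  by (simp add: m_weight_def part_sup_def)

lemma part_sup_upper:
  "g \<in> S \<Longrightarrow> length hs = length \<rho>s \<Longrightarrow> (\<And>h. h \<in> set hs \<Longrightarrow> norm h = 1) \<Longrightarrow>
    ennreal (V_part \<kappa> V \<rho>s g hs) \<le> part_sup \<rho>s"
  unfolding part_sup_def by (intro SUP_upper2[of g] SUP_upper2[of hs]) auto

lemma V_part_map2_scaleR:
  assumes "length cs = length hs" "length \<rho>s = length hs" "length hs \<le> k" "set \<rho>s \<subseteq> lattice_star" "g \<in> S"
  shows "V_part \<kappa> V \<rho>s g (map2 scaleR cs hs) = prod_list cs * V_part \<kappa> V \<rho>s g hs"
proof -
  have "length \<rho>s = length hs" "length hs = length cs" using assms by auto
  then have "map2 single \<rho>s (map2 scaleR cs hs) = map2 scaleR cs (map2 single \<rho>s hs)"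
    using assms(4) by (induction \<rho>s hs cs rule: list_induct3) (auto simp: single_scaleR)
  then show ?thesis
    unfolding V_part_def using map2_scaleR[of cs "map2 single \<rho>s hs" "[]" g] assms by simp
qed

text \<open>Normalizing every direction by multilinearity leaves unit vectors, and flipping the
  sign of one of them shows that the supremum also bounds the absolute value.\<close>

lemma abs_V_part_le:
  assumes len: "length hs = length \<rho>s" "\<rho>s \<noteq> []" "length \<rho>s \<le> k" and \<rho>s: "set \<rho>s \<subseteq> lattice_star" and g: "g \<in> S"
  shows "ennreal \<bar>V_part \<kappa> V \<rho>s g hs\<bar> \<le> ennreal (\<Prod>h\<leftarrow>hs. norm h) * part_sup \<rho>s"
proof -
  \<comment> \<open>A zero direction is replaced by an arbitrary unit vector; its norm then supplies the factor zero.\<close>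
  define un where "un h = (if h = 0 then axis undefined 1 else sgn h)" for h :: "real^'n"
  have un: "norm (un h) = 1" "norm h *\<^sub>R un h = h" for h
    by (auto simp: un_def norm_sgn sgn_div_norm)
  have hs_eq: "map2 scaleR (map norm hs) (map un hs) = hs" by (induction hs) (simp_all add: un)
  have V1: "V_part \<kappa> V \<rho>s g hs = (\<Prod>h\<leftarrow>hs. norm h) * V_part \<kappa> V \<rho>s g (map un hs)"
    by (subst (1) hs_eq[symmetric], rule V_part_map2_scaleR) (use assms in auto)
  have "ennreal \<bar>V_part \<kappa> V \<rho>s g (map un hs)\<bar> \<le> part_sup \<rho>s"
  proof (cases "0 \<le> V_part \<kappa> V \<rho>s g (map un hs)")
    case True
    have "ennreal (V_part \<kappa> V \<rho>s g (map un hs)) \<le> part_sup \<rho>s"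
      by (rule part_sup_upper[OF g]) (use len un(1) in auto)
    then show ?thesis using True by simp
  next
    case False
    obtain h hs' where hs: "hs = h # hs'" using len by (cases hs) auto
    define cs where "cs = (- 1 :: real) # replicate (length hs') 1"
    have "map2 scaleR (replicate (length hs') 1) (map un hs') = map un hs'"
      by (induction hs') simp_all
    then have "- un h # map un hs' = map2 scaleR cs (map un hs)" by (simp add: cs_def hs)
    then have "V_part \<kappa> V \<rho>s g (- un h # map un hs') = V_part \<kappa> V \<rho>s g (map2 scaleR cs (map un hs))"
      by (rule arg_cong)
    also have "\<dots> = prod_list cs * V_part \<kappa> V \<rho>s g (map un hs)"
      by (rule V_part_map2_scaleR) (use assms in \<open>auto simp: cs_def hs\<close>)
    finally have "\<bar>V_part \<kappa> V \<rho>s g (map un hs)\<bar> = V_part \<kappa> V \<rho>s g (- un h # map un hs')"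
      using False by (simp add: cs_def)
    moreover have "ennreal (V_part \<kappa> V \<rho>s g (- un h # map un hs')) \<le> part_sup \<rho>s"
      by (rule part_sup_upper[OF g]) (use len un(1) in \<open>auto simp: hs\<close>)
    ultimately show ?thesis by (simp only:)
  qed
  moreover have "0 \<le> (\<Prod>h\<leftarrow>hs. norm h)" by (induction hs) auto
  ultimately show ?thesis unfolding V1 by (simp add: abs_mult ennreal_mult mult_left_mono)
qed

lemma part_sup_swap:
  assumes "set [\<rho>, \<sigma>, \<tau>] \<subseteq> lattice_star"
  shows "part_sup [\<rho>, \<sigma>, \<tau>] \<le> part_sup [\<rho>, \<tau>, \<sigma>]"
  unfolding part_sup_def[of "[\<rho>, \<sigma>, \<tau>]"]
proof (intro SUP_least)
  fix g and hs :: "(real^'n) list"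
  assume g: "g \<in> S" and "hs \<in> {hs. length hs = length [\<rho>, \<sigma>, \<tau>] \<and> (\<forall>h\<in>set hs. norm h = 1)}"
  then obtain a b c where hs: "hs = [a, b, c]" "norm a = 1" "norm b = 1" "norm c = 1"
    by (auto simp: length_Suc_conv)
  have "N ([single \<rho> a] @ [single \<sigma> b, single \<tau> c]) g = N ([single \<rho> a] @ [single \<tau> c, single \<sigma> b]) g"
    by (rule append_cong) (use schwarz[of "[]"] k g in auto)
  then have "V_part \<kappa> V [\<rho>, \<sigma>, \<tau>] g hs = V_part \<kappa> V [\<rho>, \<tau>, \<sigma>] g [a, c, b]"
    by (simp add: V_part_def hs)
  then show "ennreal (V_part \<kappa> V [\<rho>, \<sigma>, \<tau>] g hs) \<le> part_sup [\<rho>, \<tau>, \<sigma>]"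
    using part_sup_upper[OF g, of "[a, c, b]" "[\<rho>, \<tau>, \<sigma>]"] hs by auto
qed

text \<open>A first direction supported at the single entry \<open>\<rho>\<close> leaves only the tuples starting
  with \<open>\<rho>\<close> in the expansion into partial derivatives.\<close>

lemma has_sum_nderiv_single:
  assumes \<rho>: "\<rho> \<in> lattice_star" and len: "length ds < k" and g: "g \<in> S"
  shows "((\<lambda>\<sigma>s. V_part \<kappa> V (\<rho> # \<sigma>s) g (w # map2 entry ds \<sigma>s)) has_sum N (single \<rho> w # ds) g)
    (star_tuples (length ds))"
proof -
  have "((\<lambda>\<rho>s. V_part \<kappa> V \<rho>s g (map2 entry (single \<rho> w # ds) \<rho>s)) has_sum N (single \<rho> w # ds) g)
      (star_tuples (Suc (length ds)))"
    using V len g unfolding admissible_potential_def by simp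
  then have "((\<lambda>\<rho>s. V_part \<kappa> V \<rho>s g (map2 entry (single \<rho> w # ds) \<rho>s)) has_sum N (single \<rho> w # ds) g)
      ((#) \<rho> ` star_tuples (length ds))"
  proof (rule has_sum_cong_neutral[THEN iffD1, rotated -1])
    fix \<rho>s assume "\<rho>s \<in> star_tuples (Suc (length ds)) - (#) \<rho> ` star_tuples (length ds)"
    then obtain \<rho>' \<sigma>s where *: "\<rho>s = \<rho>' # \<sigma>s" "\<rho>' \<in> lattice_star" "\<rho>' \<noteq> \<rho>" "length \<sigma>s = length ds"
      unfolding star_tuples_Suc by (auto simp: star_tuples_def)
    have "linear (\<lambda>h. N ([] @ h # map2 single \<sigma>s (map2 entry ds \<sigma>s)) g)"
      by (rule linear_slot) (use * len g in auto)
    then have "N (0 # map2 single \<sigma>s (map2 entry ds \<sigma>s)) g = 0"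
      using linear_0 by fastforce
    then show "V_part \<kappa> V \<rho>s g (map2 entry (single \<rho> w # ds) \<rho>s) = 0"
      using * \<rho> by (simp add: V_part_def entry_single single_0)
  next
    fix \<rho>s assume "\<rho>s \<in> (#) \<rho> ` star_tuples (length ds) - star_tuples (Suc (length ds))"
    then show "V_part \<kappa> V \<rho>s g (map2 entry (single \<rho> w # ds) \<rho>s) = 0"
      using \<rho> unfolding star_tuples_Suc by auto
  qed simp
  then show ?thesis
    by (subst (asm) has_sum_reindex) (auto simp: o_def entry_single \<rho>)
qed

lemma nderiv_reflect: "g \<in> S \<Longrightarrow> N [reflect h] (reflect g) = N [h] g"
proof -
  assume g: "g \<in> S"
  then have rg: "reflect g \<in> S" by (simp add: norm_reflect)
  have "((\<lambda>g. f (reflect g)) has_derivative (\<lambda>h. N [reflect h] (reflect g))) (at g within S)"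
  proof (rule has_derivative_in_compose[where g = f and f = reflect])
    show "(reflect has_derivative reflect) (at g within S)"
      by (rule bounded_linear_imp_has_derivative[OF bounded_linear_reflect])
    show "(f has_derivative (\<lambda>h. N [h] (reflect g))) (at (reflect g) within reflect ` S)"
    proof (rule has_derivative_subset)
      show "(f has_derivative (\<lambda>h. N [h] (reflect g))) (at (reflect g) within S)"
        using has_derivative[of "[]" "reflect g"] rg k by simp
    qed (auto simp: norm_reflect)
  qed
  moreover have "f (reflect g) = f g" for g using V by (simp add: admissible_potential_def)
  ultimately have "(f has_derivative (\<lambda>h. N [reflect h] (reflect g))) (at g within S)" by simp
  moreover have "(f has_derivative (\<lambda>h. N [h] g)) (at g within S)"
    using has_derivative[of "[]" g] g k by simp
  ultimately show ?thesis using derivative_unique[OF g] by metis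
qed

end


section \<open>The kernel\<close>

definition kernel_support :: "(real^'n \<Rightarrow> real) \<Rightarrow> real^'n \<Rightarrow> (real^'n) set" where
  "kernel_support \<zeta> x = {\<xi> \<in> lattice. \<zeta> (\<xi> - x) \<noteq> 0}"

lemma lattice_add: "\<xi> \<in> lattice \<Longrightarrow> \<rho> \<in> lattice \<Longrightarrow> \<xi> + \<rho> \<in> lattice"
  and lattice_diff: "\<xi> \<in> lattice \<Longrightarrow> \<rho> \<in> lattice \<Longrightarrow> \<xi> - \<rho> \<in> lattice"
  by (auto simp: lattice_def)

lemma finite_lattice_cball: "finite {\<xi> \<in> lattice. norm (\<xi> - x) \<le> c}"
  for x :: "real^'n::finite"
proof -
  let ?X = "{\<xi> \<in> lattice. norm (\<xi> - x) \<le> c}"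
  define N where "N = \<lceil>norm x + c\<rceil>"
  let ?f = "\<lambda>\<xi>::real^'n. (\<lambda>i. \<lfloor>\<xi> $ i\<rfloor>)"
  have "inj_on ?f ?X"
  proof (rule inj_onI)
    fix \<xi> \<xi>' assume "\<xi> \<in> ?X" "\<xi>' \<in> ?X" and eq: "?f \<xi> = ?f \<xi>'"
    then have l: "\<xi> $ i \<in> \<int>" "\<xi>' $ i \<in> \<int>" for i by (auto simp: lattice_def)
    have "\<xi> $ i = \<xi>' $ i" for i
      using fun_cong[OF eq, of i] l[of i] by (metis Ints_cases floor_of_int)
    then show "\<xi> = \<xi>'" by (simp add: vec_eq_iff)
  qed
  moreover have "?f ` ?X \<subseteq> PiE UNIV (\<lambda>_. {-N..N})"
  proof -
    have "- N \<le> \<lfloor>\<xi> $ i\<rfloor> \<and> \<lfloor>\<xi> $ i\<rfloor> \<le> N" if "\<xi> \<in> lattice" and le: "norm (\<xi> - x) \<le> c" for \<xi> i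
    proof -
    have int: "\<xi> $ i \<in> \<int>" using that by (simp add: lattice_def)
    have "\<bar>\<xi> $ i\<bar> \<le> norm \<xi>" by (rule component_le_norm_cart)
    also have "\<dots> \<le> norm x + c" using norm_triangle_ineq[of x "\<xi> - x"] le by simp
    also have "\<dots> \<le> of_int N" by (simp add: N_def)
    finally show ?thesis
      using int by (auto elim!: Ints_cases simp: abs_le_iff)
    qed
    then show ?thesis by (auto simp: PiE_iff)
  qed
  then have "finite (?f ` ?X)" by (rule finite_subset) (auto intro: finite_PiE)
  ultimately show ?thesis using finite_imageD by blast
qed

lemma kernel_radius:
  assumes "admissible_kernel \<zeta>"
  obtains c where "0 < c" "\<And>y. \<zeta> y \<noteq> 0 \<Longrightarrow> norm y \<le> c"
proof -
  have "bounded {x. \<zeta> x \<noteq> 0}"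
    using assms closure_subset compact_imp_bounded bounded_subset unfolding admissible_kernel_def by metis
  then show ?thesis using that unfolding bounded_pos by auto
qed

lemma finite_kernel_support: "admissible_kernel \<zeta> \<Longrightarrow> finite (kernel_support \<zeta> x)"
proof -
  assume "admissible_kernel \<zeta>"
  then obtain c where c: "\<And>y. \<zeta> y \<noteq> 0 \<Longrightarrow> norm y \<le> c" by (rule kernel_radius) blast
  show ?thesis
    by (rule finite_subset[OF _ finite_lattice_cball[of x c]]) (auto simp: kernel_support_def c)
qed

lemma kernel_sum_has_sum:
  fixes a :: "real^'n::finite \<Rightarrow> 'b::real_normed_vector"
  assumes "admissible_kernel \<zeta>"
  shows "((\<lambda>\<xi>. \<zeta> (\<xi> - x) *\<^sub>R a \<xi>) has_sum (\<Sum>\<xi>\<in>kernel_support \<zeta> x. \<zeta> (\<xi> - x) *\<^sub>R a \<xi>)) lattice"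
proof -
  have "((\<lambda>\<xi>. \<zeta> (\<xi> - x) *\<^sub>R a \<xi>) has_sum (\<Sum>\<xi>\<in>kernel_support \<zeta> x. \<zeta> (\<xi> - x) *\<^sub>R a \<xi>)) (kernel_support \<zeta> x)"
    by (rule has_sum_finite[OF finite_kernel_support[OF assms]])
  then show ?thesis
    by (rule has_sum_cong_neutral[THEN iffD1, rotated -1]) (auto simp: kernel_support_def)
qed

lemma kernel_affine_moment:
  assumes "admissible_kernel \<zeta>"
  shows "(\<Sum>\<xi>\<in>kernel_support \<zeta> x. \<zeta> (\<xi> - x) * (a + b \<bullet> \<xi>)) = a + b \<bullet> x"
proof -
  have "\<zeta> (x - \<xi>) = \<zeta> (\<xi> - x)" for \<xi>
    using assms minus_diff_eq[of \<xi> x] unfolding admissible_kernel_def by metis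
  then have "((\<lambda>\<xi>. \<zeta> (\<xi> - x) *\<^sub>R (a + b \<bullet> \<xi>)) has_sum (a + b \<bullet> x)) lattice"
  proof -
    have "((\<lambda>\<xi>. (a + b \<bullet> \<xi>) * \<zeta> (x - \<xi>)) has_sum (a + b \<bullet> x)) lattice"
      using assms unfolding admissible_kernel_def by blast
    then show ?thesis using \<open>\<And>\<xi>. \<zeta> (x - \<xi>) = \<zeta> (\<xi> - x)\<close> by (simp add: mult.commute)
  qed
  then have "(\<Sum>\<xi>\<in>kernel_support \<zeta> x. \<zeta> (\<xi> - x) *\<^sub>R (a + b \<bullet> \<xi>)) = a + b \<bullet> x"
    using has_sum_unique[OF kernel_sum_has_sum[OF assms, of x "\<lambda>\<xi>. a + b \<bullet> \<xi>"]] by blast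
  then show ?thesis by simp
qed

lemma kernel_mass: "admissible_kernel \<zeta> \<Longrightarrow> (\<Sum>\<xi>\<in>kernel_support \<zeta> x. \<zeta> (\<xi> - x)) = 1"
  using kernel_affine_moment[of \<zeta> x 1 0] by simp

lemma kernel_first_moment:
  assumes "admissible_kernel \<zeta>"
  shows "(\<Sum>\<xi>\<in>kernel_support \<zeta> x. \<zeta> (\<xi> - x) *\<^sub>R (\<xi> - x)) = 0"
proof (rule vector_eq_ldot[THEN iffD1], rule allI)
  fix b
  have "b \<bullet> (\<Sum>\<xi>\<in>kernel_support \<zeta> x. \<zeta> (\<xi> - x) *\<^sub>R (\<xi> - x))
      = (\<Sum>\<xi>\<in>kernel_support \<zeta> x. \<zeta> (\<xi> - x) * (- (b \<bullet> x) + b \<bullet> \<xi>))"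
    by (simp add: inner_sum_right inner_diff_right algebra_simps)
  then show "b \<bullet> (\<Sum>\<xi>\<in>kernel_support \<zeta> x. \<zeta> (\<xi> - x) *\<^sub>R (\<xi> - x)) = b \<bullet> 0"
    using kernel_affine_moment[OF assms, of x "- (b \<bullet> x)" b] by simp
qed

text \<open>Along the bond direction, \<open>\<chi>\<^sub>\<xi>\<^sub>,\<^sub>\<rho>(x + s \<rho>)\<close> is the integral of the continuous function
  \<open>t \<mapsto> \<zeta> (\<xi> - x + t \<rho>)\<close> over the moving interval from \<open>-s\<close> to \<open>1 - s\<close>, so the
  fundamental theorem of calculus applies at every \<open>x\<close>.\<close>

lemma bond_kernel_deriv_eq:
  assumes "admissible_kernel \<zeta>"
  shows "bond_kernel_deriv \<zeta> \<xi> \<rho> x = \<zeta> (\<xi> - x) - \<zeta> (\<xi> + \<rho> - x)"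
proof -
  define p where "p = (\<lambda>t::real. \<zeta> (\<xi> - x + t *\<^sub>R \<rho>))"
  have cont: "continuous_on UNIV \<zeta>" using assms by (simp add: admissible_kernel_def)
  have "continuous_on {-1..2} p"
    unfolding p_def by (rule continuous_on_compose2[OF cont]) (auto intro!: continuous_intros)
  then obtain P where P: "\<And>t. t \<in> {-1..2} \<Longrightarrow> (P has_vector_derivative p t) (at t within {-1..2})"
    using antiderivative_continuous by blast
  have P_at: "(P has_real_derivative p t) (at t)" if "t \<in> {-1<..<2}" for t
  proof -
    have "(P has_vector_derivative p t) (at t within {-1<..<2})"
      by (rule has_vector_derivative_within_subset[OF P]) (use that in auto)
    then show ?thesis using that
      by (simp add: has_real_derivative_iff_has_vector_derivative at_within_open[OF that])
  qed
  have eq: "P (1 - s) - P (- s) = bond_kernel \<zeta> \<xi> \<rho> (x + s *\<^sub>R \<rho>)" if s: "\<bar>s\<bar> < 1" for s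
  proof -
    have "((\<lambda>t. p (t - s)) has_integral P (1 - s) - P (0 - s)) {0..1}"
    proof (rule fundamental_theorem_of_calculus)
      fix t :: real assume t: "t \<in> {0..1}"
      have "((\<lambda>t. P (t - s)) has_real_derivative p (t - s) * 1) (at t)"
        by (rule DERIV_chain2[OF P_at]) (use s t in \<open>auto intro!: derivative_eq_intros\<close>)
      then show "((\<lambda>t. P (t - s)) has_vector_derivative p (t - s)) (at t within {0..1})"
        by (auto simp: has_real_derivative_iff_has_vector_derivative intro: has_vector_derivative_at_within)
    qed simp
    then show ?thesis
      by (simp add: bond_kernel_def p_def integral_unique algebra_simps)
  qed
  have "((\<lambda>s. P (1 - s) - P (- s)) has_real_derivative (p 1 * (- 1) - p 0 * (- 1))) (at 0)"
    by (intro DERIV_diff DERIV_chain2[of P]) (auto intro!: derivative_eq_intros P_at)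
  then have "((\<lambda>s. bond_kernel \<zeta> \<xi> \<rho> (x + s *\<^sub>R \<rho>)) has_real_derivative (p 1 * (- 1) - p 0 * (- 1))) (at 0)"
    by (rule DERIV_cong_ev[THEN iffD1, rotated -1])
      (use eventually_nhds_in_open[of "{-1<..<1}" "0::real"] eq in \<open>auto elim!: eventually_mono\<close>)
  then have "bond_kernel_deriv \<zeta> \<xi> \<rho> x = p 1 * (- 1) - p 0 * (- 1)"
    unfolding bond_kernel_deriv_def by (rule DERIV_imp_deriv)
  then show ?thesis by (simp add: p_def algebra_simps)
qed

text \<open>Summation by parts: the term with \<open>\<zeta>(\<xi> + \<rho> - x)\<close> is shifted by \<open>-\<rho>\<close>.\<close>

lemma div_atomistic_stress_eq:
  assumes "admissible_kernel \<zeta>"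
  shows "div_atomistic_stress \<zeta> \<kappa> V u x = (\<Sum>\<^sub>\<infinity>\<rho>\<in>lattice_star. \<Sum>\<xi>\<in>kernel_support \<zeta> x.
     \<zeta> (\<xi> - x) *\<^sub>R (V_grad \<kappa> V \<rho> (differences u \<xi>) - V_grad \<kappa> V \<rho> (differences u (\<xi> - \<rho>))))"
  unfolding div_atomistic_stress_def
proof (rule infsum_cong)
  fix \<rho> :: "real^'a" assume \<rho>: "\<rho> \<in> lattice_star"
  then have \<rho>': "\<rho> \<in> lattice" by (simp add: lattice_star_def)
  define a where "a = (\<lambda>\<xi>. V_grad \<kappa> V \<rho> (differences u \<xi>))"
  have 1: "((\<lambda>\<xi>. \<zeta> (\<xi> - x) *\<^sub>R a \<xi>) has_sum (\<Sum>\<xi>\<in>kernel_support \<zeta> x. \<zeta> (\<xi> - x) *\<^sub>R a \<xi>)) lattice"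
    by (rule kernel_sum_has_sum[OF assms])
  have "((\<lambda>\<xi>. \<zeta> (\<xi> - x) *\<^sub>R a (\<xi> - \<rho>)) has_sum (\<Sum>\<xi>\<in>kernel_support \<zeta> x. \<zeta> (\<xi> - x) *\<^sub>R a (\<xi> - \<rho>))) lattice"
    by (rule kernel_sum_has_sum[OF assms])
  then have "((\<lambda>\<xi>. \<zeta> (\<xi> + \<rho> - x) *\<^sub>R a \<xi>) has_sum (\<Sum>\<xi>\<in>kernel_support \<zeta> x. \<zeta> (\<xi> - x) *\<^sub>R a (\<xi> - \<rho>))) lattice"
    by (subst has_sum_reindex_bij_witness[of lattice "\<lambda>\<xi>. \<xi> - \<rho>" "\<lambda>\<xi>. \<xi> + \<rho>"])
      (auto simp: lattice_add lattice_diff \<rho>')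
  then have "((\<lambda>\<xi>. - (\<zeta> (\<xi> + \<rho> - x) *\<^sub>R a \<xi>)) has_sum
      - (\<Sum>\<xi>\<in>kernel_support \<zeta> x. \<zeta> (\<xi> - x) *\<^sub>R a (\<xi> - \<rho>))) lattice"
    by (subst has_sum_uminus) simp
  from has_sum_add[OF 1 this]
  have "((\<lambda>\<xi>. bond_kernel_deriv \<zeta> \<xi> \<rho> x *\<^sub>R a \<xi>) has_sum
      (\<Sum>\<xi>\<in>kernel_support \<zeta> x. \<zeta> (\<xi> - x) *\<^sub>R (a \<xi> - a (\<xi> - \<rho>)))) lattice"
    by (simp add: bond_kernel_deriv_eq[OF assms] scaleR_left_diff_distrib scaleR_right_diff_distrib sum_subtractf)
  then show "(\<Sum>\<^sub>\<infinity>\<xi>\<in>lattice. bond_kernel_deriv \<zeta> \<xi> \<rho> x *\<^sub>R V_grad \<kappa> V \<rho> (differences u \<xi>))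
      = (\<Sum>\<xi>\<in>kernel_support \<zeta> x. \<zeta> (\<xi> - x) *\<^sub>R (V_grad \<kappa> V \<rho> (differences u \<xi>) - V_grad \<kappa> V \<rho> (differences u (\<xi> - \<rho>))))"
    unfolding a_def by (rule infsumI)
qed

text \<open>The difference is linear in \<open>\<xi> - x\<close>, and the first moment of the weights about \<open>x\<close>
  vanishes.\<close>

lemma kernel_bilinear_cancellation:
  fixes \<gamma> :: "real^'n::finite \<Rightarrow> real^'n \<Rightarrow> 'b::real_normed_vector"
  assumes \<zeta>: "admissible_kernel \<zeta>" and l: "\<And>w'. linear (\<lambda>w. \<gamma> w w')" "\<And>w. linear (\<gamma> w)"
  shows "(\<Sum>\<xi>\<in>kernel_support \<zeta> x. \<zeta> (\<xi> - x) *\<^sub>R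
    (\<gamma> (\<xi> - x + y) (\<xi> - x + y') - \<gamma> (\<xi> - x - y) (\<xi> - x - y'))) = 0"
proof -
  have "\<zeta> (\<xi> - x) *\<^sub>R (\<gamma> (\<xi> - x + y) (\<xi> - x + y') - \<gamma> (\<xi> - x - y) (\<xi> - x - y'))
      = 2 *\<^sub>R \<gamma> (\<zeta> (\<xi> - x) *\<^sub>R (\<xi> - x)) y' + 2 *\<^sub>R \<gamma> y (\<zeta> (\<xi> - x) *\<^sub>R (\<xi> - x))" for \<xi>
  proof -
    have ex: "\<gamma> (z + y) (z + y') - \<gamma> (z - y) (z - y') = 2 *\<^sub>R \<gamma> z y' + 2 *\<^sub>R \<gamma> y z" for z
      by (simp add: linear_add[OF l(1)] linear_add[OF l(2)] linear_diff[OF l(1)] linear_diff[OF l(2)] scaleR_2)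
    show ?thesis unfolding ex linear_scale[OF l(1)] linear_scale[OF l(2)]
      by (simp add: scaleR_right_distrib mult.commute)
  qed
  then have "(\<Sum>\<xi>\<in>kernel_support \<zeta> x. \<zeta> (\<xi> - x) *\<^sub>R
      (\<gamma> (\<xi> - x + y) (\<xi> - x + y') - \<gamma> (\<xi> - x - y) (\<xi> - x - y')))
      = 2 *\<^sub>R \<gamma> (\<Sum>\<xi>\<in>kernel_support \<zeta> x. \<zeta> (\<xi> - x) *\<^sub>R (\<xi> - x)) y'
        + 2 *\<^sub>R \<gamma> y (\<Sum>\<xi>\<in>kernel_support \<zeta> x. \<zeta> (\<xi> - x) *\<^sub>R (\<xi> - x))"
    by (simp only: sum.distrib linear_sum[OF l(1)] linear_sum[OF l(2)] scaleR_sum_right)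
  then show ?thesis
    unfolding kernel_first_moment[OF \<zeta>] by (simp add: linear_0[OF l(1)] linear_0[OF l(2)])
qed


section \<open>Taylor expansion of the displacement\<close>

text \<open>The hull contains all \<open>a \<rho> + b \<sigma>\<close> with \<open>\<bar>a\<bar> \<le> 2\<close> and
  \<open>\<bar>b\<bar> \<le> 1\<close>. Half of the thickness \<open>2 c\<close> accommodates the lattice points at distance up to
  \<open>c\<close> from \<open>x\<close>, the other half the mollification radius.\<close>

lemma nu_contains:
  assumes z: "norm z \<le> c" and a: "\<bar>a\<bar> \<le> 1" and b: "\<bar>b\<bar> \<le> 1" and y: "y = x + z + a *\<^sub>R \<rho> + b *\<^sub>R \<sigma>"
  shows "cball y c \<subseteq> (+) x ` nu c \<rho> \<sigma>"
proof
  fix y' assume y': "y' \<in> cball y c"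
  let ?X = "{2 *\<^sub>R \<rho> + \<sigma>, 2 *\<^sub>R \<rho> - \<sigma>, - 2 *\<^sub>R \<rho> + \<sigma>, - 2 *\<^sub>R \<rho> - \<sigma>}"
  have mix: "m + t *\<^sub>R d \<in> convex hull ?X"
    if "m + d \<in> convex hull ?X" "m - d \<in> convex hull ?X" "\<bar>t\<bar> \<le> 1" for m d :: "real^'a" and t
  proof -
    have "((1 + t) / 2) *\<^sub>R (m + d) + ((1 - t) / 2) *\<^sub>R (m - d) \<in> convex hull ?X"
      by (rule convexD[OF convex_convex_hull that(1,2)]) (use that(3) in \<open>auto simp: field_simps abs_le_iff\<close>)
    moreover have "((1 + t) / 2) *\<^sub>R (m + d) + ((1 - t) / 2) *\<^sub>R (m - d) = m + t *\<^sub>R d"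
      by (simp add: vec_eq_iff field_simps)
    ultimately show ?thesis by simp
  qed
  have "\<sigma> + (a / 2) *\<^sub>R (2 *\<^sub>R \<rho>) \<in> convex hull ?X"
    by (rule mix) (use a in \<open>auto intro!: hull_inc simp: algebra_simps\<close>)
  moreover have "- \<sigma> + (a / 2) *\<^sub>R (2 *\<^sub>R \<rho>) \<in> convex hull ?X"
    by (rule mix) (use a in \<open>auto intro!: hull_inc simp: algebra_simps\<close>)
  ultimately have in_hull: "a *\<^sub>R \<rho> + b *\<^sub>R \<sigma> \<in> convex hull ?X"
    by (intro mix b) (simp_all add: algebra_simps)
  have "infdist (y' - x) (convex hull ?X) \<le> dist (y' - x) (a *\<^sub>R \<rho> + b *\<^sub>R \<sigma>)"
    by (rule infdist_le[OF in_hull])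
  also have "\<dots> = norm ((y' - y) + z)" by (simp add: dist_norm y algebra_simps)
  also have "\<dots> \<le> 2 * c" using norm_triangle_ineq[of "y' - y" z] y' z by (simp add: dist_norm norm_minus_commute)
  finally have "y' - x \<in> nu c \<rho> \<sigma>" by (simp add: nu_def)
  then show "y' \<in> (+) x ` nu c \<rho> \<sigma>" by (intro image_eqI[of _ _ "y' - x"]) auto
qed

lemma closed_nu: "closed (nu c \<rho> \<sigma>)"
  unfolding nu_def by (intro closed_Collect_le continuous_intros)

text \<open>Transfers real bounds to \<^typ>\<open>ennreal\<close>. Positivity of \<open>a\<close> is essential when \<open>X\<close> is
  infinite, since zero times infinity is zero.\<close>

lemma ennreal_le_mult_of_bound:
  assumes "0 < a" "\<And>B. 0 \<le> B \<Longrightarrow> X \<le> ennreal B \<Longrightarrow> r \<le> a * B"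
  shows "ennreal r \<le> ennreal a * X"
proof (cases X)
  case (real B)
  then have "r \<le> a * B" using assms(2) by simp
  then show ?thesis using real assms(1) by (simp add: ennreal_leI flip: ennreal_mult')
next
  case top
  then show ?thesis using assms(1) by (simp add: ennreal_mult_top)
qed

locale displacement =
  fixes \<eta> :: "nat \<Rightarrow> real^'n::finite \<Rightarrow> real" and u :: "real^'n \<Rightarrow> real^'n" and x :: "real^'n"
  assumes \<eta>: "\<And>n. mollifier (inverse (real (Suc n))) (\<eta> n)"
    and u: "continuous_on UNIV u" and u4: "sobolev_inf_loc 4 u"
begin

abbreviation v where "v \<equiv> jet \<eta> u"

lemma v_derivative: "length \<alpha>s \<le> 2 \<Longrightarrow> (v \<alpha>s has_derivative lin (\<lambda>\<alpha>. v (\<alpha> # \<alpha>s) y)) (at y)"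
  by (rule jet_has_derivative[OF \<eta> u u4]) simp

text \<open>The derivatives of \<open>u\<close> as multilinear forms: \<open>D2 y \<sigma> w\<close> differentiates \<open>\<nabla>u \<sigma>\<close>
  in direction \<open>w\<close>, and \<open>D3 y \<sigma> w w'\<close> differentiates this in direction \<open>w'\<close>.\<close>

definition D1 where "D1 y \<sigma> = lin (\<lambda>\<alpha>. v [\<alpha>] y) \<sigma>"
definition D2 where "D2 y \<sigma> w = lin (\<lambda>\<beta>. lin (\<lambda>\<alpha>. v [\<beta>, \<alpha>] y) \<sigma>) w"
definition D3 where "D3 y \<sigma> w w' = lin (\<lambda>\<gamma>. lin (\<lambda>\<beta>. lin (\<lambda>\<alpha>. v [\<gamma>, \<beta>, \<alpha>] y) \<sigma>) w) w'"

lemma u_has_derivative: "(u has_derivative D1 y) (at y)"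
  using v_derivative[of "[]"] unfolding D1_def jet_Nil[OF \<eta> u] by simp

lemma D1_has_derivative: "((\<lambda>y. D1 y \<sigma>) has_derivative D2 y \<sigma>) (at y)"
proof -
  have "((\<lambda>y. D1 y \<sigma>) has_derivative (\<lambda>h. lin (\<lambda>\<alpha>. lin (\<lambda>\<beta>. v [\<beta>, \<alpha>] y) h) \<sigma>)) (at y)"
    unfolding D1_def by (intro lin_has_derivative v_derivative) simp
  moreover have "(\<lambda>h. lin (\<lambda>\<alpha>. lin (\<lambda>\<beta>. v [\<beta>, \<alpha>] y) h) \<sigma>) = D2 y \<sigma>"
    by (rule ext) (unfold D2_def, rule lin_swap)
  ultimately show ?thesis by simp
qed

lemma D2_has_derivative: "((\<lambda>y. D2 y \<sigma> w) has_derivative D3 y \<sigma> w) (at y)"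
proof -
  have "((\<lambda>y. D2 y \<sigma> w) has_derivative
      (\<lambda>h. lin (\<lambda>\<beta>. lin (\<lambda>\<alpha>. lin (\<lambda>\<gamma>. v [\<gamma>, \<beta>, \<alpha>] y) h) \<sigma>) w)) (at y)"
    unfolding D2_def by (intro lin_has_derivative v_derivative) simp
  moreover have "(\<lambda>h. lin (\<lambda>\<beta>. lin (\<lambda>\<alpha>. lin (\<lambda>\<gamma>. v [\<gamma>, \<beta>, \<alpha>] y) h) \<sigma>) w) = D3 y \<sigma> w"
  proof
    fix h
    have "lin (\<lambda>\<alpha>. lin (\<lambda>\<gamma>. v [\<gamma>, \<beta>, \<alpha>] y) h) \<sigma> = lin (\<lambda>\<gamma>. lin (\<lambda>\<alpha>. v [\<gamma>, \<beta>, \<alpha>] y) \<sigma>) h" for \<beta>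
      by (rule lin_swap)
    then show "lin (\<lambda>\<beta>. lin (\<lambda>\<alpha>. lin (\<lambda>\<gamma>. v [\<gamma>, \<beta>, \<alpha>] y) h) \<sigma>) w = D3 y \<sigma> w h"
      unfolding D3_def by (simp only:) (rule lin_swap)
  qed
  ultimately show ?thesis by simp
qed

text \<open>The deviation of the finite difference of \<open>u\<close> across the bond from \<open>x + z\<close> to
  \<open>x + z + \<sigma>\<close> from its linearization at \<open>x\<close>. Its Taylor expansion consists of \<open>linear_part\<close>,
  affine in \<open>z\<close> and evaluated at the midpoint of the bond, and of \<open>quadratic_part\<close>. The
  latter is the average of \<open>D3 x \<sigma> w w / 2\<close> over the bond: its value at the midpoint, plus a
  correction that does not depend on \<open>z\<close>, as the variance of the uniform distribution on a
  unit interval is \<open>1/12\<close>.\<close>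

definition strain_defect where "strain_defect \<sigma> z = u (x + z + \<sigma>) - u (x + z) - D1 x \<sigma>"

abbreviation linear_part where "linear_part \<sigma> z \<equiv> D2 x \<sigma> (z + (1/2) *\<^sub>R \<sigma>)"

definition quadratic_part where
  "quadratic_part \<sigma> z = (1/2) *\<^sub>R (D3 x \<sigma> (z + (1/2) *\<^sub>R \<sigma>) (z + (1/2) *\<^sub>R \<sigma>) + (1/12) *\<^sub>R D3 x \<sigma> \<sigma> \<sigma>)"

lemma D2_linear: "linear (D2 y \<sigma>)"
  unfolding D2_def using bounded_linear_lin bounded_linear.linear by blast

lemma D3_linear_right: "linear (D3 y \<sigma> w)"
  unfolding D3_def using bounded_linear_lin bounded_linear.linear by blast

lemma D3_linear_left: "linear (\<lambda>w. D3 y \<sigma> w w')"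
proof -
  have "(\<lambda>w. D3 y \<sigma> w w') = lin (\<lambda>\<beta>. lin (\<lambda>\<gamma>. lin (\<lambda>\<alpha>. v [\<gamma>, \<beta>, \<alpha>] y) \<sigma>) w')"
    by (rule ext, unfold D3_def) (rule lin_swap)
  then show ?thesis using bounded_linear_lin bounded_linear.linear by metis
qed

lemma norm_D2_le:
  "(\<And>\<alpha> \<beta>. norm (v [\<beta>, \<alpha>] y) \<le> B) \<Longrightarrow> norm (D2 y \<sigma> w) \<le> real CARD('n) ^ 2 * norm \<sigma> * norm w * B"
  using norm_lin_le[OF norm_lin_le, of "\<lambda>\<beta> \<alpha>. v [\<beta>, \<alpha>] y" B \<sigma> w]
  by (simp add: D2_def power2_eq_square mult_ac)

lemma norm_D3_le:
  "(\<And>\<alpha> \<beta> \<gamma>. norm (v [\<gamma>, \<beta>, \<alpha>] y) \<le> B) \<Longrightarrow>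
    norm (D3 y \<sigma> w w') \<le> real CARD('n) ^ 3 * norm \<sigma> * norm w * norm w' * B"
  using norm_lin_le[OF norm_lin_le[OF norm_lin_le], of "\<lambda>\<gamma> \<beta> \<alpha>. v [\<gamma>, \<beta>, \<alpha>] y" B \<sigma> w w']
  by (simp add: D3_def power3_eq_cube mult_ac)

lemma norm_D3_diff_le:
  assumes "\<And>\<alpha> \<beta> \<gamma>. norm (v [\<gamma>, \<beta>, \<alpha>] y' - v [\<gamma>, \<beta>, \<alpha>] y) \<le> B"
  shows "norm (D3 y' \<sigma> w w' - D3 y \<sigma> w w') \<le> real CARD('n) ^ 3 * norm \<sigma> * norm w * norm w' * B"
  using norm_lin_le[OF norm_lin_le[OF norm_lin_le], of "\<lambda>\<gamma> \<beta> \<alpha>. v [\<gamma>, \<beta>, \<alpha>] y' - v [\<gamma>, \<beta>, \<alpha>] y" B \<sigma> w w'] assms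
  by (simp add: D3_def lin_diff power3_eq_cube mult_ac)

lemma card_index_ge_1: "1 \<le> real CARD('n)"
  using zero_less_card_finite[where ?'a = 'n] by (simp add: Suc_le_eq)

context
  fixes A :: "(real^'n) set" and r :: real and w :: "real^'n"
  assumes A: "closed A" "0 < r" "\<And>t. t \<in> {0..1} \<Longrightarrow> cball (x + t *\<^sub>R w) r \<subseteq> A"
begin

lemma jet_bound_on_segment:
  assumes "t \<in> {0..1}" "length \<alpha>s < 4" "0 \<le> B" "Linf_norm A (grad_norm (length \<alpha>s) u) \<le> ennreal B"
  shows "norm (v \<alpha>s (x + t *\<^sub>R w)) \<le> B"
  by (rule norm_jet_le[OF \<eta> u u4 assms(2) A(1,2) A(3)[OF assms(1)] assms(3,4)])

text \<open>The expansions are made for \<open>\<nabla>u \<sigma>\<close> rather than for \<open>u\<close>, so that every bound contains a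
  factor \<open>\<bar>\<sigma>\<bar>\<close>; it provides the factors \<open>\<bar>\<rho>\<^sub>i\<bar>\<close> with \<open>i \<ge> 2\<close> in the
  weights.\<close>

lemma gradient_increment_first_order:
  assumes B: "0 \<le> B" "Linf_norm A (grad_norm 2 u) \<le> ennreal B"
  shows "norm (D1 (x + w) \<sigma> - D1 x \<sigma>) \<le> real CARD('n) ^ 2 * norm \<sigma> * norm w * B"
proof -
  have "norm (D1 (x + 1 *\<^sub>R w) \<sigma> - D1 (x + 0 *\<^sub>R w) \<sigma>) \<le> real CARD('n) ^ 2 * norm \<sigma> * norm w * B"
  proof (rule interval_mean_value_bound)
    fix t :: real assume t: "t \<in> {0..1}"
    show "((\<lambda>t. D1 (x + t *\<^sub>R w) \<sigma>) has_vector_derivative D2 (x + t *\<^sub>R w) \<sigma> w) (at t within {0..1})"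
      by (rule has_derivative_along_line[OF D1_has_derivative])
    show "norm (D2 (x + t *\<^sub>R w) \<sigma> w) \<le> real CARD('n) ^ 2 * norm \<sigma> * norm w * B"
      by (rule norm_D2_le, rule jet_bound_on_segment[OF t]) (use B in \<open>simp_all add: numeral_2_eq_2\<close>)
  qed simp
  then show ?thesis by simp
qed

lemma gradient_increment_second_order:
  assumes B: "0 \<le> B" "Linf_norm A (grad_norm 3 u) \<le> ennreal B"
  shows "norm (D1 (x + w) \<sigma> - D1 x \<sigma> - D2 x \<sigma> w) \<le> real CARD('n) ^ 3 * norm \<sigma> * norm w ^ 2 * B"
proof -
  have "norm (D1 (x + 1 *\<^sub>R w) \<sigma> - D1 (x + 0 *\<^sub>R w) \<sigma> - D2 (x + 0 *\<^sub>R w) \<sigma> w)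
      \<le> real CARD('n) ^ 3 * norm \<sigma> * norm w * norm w * B"
  proof (rule taylor_second_order)
    fix t :: real assume t: "t \<in> {0..1}"
    show "((\<lambda>t. D1 (x + t *\<^sub>R w) \<sigma>) has_vector_derivative D2 (x + t *\<^sub>R w) \<sigma> w) (at t within {0..1})"
      by (rule has_derivative_along_line[OF D1_has_derivative])
    show "((\<lambda>t. D2 (x + t *\<^sub>R w) \<sigma> w) has_vector_derivative D3 (x + t *\<^sub>R w) \<sigma> w w) (at t within {0..1})"
      by (rule has_derivative_along_line[OF D2_has_derivative])
    show "norm (D3 (x + t *\<^sub>R w) \<sigma> w w) \<le> real CARD('n) ^ 3 * norm \<sigma> * norm w * norm w * B"
      by (rule norm_D3_le, rule jet_bound_on_segment[OF t]) (use B in \<open>simp_all add: numeral_3_eq_3\<close>)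
  qed
  then show ?thesis by (simp add: power2_eq_square mult.assoc)
qed

lemma gradient_increment_third_order:
  assumes B: "0 \<le> B" "Linf_norm A (grad_norm 4 u) \<le> ennreal B"
  shows "norm (D1 (x + w) \<sigma> - D1 x \<sigma> - D2 x \<sigma> w - (1/2) *\<^sub>R D3 x \<sigma> w w)
    \<le> real CARD('n) ^ 4 * norm \<sigma> * norm w ^ 3 * B"
proof -
  have "norm (D1 (x + 1 *\<^sub>R w) \<sigma> - D1 (x + 0 *\<^sub>R w) \<sigma> - D2 (x + 0 *\<^sub>R w) \<sigma> w
      - (1/2) *\<^sub>R D3 (x + 0 *\<^sub>R w) \<sigma> w w) \<le> real CARD('n) ^ 3 * norm \<sigma> * norm w * norm w * (real CARD('n) * (norm w * B))"
  proof (rule taylor_third_order)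
    fix t :: real assume t: "t \<in> {0..1}"
    show "((\<lambda>t. D1 (x + t *\<^sub>R w) \<sigma>) has_vector_derivative D2 (x + t *\<^sub>R w) \<sigma> w) (at t within {0..1})"
      by (rule has_derivative_along_line[OF D1_has_derivative])
    show "((\<lambda>t. D2 (x + t *\<^sub>R w) \<sigma> w) has_vector_derivative D3 (x + t *\<^sub>R w) \<sigma> w w) (at t within {0..1})"
      by (rule has_derivative_along_line[OF D2_has_derivative])
    show "norm (D3 (x + t *\<^sub>R w) \<sigma> w w - D3 (x + 0 *\<^sub>R w) \<sigma> w w)
        \<le> real CARD('n) ^ 3 * norm \<sigma> * norm w * norm w * (real CARD('n) * (norm w * B))"
    proof (rule norm_D3_diff_le)
      fix \<alpha> \<beta> \<gamma>
      have "norm (v [\<gamma>, \<beta>, \<alpha>] (x + t *\<^sub>R w) - v [\<gamma>, \<beta>, \<alpha>] (x + 0 *\<^sub>R w))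
          \<le> real CARD('n) * (norm ((x + t *\<^sub>R w) - (x + 0 *\<^sub>R w)) * B)"
      proof (rule jet_lipschitz[OF \<eta> u _ A(1,2) _ B(1)])
        show "cball z r \<subseteq> A" if z: "z \<in> closed_segment (x + 0 *\<^sub>R w) (x + t *\<^sub>R w)" for z
        proof -
          obtain s where s: "0 \<le> s" "s \<le> 1" "z = (1 - s) *\<^sub>R (x + 0 *\<^sub>R w) + s *\<^sub>R (x + t *\<^sub>R w)"
            using z in_segment(1)[of z "x + 0 *\<^sub>R w" "x + t *\<^sub>R w"] by metis
          have "z = x + (s * t) *\<^sub>R w" unfolding s(3) by (simp add: algebra_simps)
          moreover have "s * t \<in> {0..1}" using s(1,2) t by (simp add: mult_le_one)
          ultimately show ?thesis using A(3)[of "s * t"] by (simp only:)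
        qed
        have "Suc (length [\<gamma>, \<beta>, \<alpha>]) = 4" by simp
        then show "sobolev_inf_loc (Suc (length [\<gamma>, \<beta>, \<alpha>])) u"
          "Linf_norm A (grad_norm (Suc (length [\<gamma>, \<beta>, \<alpha>])) u) \<le> ennreal B"
          using u4 B(2) by (simp_all only:)
      qed
      also have "\<dots> \<le> real CARD('n) * (norm w * B)"
      proof (intro mult_left_mono mult_right_mono B(1))
        show "norm ((x + t *\<^sub>R w) - (x + 0 *\<^sub>R w)) \<le> norm w"
          using t mult_right_mono[of t 1 "norm w"] by simp
      qed simp
      finally show "norm (v [\<gamma>, \<beta>, \<alpha>] (x + t *\<^sub>R w) - v [\<gamma>, \<beta>, \<alpha>] (x + 0 *\<^sub>R w)) \<le> real CARD('n) * (norm w * B)" .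
    qed
  qed
  also have "\<dots> = real CARD('n) ^ 4 * norm \<sigma> * norm w ^ 3 * B"
    by (simp add: power4_eq_xxxx power3_eq_cube)
  finally show ?thesis by simp
qed

end

context
  fixes A :: "(real^'n) set" and r :: real and \<sigma> z :: "real^'n" and L :: real
  assumes A: "closed A" "0 < r" "\<And>t s. t \<in> {0..1} \<Longrightarrow> s \<in> {0..1} \<Longrightarrow> cball (x + t *\<^sub>R (z + s *\<^sub>R \<sigma>)) r \<subseteq> A"
    and L: "norm z + norm \<sigma> \<le> L"
begin

lemma norm_segment_le: "s \<in> {0..1} \<Longrightarrow> norm (z + s *\<^sub>R \<sigma>) \<le> L"
proof -
  assume s: "s \<in> {0..1}"
  have "norm (z + s *\<^sub>R \<sigma>) \<le> norm z + norm (s *\<^sub>R \<sigma>)" by (rule norm_triangle_ineq)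
  also have "\<dots> \<le> norm z + norm \<sigma>" using s by (simp add: mult_left_le_one_le)
  finally show ?thesis using L by linarith
qed

lemma displacement_line_derivative:
  "((\<lambda>s. u (x + z + s *\<^sub>R \<sigma>)) has_vector_derivative D1 (x + (z + s *\<^sub>R \<sigma>)) \<sigma>) (at s within {0..1})"
  using has_derivative_along_line[OF u_has_derivative, where a = "x + z"] by (simp only: add.assoc)

text \<open>The bounds on the finite difference follow by integrating those for the gradient along
  the bond; the distance from \<open>x\<close> to points of the bond is at most \<open>\<bar>z\<bar> + \<bar>\<sigma>\<bar>\<close>. The common
  constant \<open>CARD('n) ^ 4\<close> is that of the highest order.\<close>

lemma strain_defect_bound:
  assumes B: "0 \<le> B" "Linf_norm A (grad_norm 2 u) \<le> ennreal B"
  shows "norm (strain_defect \<sigma> z) \<le> real CARD('n) ^ 4 * norm \<sigma> * L * B"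
proof -
  have L0: "0 \<le> L" using L norm_ge_zero[of z] norm_ge_zero[of \<sigma>] by linarith
  let ?q = "\<lambda>s. u (x + z + s *\<^sub>R \<sigma>) - s *\<^sub>R D1 x \<sigma>"
  have "norm (?q 1 - ?q 0) \<le> real CARD('n) ^ 4 * norm \<sigma> * L * B"
  proof (rule interval_mean_value_bound[where f = ?q and f' = "\<lambda>s. D1 (x + (z + s *\<^sub>R \<sigma>)) \<sigma> - D1 x \<sigma>"])
    fix s :: real assume s: "s \<in> {0..1}"
    show "(?q has_vector_derivative D1 (x + (z + s *\<^sub>R \<sigma>)) \<sigma> - D1 x \<sigma>) (at s within {0..1})"
      by (auto intro!: derivative_eq_intros displacement_line_derivative)
    have "norm (D1 (x + (z + s *\<^sub>R \<sigma>)) \<sigma> - D1 x \<sigma>) \<le> real CARD('n) ^ 2 * norm \<sigma> * norm (z + s *\<^sub>R \<sigma>) * B"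
      by (rule gradient_increment_first_order[OF A(1,2) A(3) B]) (use s in auto)
    also have "\<dots> \<le> real CARD('n) ^ 4 * norm \<sigma> * L * B"
      by (intro mult_mono norm_segment_le s power_increasing card_index_ge_1) (use B L0 in auto)
    finally show "norm (D1 (x + (z + s *\<^sub>R \<sigma>)) \<sigma> - D1 x \<sigma>) \<le> real CARD('n) ^ 4 * norm \<sigma> * L * B" .
  qed simp
  then show ?thesis by (simp add: strain_defect_def algebra_simps)
qed

lemma strain_defect_linear_bound:
  assumes B: "0 \<le> B" "Linf_norm A (grad_norm 2 u) \<le> ennreal B"
  shows "norm (linear_part \<sigma> z) \<le> real CARD('n) ^ 4 * norm \<sigma> * L * B"
proof -
  have L0: "0 \<le> L" using L norm_ge_zero[of z] norm_ge_zero[of \<sigma>] by linarith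
  have "norm (linear_part \<sigma> z) \<le> real CARD('n) ^ 2 * norm \<sigma> * norm (z + (1/2) *\<^sub>R \<sigma>) * B"
  proof (rule norm_D2_le)
    fix \<alpha> \<beta>
    show "norm (v [\<beta>, \<alpha>] x) \<le> B"
      by (rule norm_jet_le[OF \<eta> u u4 _ A(1,2)]) (use A(3)[of 0 0] B in \<open>simp_all add: numeral_2_eq_2\<close>)
  qed
  also have "\<dots> \<le> real CARD('n) ^ 4 * norm \<sigma> * L * B"
    by (intro mult_mono norm_segment_le power_increasing card_index_ge_1) (use B L0 in auto)
  finally show ?thesis .
qed

lemma strain_defect_second_order:
  assumes B: "0 \<le> B" "Linf_norm A (grad_norm 3 u) \<le> ennreal B"
  shows "norm (strain_defect \<sigma> z - linear_part \<sigma> z) \<le> real CARD('n) ^ 4 * norm \<sigma> * L ^ 2 * B"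
proof -
  have L0: "0 \<le> L" using L norm_ge_zero[of z] norm_ge_zero[of \<sigma>] by linarith
  let ?q = "\<lambda>s. u (x + z + s *\<^sub>R \<sigma>) - s *\<^sub>R D1 x \<sigma> - (s *\<^sub>R D2 x \<sigma> z + (s ^ 2 / 2) *\<^sub>R D2 x \<sigma> \<sigma>)"
  let ?q' = "\<lambda>s. D1 (x + (z + s *\<^sub>R \<sigma>)) \<sigma> - D1 x \<sigma> - D2 x \<sigma> (z + s *\<^sub>R \<sigma>)"
  have "norm (?q 1 - ?q 0) \<le> real CARD('n) ^ 4 * norm \<sigma> * L ^ 2 * B"
  proof (rule interval_mean_value_bound[where f = ?q and f' = ?q'])
    fix s :: real assume s: "s \<in> {0..1}"
    show "(?q has_vector_derivative ?q' s) (at s within {0..1})"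
      by (auto intro!: derivative_eq_intros displacement_line_derivative
          simp: linear_add[OF D2_linear] linear_scale[OF D2_linear])
    have "norm (?q' s) \<le> real CARD('n) ^ 3 * norm \<sigma> * norm (z + s *\<^sub>R \<sigma>) ^ 2 * B"
      by (rule gradient_increment_second_order[OF A(1,2) A(3) B]) (use s in auto)
    also have "\<dots> \<le> real CARD('n) ^ 4 * norm \<sigma> * L ^ 2 * B"
      by (intro mult_mono norm_segment_le s power_increasing card_index_ge_1 power_mono) (use B L0 in auto)
    finally show "norm (?q' s) \<le> real CARD('n) ^ 4 * norm \<sigma> * L ^ 2 * B" .
  qed simp
  then show ?thesis
    by (simp add: strain_defect_def linear_add[OF D2_linear] linear_scale[OF D2_linear] algebra_simps)
qed

lemma strain_defect_third_order:
  assumes B: "0 \<le> B" "Linf_norm A (grad_norm 4 u) \<le> ennreal B"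
  shows "norm (strain_defect \<sigma> z - linear_part \<sigma> z - quadratic_part \<sigma> z) \<le> real CARD('n) ^ 4 * norm \<sigma> * L ^ 3 * B"
proof -
  have L0: "0 \<le> L" using L norm_ge_zero[of z] norm_ge_zero[of \<sigma>] by linarith
  note lin_rules = linear_add[OF D2_linear] linear_scale[OF D2_linear] linear_add[OF D3_linear_right]
    linear_scale[OF D3_linear_right] linear_add[OF D3_linear_left] linear_scale[OF D3_linear_left]
  \<comment> \<open>The antiderivative in \<open>s\<close> of \<open>D3 x \<sigma> (z + s \<sigma>) (z + s \<sigma>) / 2\<close>\<close>
  let ?p = "\<lambda>s. (s / 2) *\<^sub>R D3 x \<sigma> z z + (s ^ 2 / 4) *\<^sub>R (D3 x \<sigma> z \<sigma> + D3 x \<sigma> \<sigma> z) + (s ^ 3 / 6) *\<^sub>R D3 x \<sigma> \<sigma> \<sigma>"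
  let ?q = "\<lambda>s. u (x + z + s *\<^sub>R \<sigma>) - s *\<^sub>R D1 x \<sigma> - (s *\<^sub>R D2 x \<sigma> z + (s ^ 2 / 2) *\<^sub>R D2 x \<sigma> \<sigma>) - ?p s"
  let ?q' = "\<lambda>s. D1 (x + (z + s *\<^sub>R \<sigma>)) \<sigma> - D1 x \<sigma> - D2 x \<sigma> (z + s *\<^sub>R \<sigma>)
      - (1/2) *\<^sub>R D3 x \<sigma> (z + s *\<^sub>R \<sigma>) (z + s *\<^sub>R \<sigma>)"
  have "norm (?q 1 - ?q 0) \<le> real CARD('n) ^ 4 * norm \<sigma> * L ^ 3 * B"
  proof (rule interval_mean_value_bound[where f = ?q and f' = ?q'])
    fix s :: real assume s: "s \<in> {0..1}"
    have "(?q has_vector_derivative (D1 (x + (z + s *\<^sub>R \<sigma>)) \<sigma> - D1 x \<sigma> - (D2 x \<sigma> z + s *\<^sub>R D2 x \<sigma> \<sigma>)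
        - ((1/2) *\<^sub>R D3 x \<sigma> z z + (s / 2) *\<^sub>R (D3 x \<sigma> z \<sigma> + D3 x \<sigma> \<sigma> z) + (s ^ 2 / 2) *\<^sub>R D3 x \<sigma> \<sigma> \<sigma>))) (at s within {0..1})"
      by (auto intro!: derivative_eq_intros displacement_line_derivative)
    moreover have "(D1 (x + (z + s *\<^sub>R \<sigma>)) \<sigma> - D1 x \<sigma> - (D2 x \<sigma> z + s *\<^sub>R D2 x \<sigma> \<sigma>)
        - ((1/2) *\<^sub>R D3 x \<sigma> z z + (s / 2) *\<^sub>R (D3 x \<sigma> z \<sigma> + D3 x \<sigma> \<sigma> z) + (s ^ 2 / 2) *\<^sub>R D3 x \<sigma> \<sigma> \<sigma>)) = ?q' s"
      by (simp add: lin_rules algebra_simps power2_eq_square)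
    ultimately show "(?q has_vector_derivative ?q' s) (at s within {0..1})" by simp
    have "norm (?q' s) \<le> real CARD('n) ^ 4 * norm \<sigma> * norm (z + s *\<^sub>R \<sigma>) ^ 3 * B"
      by (rule gradient_increment_third_order[OF A(1,2) A(3) B]) (use s in auto)
    also have "\<dots> \<le> real CARD('n) ^ 4 * norm \<sigma> * L ^ 3 * B"
      by (intro mult_mono norm_segment_le s power_mono) (use B L0 in auto)
    finally show "norm (?q' s) \<le> real CARD('n) ^ 4 * norm \<sigma> * L ^ 3 * B" .
  qed simp
  moreover have "?q 1 - ?q 0 = strain_defect \<sigma> z - linear_part \<sigma> z - quadratic_part \<sigma> z"
  proof -
    have "linear_part \<sigma> z = 1 *\<^sub>R D2 x \<sigma> z + (1 ^ 2 / 2) *\<^sub>R D2 x \<sigma> \<sigma>" by (simp add: lin_rules)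
    moreover have "quadratic_part \<sigma> z = ?p 1"
    proof -
      have "quadratic_part \<sigma> z = (1/2) *\<^sub>R D3 x \<sigma> z z + (1/4) *\<^sub>R (D3 x \<sigma> z \<sigma> + D3 x \<sigma> \<sigma> z) + (1/8 + 1/24) *\<^sub>R D3 x \<sigma> \<sigma> \<sigma>"
        unfolding quadratic_part_def scaleR_left_distrib by (simp add: lin_rules scaleR_right_distrib)
      then show ?thesis by simp
    qed
    ultimately show ?thesis by (simp add: strain_defect_def algebra_simps)
  qed
  ultimately show ?thesis by simp
qed

end

end


section \<open>The two stress divergences as lattice sums\<close>

lemma summable_of_ennreal_bound:
  fixes f :: "'i \<Rightarrow> real"
  assumes B: "\<And>i. i \<in> A \<Longrightarrow> ennreal \<bar>f i\<bar> \<le> B i" and fin: "infsum B A < \<infinity>"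
  shows "f summable_on A"
proof (rule abs_summable_summable, subst abs_summable_iff_bdd_above, rule bdd_aboveI)
  fix y assume "y \<in> sum (\<lambda>x. norm (f x)) ` {F. F \<subseteq> A \<and> finite F}"
  then obtain F where F: "F \<subseteq> A" "finite F" and y: "y = (\<Sum>i\<in>F. \<bar>f i\<bar>)" by auto
  have "ennreal y = (\<Sum>i\<in>F. ennreal \<bar>f i\<bar>)" by (simp add: y)
  also have "\<dots> \<le> sum B F" using F B by (intro sum_mono) auto
  also have "\<dots> = infsum B F" using F by simp
  also have "\<dots> \<le> infsum B A" using F by (intro infsum_mono_neutral ennreal_summable) auto
  finally show "y \<le> enn2real (infsum B A)"
    using fin by (simp add: y ennreal_le_iff2 enn2real_mono enn2real_leI flip: ennreal_enn2real_if)
      (metis enn2real_ennreal enn2real_mono infinity_ennreal_def sum_nonneg abs_ge_zero)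
qed

lemma has_sum_vec:
  fixes v :: "'i \<Rightarrow> real^'n"
  assumes "\<And>i. ((\<lambda>\<rho>. v \<rho> $ i) has_sum s $ i) A"
  shows "(v has_sum s) A"
  using assms unfolding has_sum_def by (intro vec_tendstoI) simp

lemma has_sum_finite_sum:
  fixes f :: "'p \<Rightarrow> 'i \<Rightarrow> real"
  shows "(\<And>p. p \<in> P \<Longrightarrow> (f p has_sum s p) A) \<Longrightarrow> ((\<lambda>i. \<Sum>p\<in>P. f p i) has_sum (\<Sum>p\<in>P. s p)) A"
  by (induction P rule: infinite_finite_induct) (auto intro: has_sum_add)

lemma has_sum_star_tuples_Suc:
  fixes f :: "(real^'n::finite) list \<Rightarrow> real"
  assumes f: "(f has_sum s) (star_tuples (Suc j))"
    and g: "\<And>\<rho>. \<rho> \<in> lattice_star \<Longrightarrow> ((\<lambda>\<sigma>s. f (\<rho> # \<sigma>s)) has_sum g \<rho>) (star_tuples j)"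
  shows "(g has_sum s) lattice_star"
proof (rule has_sum_SigmaD[where f = "\<lambda>(\<rho>, \<sigma>s). f (\<rho> # \<sigma>s)" and B = "\<lambda>_. star_tuples j"])
  have "bij_betw (\<lambda>(\<rho>, \<sigma>s). \<rho> # \<sigma>s) (lattice_star \<times> star_tuples j) (star_tuples (Suc j) :: (real^'n) list set)"
    unfolding star_tuples_Suc by (auto simp: bij_betw_def inj_on_def)
  from has_sum_reindex_bij_betw[OF this, of f s] f
  show "((\<lambda>(\<rho>, \<sigma>s). f (\<rho> # \<sigma>s)) has_sum s) (SIGMA \<rho>:lattice_star. star_tuples j)"
    by (simp add: case_prod_unfold)
qed (use g in simp)

lemma linear_single: "\<rho> \<in> lattice_star \<Longrightarrow> linear (single \<rho>)"
  by (rule linearI) (auto intro!: stencil_eqI simp: entry_single)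

locale model = potential \<kappa> k V + displacement \<eta> u x
  for \<kappa> k and V :: "'n::finite stencil \<Rightarrow> ereal" and \<eta> u and x :: "real^'n" +
  fixes \<zeta> :: "real^'n \<Rightarrow> real" and c :: real
  assumes \<zeta>: "admissible_kernel \<zeta>" and c: "0 < c" "\<And>y. \<zeta> y \<noteq> 0 \<Longrightarrow> norm y \<le> c"
    and uK: "u \<in> K_set \<kappa>"
begin

abbreviation nodes where "nodes \<equiv> kernel_support \<zeta> x"

lemma D1_linear: "linear (D1 y)"
  unfolding D1_def using bounded_linear_lin bounded_linear.linear by blast

lemma D2_linear_left: "linear (\<lambda>\<sigma>. D2 y \<sigma> w)"
proof -
  have "(\<lambda>\<sigma>. D2 y \<sigma> w) = lin (\<lambda>\<alpha>. lin (\<lambda>\<beta>. v [\<beta>, \<alpha>] y) w)"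
    by (rule ext, unfold D2_def) (rule lin_swap)
  then show ?thesis using bounded_linear_lin bounded_linear.linear by metis
qed

lemma norm_D1_le: "norm (D1 y h) \<le> \<kappa> * norm h"
  unfolding D1_def
  by (rule norm_gradient_le[OF \<eta> u u4]) (use \<kappa> uK in \<open>auto simp: K_set_def\<close>)

lemma u_lipschitz: "norm (u (y + h) - u y) \<le> \<kappa> * norm h"
proof -
  have "norm (u (y + 1 *\<^sub>R h) - u (y + 0 *\<^sub>R h)) \<le> \<kappa> * norm h"
    by (rule interval_mean_value_bound[OF has_derivative_along_line[OF u_has_derivative]])
      (auto intro: norm_D1_le)
  then show ?thesis by simp
qed

lemma entry_differences: "entry (differences u \<xi>) \<rho> = (if \<rho> \<in> lattice_star then u (\<xi> + \<rho>) - u \<xi> else 0)"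
  unfolding differences_def by (rule entry_family) (rule u_lipschitz)

lemma differences_in_S: "differences u \<xi> \<in> S"
  by (auto simp: norm_stencil_le_iff entry_differences u_lipschitz)

text \<open>The stencils \<open>(\<nabla>u(y) \<sigma>)\<^sub>\<sigma>\<close> and
  \<open>(\<nabla>\<^sub>w\<nabla>\<^sub>\<sigma>u(x))\<^sub>\<sigma>\<close>. The latter is the derivative in direction \<open>w\<close> at
  \<open>x\<close> of the former as a map into the interaction space, which is seen by writing it as a
  finite sum of bounded linear images of the partial derivatives of \<open>u\<close>.\<close>

definition gradient_stencil where "gradient_stencil y = family (D1 y)"

lemma entry_gradient_stencil: "entry (gradient_stencil y) \<rho> = (if \<rho> \<in> lattice_star then D1 y \<rho> else 0)"
  unfolding gradient_stencil_def by (rule entry_family) (rule norm_D1_le)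

lemma gradient_stencil_in_S: "gradient_stencil y \<in> S"
  by (auto simp: norm_stencil_le_iff entry_gradient_stencil norm_D1_le)

abbreviation G where "G \<equiv> gradient_stencil x"

definition hessian_stencil where "hessian_stencil w = family (\<lambda>\<sigma>. D2 x \<sigma> w)"

lemma entry_hessian_stencil: "entry (hessian_stencil w) \<sigma> = (if \<sigma> \<in> lattice_star then D2 x \<sigma> w else 0)"
proof -
  obtain C where "\<And>\<sigma>. norm (D2 x \<sigma> w) \<le> C * norm \<sigma>"
    using linear_bounded[OF D2_linear_left] by blast
  then show ?thesis unfolding hessian_stencil_def by (rule entry_family)
qed

definition tensor where "tensor \<alpha> a = family (\<lambda>\<sigma>. \<sigma> $ \<alpha> *\<^sub>R a)" for a :: "real^'n"

lemma entry_tensor: "entry (tensor \<alpha> a) \<sigma> = (if \<sigma> \<in> lattice_star then \<sigma> $ \<alpha> *\<^sub>R a else 0)"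
  unfolding tensor_def
  by (rule entry_family[where C = "norm a"])
    (simp add: mult.commute[of "norm a"] mult_right_mono component_le_norm_cart)

lemma bounded_linear_tensor: "bounded_linear (tensor \<alpha>)"
proof (rule bounded_linear_intro[where K = 1])
  show "norm (tensor \<alpha> a) \<le> norm a * 1" for a
    by (auto simp: norm_stencil_le_iff entry_tensor mult.commute[of "norm a"] intro!: mult_right_mono component_le_norm_cart)
qed (auto intro!: stencil_eqI simp: entry_tensor scaleR_right_distrib)

lemma entry_sum: "entry (\<Sum>i\<in>I. g i) \<sigma> = (\<Sum>i\<in>I. entry (g i) \<sigma>)"
  by (induction I rule: infinite_finite_induct) auto

lemma gradient_stencil_has_derivative: "(gradient_stencil has_derivative hessian_stencil) (at x)"
proof -
  have "((\<lambda>y. \<Sum>\<alpha>\<in>UNIV. tensor \<alpha> (v [\<alpha>] y)) has_derivative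
      (\<lambda>h. \<Sum>\<alpha>\<in>UNIV. tensor \<alpha> (lin (\<lambda>\<beta>. v [\<beta>, \<alpha>] x) h))) (at x)"
    by (intro has_derivative_sum bounded_linear.has_derivative[OF bounded_linear_tensor] v_derivative) simp
  moreover have "(\<lambda>y. \<Sum>\<alpha>\<in>UNIV. tensor \<alpha> (v [\<alpha>] y)) = gradient_stencil"
    by (rule ext, rule stencil_eqI) (simp add: entry_sum entry_tensor entry_gradient_stencil D1_def lin_def)
  moreover have "(\<lambda>h. \<Sum>\<alpha>\<in>UNIV. tensor \<alpha> (lin (\<lambda>\<beta>. v [\<beta>, \<alpha>] x) h)) = hessian_stencil"
  proof (rule ext, rule stencil_eqI)
    fix h \<sigma> :: "real^'n" assume "\<sigma> \<in> lattice_star"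
    moreover have "D2 x \<sigma> h = lin (\<lambda>\<alpha>. lin (\<lambda>\<beta>. v [\<beta>, \<alpha>] x) h) \<sigma>" unfolding D2_def by (rule lin_swap)
    ultimately show "entry (\<Sum>\<alpha>\<in>UNIV. tensor \<alpha> (lin (\<lambda>\<beta>. v [\<beta>, \<alpha>] x) h)) \<sigma> = entry (hessian_stencil h) \<sigma>"
      by (simp add: entry_sum entry_tensor entry_hessian_stencil lin_def)
  qed
  ultimately show ?thesis by simp
qed

lemma linear_homogeneous: "linear (homogeneous :: real^'n^'n \<Rightarrow> 'n stencil)"
  by (rule linearI)
    (auto intro!: stencil_eqI simp: entry_homogeneous matrix_vector_mult_add_rdistrib scaleR_matrix_vector_assoc)

lemma cauchy_born_stress_eq:
  "cauchy_born_stress \<kappa> V u y $ i $ \<alpha> = N [tensor \<alpha> (axis i 1)] (gradient_stencil y)"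
proof -
  let ?M = "matrix (frechet_derivative u (at y)) :: real^'n^'n"
  define X where "X = {F :: real^'n^'n. homogeneous F \<in> S}"
  have D: "frechet_derivative u (at y) = D1 y"
    using frechet_derivative_at[OF u_has_derivative] by simp
  have MG: "homogeneous ?M = gradient_stencil y"
    unfolding D by (rule stencil_eqI) (simp add: entry_homogeneous entry_gradient_stencil matrix_works D1_linear)
  have bl: "bounded_linear (homogeneous :: real^'n^'n \<Rightarrow> 'n stencil)"
    using linear_homogeneous by (simp add: linear_conv_bounded_linear)
  have "((\<lambda>F. f (homogeneous F)) has_derivative (\<lambda>E. N [homogeneous E] (gradient_stencil y))) (at ?M within X)"
  proof (rule has_derivative_in_compose[where g = f and f = homogeneous])
    show "(homogeneous has_derivative homogeneous) (at ?M within X)"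
      by (rule bounded_linear_imp_has_derivative[OF bl])
    show "(f has_derivative (\<lambda>h. N [h] (gradient_stencil y))) (at (homogeneous ?M) within homogeneous ` X)"
      unfolding MG
    proof (rule has_derivative_subset)
      show "(f has_derivative (\<lambda>h. N [h] (gradient_stencil y))) (at (gradient_stencil y) within S)"
        using has_derivative[of "[]"] gradient_stencil_in_S k by simp
    qed (auto simp: X_def)
  qed
  moreover obtain K where K: "0 < K" "\<And>F :: real^'n^'n. norm (homogeneous F) \<le> norm F * K"
    using bounded_linear.pos_bounded[OF bl] by blast
  have "convex X"
  proof -
    have "X = homogeneous -` S" by (auto simp: X_def)
    then show ?thesis using convex_linear_vimage[OF linear_homogeneous convex] by simp
  qed
  moreover have "ball 0 (\<kappa> / K) \<subseteq> X"
  proof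
    fix F :: "real^'n^'n" assume "F \<in> ball 0 (\<kappa> / K)"
    then have "norm F * K < \<kappa>" using K(1) by (simp add: field_simps)
    then show "F \<in> X" using K(2)[of F] by (simp add: X_def)
  qed
  moreover have "0 < \<kappa> / K" using \<kappa> K by simp
  moreover have "?M \<in> X" using gradient_stencil_in_S MG by (simp add: X_def)
  ultimately have "frechet_derivative (\<lambda>F. f (homogeneous F)) (at ?M within X) = (\<lambda>E. N [homogeneous E] (gradient_stencil y))"
    by (metis has_derivative_within_unique differentiableI frechet_derivative_works)
  moreover have "homogeneous (axis i (axis \<alpha> 1) :: real^'n^'n) = tensor \<alpha> (axis i 1)"
  proof (rule stencil_eqI)
    fix \<sigma> :: "real^'n" assume \<sigma>: "\<sigma> \<in> lattice_star"
    have "((axis i (axis \<alpha> 1) :: real^'n^'n) *v \<sigma>) $ j = (\<sigma> $ \<alpha> *\<^sub>R axis i 1) $ j" for j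
      by (cases "j = i") (simp_all add: matrix_vector_mul_component inner_axis', simp_all add: axis_def)
    then show "entry (homogeneous (axis i (axis \<alpha> 1) :: real^'n^'n)) \<sigma> = entry (tensor \<alpha> (axis i 1)) \<sigma>"
      using \<sigma> by (simp add: entry_homogeneous entry_tensor vec_eq_iff)
  qed
  ultimately show ?thesis
    by (simp add: cauchy_born_stress_def W_cb_def X_def)
qed

lemma divergence_cauchy_born_stress:
  "divergence (cauchy_born_stress \<kappa> V u) x $ i
    = (\<Sum>\<alpha>\<in>UNIV. N [tensor \<alpha> (axis i 1), hessian_stencil (axis \<alpha> 1)] G)"
proof -
  have "partial \<alpha> (\<lambda>y. cauchy_born_stress \<kappa> V u y $ i $ \<alpha>) x
      = N [tensor \<alpha> (axis i 1), hessian_stencil (axis \<alpha> 1)] G" for \<alpha>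
  proof -
    have "((\<lambda>y. N [tensor \<alpha> (axis i 1)] (gradient_stencil y)) has_derivative
        (\<lambda>h. N [hessian_stencil h, tensor \<alpha> (axis i 1)] G)) (at x)"
    proof (rule has_derivative_in_compose[where g = "N [tensor \<alpha> (axis i 1)]" and f = gradient_stencil])
      show "(gradient_stencil has_derivative hessian_stencil) (at x)"
        by (rule gradient_stencil_has_derivative)
      show "(N [tensor \<alpha> (axis i 1)] has_derivative (\<lambda>h. N [h, tensor \<alpha> (axis i 1)] G)) (at G within range gradient_stencil)"
        by (rule has_derivative_subset[OF has_derivative])
          (use k gradient_stencil_in_S in \<open>auto simp del: mem_Collect_eq\<close>)
    qed
    from frechet_derivative_at[OF this]
    have "partial \<alpha> (\<lambda>y. N [tensor \<alpha> (axis i 1)] (gradient_stencil y)) x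
        = N [hessian_stencil (axis \<alpha> 1), tensor \<alpha> (axis i 1)] G"
      unfolding partial_def by metis
    then show ?thesis
      using schwarz[of "[]" G] k gradient_stencil_in_S by (simp add: cauchy_born_stress_eq)
  qed
  then show ?thesis by (simp add: divergence_def)
qed

lemma V_part_2_linear:
  assumes "\<rho> \<in> lattice_star" "\<sigma> \<in> lattice_star" "g \<in> S"
  shows "linear (\<lambda>h. V_part \<kappa> V [\<rho>, \<sigma>] g [h, h'])" "linear (\<lambda>h'. V_part \<kappa> V [\<rho>, \<sigma>] g [h, h'])"
proof -
  show "linear (\<lambda>h. V_part \<kappa> V [\<rho>, \<sigma>] g [h, h'])"
    using linear_compose[OF linear_single[OF assms(1)] linear_slot[of "[]" "[single \<sigma> h']" g]] k assms(3)
    by (simp add: V_part_def o_def)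
  show "linear (\<lambda>h'. V_part \<kappa> V [\<rho>, \<sigma>] g [h, h'])"
    using linear_compose[OF linear_single[OF assms(2)] linear_slot[of "[single \<rho> h]" "[]" g]] k assms(3)
    by (simp add: V_part_def o_def)
qed

lemma V_part_3_linear:
  assumes "\<rho> \<in> lattice_star" "\<sigma> \<in> lattice_star" "\<tau> \<in> lattice_star" "g \<in> S"
  shows "linear (\<lambda>h. V_part \<kappa> V [\<rho>, \<sigma>, \<tau>] g [w, h, h'])" "linear (\<lambda>h'. V_part \<kappa> V [\<rho>, \<sigma>, \<tau>] g [w, h, h'])"
proof -
  show "linear (\<lambda>h. V_part \<kappa> V [\<rho>, \<sigma>, \<tau>] g [w, h, h'])"
    using linear_compose[OF linear_single[OF assms(2)] linear_slot[of "[single \<rho> w]" "[single \<tau> h']" g]] k assms(4)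
    by (simp add: V_part_def o_def)
  show "linear (\<lambda>h'. V_part \<kappa> V [\<rho>, \<sigma>, \<tau>] g [w, h, h'])"
    using linear_compose[OF linear_single[OF assms(3)] linear_slot[of "[single \<rho> w, single \<sigma> h]" "[]" g]] k assms(4)
    by (simp add: V_part_def o_def)
qed

text \<open>For a pair \<open>(\<rho>, \<sigma>)\<close>, summing over the coordinate \<open>\<alpha>\<close> assembles the components
  \<open>\<rho>\<^sub>\<alpha> \<nabla>\<^sub>\<alpha>\<nabla>\<^sub>\<sigma>u(x)\<close> into
  \<open>\<nabla>\<^sub>\<rho>\<nabla>\<^sub>\<sigma>u(x)\<close>; the pairs with fixed \<open>\<rho>\<close> then form one derivative of
  \<open>V\<close>.\<close>

lemma divergence_cauchy_born_stress_has_sum: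
  "((\<lambda>\<rho>. N [single \<rho> (axis i 1), hessian_stencil \<rho>] G) has_sum divergence (cauchy_born_stress \<kappa> V u) x $ i) lattice_star"
proof (rule has_sum_star_tuples_Suc)
  let ?f = "\<lambda>\<rho>s. V_part \<kappa> V \<rho>s G (axis i 1 # map2 entry [hessian_stencil (\<rho>s ! 0)] (tl \<rho>s))"
  have "((\<lambda>\<rho>s. \<Sum>\<alpha>\<in>UNIV. V_part \<kappa> V \<rho>s G (map2 entry [tensor \<alpha> (axis i 1), hessian_stencil (axis \<alpha> 1)] \<rho>s))
      has_sum divergence (cauchy_born_stress \<kappa> V u) x $ i) (star_tuples 2)"
    unfolding divergence_cauchy_born_stress
    by (rule has_sum_finite_sum) (use V k gradient_stencil_in_S in \<open>auto simp: admissible_potential_def numeral_2_eq_2\<close>)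
  then show "(?f has_sum divergence (cauchy_born_stress \<kappa> V u) x $ i) (star_tuples (Suc 1))"
    unfolding Suc_1
  proof (rule has_sum_cong[THEN iffD1, rotated -1])
    fix \<rho>s :: "(real^'n) list" assume "\<rho>s \<in> star_tuples 2"
    then obtain \<rho> \<sigma> where \<rho>s: "\<rho>s = [\<rho>, \<sigma>]" "\<rho> \<in> lattice_star" "\<sigma> \<in> lattice_star"
      by (auto simp: star_tuples_def numeral_2_eq_2 length_Suc_conv)
    note l = V_part_2_linear[OF \<rho>s(2,3) gradient_stencil_in_S]
    have "(\<Sum>\<alpha>\<in>UNIV. V_part \<kappa> V \<rho>s G (map2 entry [tensor \<alpha> (axis i 1), hessian_stencil (axis \<alpha> 1)] \<rho>s))
        = (\<Sum>\<alpha>\<in>UNIV. V_part \<kappa> V [\<rho>, \<sigma>] G [axis i 1, \<rho> $ \<alpha> *\<^sub>R D2 x \<sigma> (axis \<alpha> 1)])"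
      using \<rho>s by (simp add: entry_tensor entry_hessian_stencil linear_scale[OF l(1)] linear_scale[OF l(2)])
    also have "\<dots> = V_part \<kappa> V [\<rho>, \<sigma>] G [axis i 1, \<Sum>\<alpha>\<in>UNIV. \<rho> $ \<alpha> *\<^sub>R D2 x \<sigma> (axis \<alpha> 1)]"
      by (rule linear_sum[OF l(2), symmetric])
    also have "(\<Sum>\<alpha>\<in>UNIV. \<rho> $ \<alpha> *\<^sub>R D2 x \<sigma> (axis \<alpha> 1)) = D2 x \<sigma> \<rho>"
      by (simp add: D2_def lin_def[of _ \<rho>])
    finally show "(\<Sum>\<alpha>\<in>UNIV. V_part \<kappa> V \<rho>s G (map2 entry [tensor \<alpha> (axis i 1), hessian_stencil (axis \<alpha> 1)] \<rho>s)) = ?f \<rho>s"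
      using \<rho>s by (simp add: entry_hessian_stencil)
  qed
  fix \<rho> :: "real^'n" assume \<rho>: "\<rho> \<in> lattice_star"
  show "((\<lambda>\<sigma>s. ?f (\<rho> # \<sigma>s)) has_sum N [single \<rho> (axis i 1), hessian_stencil \<rho>] G) (star_tuples 1)"
    using has_sum_nderiv_single[OF \<rho> _ gradient_stencil_in_S, where ds = "[hessian_stencil \<rho>]" and w = "axis i 1"] k by simp
qed

text \<open>The contribution of the bond direction \<open>\<rho>\<close> to a component of the atomistic
  divergence.\<close>

definition bond_force where
  "bond_force i \<rho> = (\<Sum>\<xi>\<in>nodes. \<zeta> (\<xi> - x) *
     (N [single \<rho> (axis i 1)] (differences u \<xi>) - N [single \<rho> (axis i 1)] (differences u (\<xi> - \<rho>))))"

lemma V_grad_component: "V_grad \<kappa> V \<rho> g $ i = N [single \<rho> (axis i 1)] g"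
  by (simp add: V_grad_def V_part_def)

lemma norm_single_derivative_le:
  assumes "\<rho> \<in> lattice_star" "g \<in> S"
  shows "ennreal \<bar>N [single \<rho> (axis i 1)] g\<bar> \<le> m_weight \<kappa> V [\<rho>]"
proof -
  have "ennreal \<bar>N [single \<rho> (axis i 1)] g\<bar> \<le> part_sup [\<rho>]"
    using abs_V_part_le[of "[axis i 1]" "[\<rho>]" g] assms k by (simp add: V_part_def)
  also have "\<dots> \<le> ennreal (norm \<rho>) * part_sup [\<rho>]"
    using norm_lattice_star_ge_1[OF assms(1)] mult_right_mono[of 1 "ennreal (norm \<rho>)" "part_sup [\<rho>]"] by simp
  finally show ?thesis by (simp add: m_weight_eq)
qed

lemma kernel_nonneg: "0 \<le> \<zeta> y"
  using \<zeta> by (simp add: admissible_kernel_def)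

lemma bond_force_summable: "bond_force i summable_on lattice_star"
proof (rule summable_of_ennreal_bound)
  fix \<rho> :: "real^'n" assume \<rho>: "\<rho> \<in> lattice_star"
  let ?n = "\<lambda>\<xi>. \<bar>N [single \<rho> (axis i 1)] (differences u \<xi>)\<bar>"
  have "\<bar>bond_force i \<rho>\<bar> \<le> (\<Sum>\<xi>\<in>nodes. \<zeta> (\<xi> - x) * (?n \<xi> + ?n (\<xi> - \<rho>)))"
    unfolding bond_force_def
    by (rule sum_abs[THEN order_trans], rule sum_mono)
      (auto simp: abs_mult kernel_nonneg intro!: mult_left_mono)
  then have "ennreal \<bar>bond_force i \<rho>\<bar> \<le> ennreal (\<Sum>\<xi>\<in>nodes. \<zeta> (\<xi> - x) * (?n \<xi> + ?n (\<xi> - \<rho>)))"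
    by (rule ennreal_leI)
  also have "\<dots> = (\<Sum>\<xi>\<in>nodes. ennreal (\<zeta> (\<xi> - x)) * (ennreal (?n \<xi>) + ennreal (?n (\<xi> - \<rho>))))"
    by (subst sum_ennreal[symmetric]) (auto simp: ennreal_mult kernel_nonneg ennreal_plus intro!: sum.cong)
  also have "\<dots> \<le> (\<Sum>\<xi>\<in>nodes. ennreal (\<zeta> (\<xi> - x)) * (m_weight \<kappa> V [\<rho>] + m_weight \<kappa> V [\<rho>]))"
    by (intro sum_mono mult_left_mono add_mono norm_single_derivative_le \<rho> differences_in_S) auto
  also have "\<dots> = ennreal (\<Sum>\<xi>\<in>nodes. \<zeta> (\<xi> - x)) * (m_weight \<kappa> V [\<rho>] + m_weight \<kappa> V [\<rho>])"
    by (simp add: sum_distrib_right kernel_nonneg flip: sum_ennreal)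
  also have "\<dots> = 2 * m_weight \<kappa> V [\<rho>]" by (simp add: kernel_mass[OF \<zeta>] mult_2)
  finally show "ennreal \<bar>bond_force i \<rho>\<bar> \<le> 2 * m_weight \<kappa> V [\<rho>]" .
next
  have "(\<Sum>\<^sub>\<infinity>\<rho>\<in>lattice_star. 2 * m_weight \<kappa> V [\<rho>]) = (\<Sum>\<^sub>\<infinity>\<rho>\<in>lattice_star. m_weight \<kappa> V [\<rho>]) + (\<Sum>\<^sub>\<infinity>\<rho>\<in>lattice_star. m_weight \<kappa> V [\<rho>])"
    by (simp add: mult_2 infsum_add ennreal_summable)
  also have "(\<Sum>\<^sub>\<infinity>\<rho>\<in>lattice_star. m_weight \<kappa> V [\<rho>]) = (\<Sum>\<^sub>\<infinity>\<rho>s\<in>star_tuples 1. m_weight \<kappa> V \<rho>s)"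
  proof (rule infsum_reindex_bij_witness[where i = "\<lambda>\<rho>s. \<rho>s ! 0" and j = "\<lambda>\<rho>. [\<rho>]"])
  qed (auto simp: star_tuples_def length_Suc_conv)
  also have "(\<Sum>\<^sub>\<infinity>\<rho>s\<in>star_tuples 1. m_weight \<kappa> V \<rho>s) + (\<Sum>\<^sub>\<infinity>\<rho>s\<in>star_tuples 1. m_weight \<kappa> V \<rho>s) < \<infinity>"
    using V k by (auto simp: admissible_potential_def)
  finally show "(\<Sum>\<^sub>\<infinity>\<rho>\<in>lattice_star. 2 * m_weight \<kappa> V [\<rho>]) < \<infinity>" .
qed

lemma div_atomistic_stress_has_sum:
  "(bond_force i has_sum div_atomistic_stress \<zeta> \<kappa> V u x $ i) lattice_star"
proof -
  define t where "t = (\<lambda>\<rho>. \<Sum>\<xi>\<in>nodes.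
     \<zeta> (\<xi> - x) *\<^sub>R (V_grad \<kappa> V \<rho> (differences u \<xi>) - V_grad \<kappa> V \<rho> (differences u (\<xi> - \<rho>))))"
  have t: "t \<rho> $ i = bond_force i \<rho>" for \<rho> i
    by (simp add: t_def bond_force_def V_grad_component)
  have "(t has_sum (\<chi> i. \<Sum>\<^sub>\<infinity>\<rho>\<in>lattice_star. bond_force i \<rho>)) lattice_star"
    by (rule has_sum_vec) (simp add: t bond_force_summable)
  then have "div_atomistic_stress \<zeta> \<kappa> V u x = (\<chi> i. \<Sum>\<^sub>\<infinity>\<rho>\<in>lattice_star. bond_force i \<rho>)"
    unfolding div_atomistic_stress_eq[OF \<zeta>] t_def[symmetric] by (rule infsumI)
  then show ?thesis by (simp add: bond_force_summable)
qed

end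


section \<open>Symmetrization and the consistency estimate\<close>

lemma ennreal_infsum_cmult:
  fixes f :: "'i \<Rightarrow> ennreal"
  shows "(\<Sum>\<^sub>\<infinity>i\<in>A. a * f i) = a * infsum f A"
proof -
  have "(\<Sum>\<^sub>\<infinity>i\<in>A. a * f i) = (SUP F\<in>{F. finite F \<and> F \<subseteq> A}. \<Sum>i\<in>F. a * f i)"
    by (rule nonneg_infsum_complete) simp
  also have "\<dots> = a * (SUP F\<in>{F. finite F \<and> F \<subseteq> A}. sum f F)"
    by (simp add: SUP_mult_left_ennreal sum_distrib_left)
  also have "(SUP F\<in>{F. finite F \<and> F \<subseteq> A}. sum f F) = infsum f A"
    by (rule nonneg_infsum_complete[symmetric]) simp
  finally show ?thesis .
qed

lemma sum_bool_pair: "(\<Sum>p\<in>UNIV. F p) = F (False, False) + F (False, True) + F (True, False) + F (True, True)"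
  for F :: "bool \<times> bool \<Rightarrow> 'a::comm_monoid_add"
  unfolding UNIV_Times_UNIV[symmetric] sum.cartesian_product'[symmetric] by (simp add: UNIV_bool ac_simps)

text \<open>The four bonds of the symmetrized force are indexed by two flags: the first selects
  the term at \<open>\<xi> - \<rho>\<close>, or \<open>\<xi> + \<rho>\<close> for the reflected stencil, and the second selects the
  reflected stencil. Reading a reflected bond from its other end turns it into a bond in
  direction \<open>\<sigma>\<close> starting at \<open>-\<sigma>\<close>, which explains the subtraction of \<open>\<sigma>\<close> in the
  shift.\<close>

definition bond_sign :: "bool \<times> bool \<Rightarrow> real" where
  "bond_sign p = (if fst p = snd p then 1 else - 1)"

definition bond_shift :: "real^'n \<Rightarrow> real^'n \<Rightarrow> bool \<times> bool \<Rightarrow> real^'n" where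
  "bond_shift \<rho> \<sigma> p = (if fst p then (if snd p then \<rho> else - \<rho>) else 0) - (if snd p then \<sigma> else 0)"

context model
begin

abbreviation base where "base \<rho> \<sigma> \<xi> p \<equiv> \<xi> - x + bond_shift \<rho> \<sigma> p"

text \<open>The signed sum over the four bonds, averaged over the lattice points \<open>\<xi>\<close> with the
  weights \<open>\<zeta> (\<xi> - x)\<close>, whose total is one.\<close>

definition avg :: "(real^'n \<Rightarrow> bool \<times> bool \<Rightarrow> 'b::real_normed_vector) \<Rightarrow> 'b" where
  "avg X = (\<Sum>\<xi>\<in>nodes. \<zeta> (\<xi> - x) *\<^sub>R (\<Sum>p\<in>UNIV. bond_sign p *\<^sub>R X \<xi> p))"

lemma avg_add: "avg (\<lambda>\<xi> p. X \<xi> p + Y \<xi> p) = avg X + avg Y"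
  by (simp add: avg_def scaleR_right_distrib sum.distrib)

lemma avg_linear: "linear L \<Longrightarrow> avg (\<lambda>\<xi> p. L (X \<xi> p)) = L (avg X)"
  by (simp add: avg_def linear_sum linear_scale)

lemma avg_diff: "avg (\<lambda>\<xi> p. X \<xi> p - Y \<xi> p) = avg X - avg Y"
  by (simp add: avg_def scaleR_right_diff_distrib sum_subtractf)

lemma avg_const: "avg (\<lambda>\<xi> p. a) = 0"
  by (simp add: avg_def sum_bool_pair bond_sign_def)

lemma avg_cong: "(\<And>\<xi> p. \<xi> \<in> nodes \<Longrightarrow> X \<xi> p = Y \<xi> p) \<Longrightarrow> avg X = avg Y"
  unfolding avg_def by (intro sum.cong) auto

lemma avg_has_sum:
  fixes f :: "real^'n \<Rightarrow> bool \<times> bool \<Rightarrow> 'i \<Rightarrow> real"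
  assumes "\<And>\<xi> p. \<xi> \<in> nodes \<Longrightarrow> (f \<xi> p has_sum X \<xi> p) A"
  shows "((\<lambda>i. avg (\<lambda>\<xi> p. f \<xi> p i)) has_sum avg X) A"
  unfolding avg_def real_scaleR_def
  by (intro has_sum_finite_sum has_sum_cmult_right assms)

lemma ennreal_norm_avg_le:
  assumes "\<And>\<xi> p. \<xi> \<in> nodes \<Longrightarrow> ennreal (norm (X \<xi> p)) \<le> B"
  shows "ennreal (norm (avg X)) \<le> 4 * B"
proof -
  have "norm (avg X) \<le> (\<Sum>\<xi>\<in>nodes. \<zeta> (\<xi> - x) * (\<Sum>p\<in>UNIV. norm (X \<xi> p)))"
    unfolding avg_def
    by (rule sum_norm_le)
      (auto simp: kernel_nonneg bond_sign_def intro!: mult_left_mono sum_norm_le)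
  then have "ennreal (norm (avg X)) \<le> ennreal (\<Sum>\<xi>\<in>nodes. \<zeta> (\<xi> - x) * (\<Sum>p\<in>UNIV. norm (X \<xi> p)))"
    by (rule ennreal_leI)
  also have "\<dots> = (\<Sum>\<xi>\<in>nodes. ennreal (\<zeta> (\<xi> - x)) * (\<Sum>p\<in>UNIV. ennreal (norm (X \<xi> p))))"
    by (subst sum_ennreal[symmetric]) (auto simp: ennreal_mult kernel_nonneg sum_nonneg intro!: sum.cong)
  also have "\<dots> \<le> (\<Sum>\<xi>\<in>nodes. ennreal (\<zeta> (\<xi> - x)) * (\<Sum>p\<in>(UNIV :: (bool \<times> bool) set). B))"
    by (intro sum_mono mult_left_mono assms) auto
  also have "\<dots> = ennreal (\<Sum>\<xi>\<in>nodes. \<zeta> (\<xi> - x)) * (\<Sum>p\<in>(UNIV :: (bool \<times> bool) set). B)"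
    by (simp only: sum_distrib_right[symmetric] sum_ennreal kernel_nonneg)
  also have "\<dots> = 4 * B" by (simp add: kernel_mass[OF \<zeta>])
  finally show ?thesis .
qed

text \<open>The midpoints of the four bonds are symmetric about \<open>\<xi> - x\<close>, and opposite midpoints
  carry opposite signs, for two bond vectors \<open>\<sigma>\<close> and \<open>\<tau>\<close> simultaneously.\<close>

lemma avg_bilinear:
  fixes \<gamma> :: "real^'n \<Rightarrow> real^'n \<Rightarrow> 'b::real_normed_vector"
  assumes l: "\<And>w'. linear (\<lambda>w. \<gamma> w w')" "\<And>w. linear (\<gamma> w)"
  shows "avg (\<lambda>\<xi> p. \<gamma> (base \<rho> \<sigma> \<xi> p + (1/2) *\<^sub>R \<sigma>) (base \<rho> \<tau> \<xi> p + (1/2) *\<^sub>R \<tau>)) = 0"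
proof -
  define Y where "Y y y' \<xi> = \<gamma> (\<xi> - x + y) (\<xi> - x + y') - \<gamma> (\<xi> - x - y) (\<xi> - x - y')" for y y' \<xi>
  have "(\<Sum>p\<in>UNIV. bond_sign p *\<^sub>R \<gamma> (base \<rho> \<sigma> \<xi> p + (1/2) *\<^sub>R \<sigma>) (base \<rho> \<tau> \<xi> p + (1/2) *\<^sub>R \<tau>))
      = Y ((1/2) *\<^sub>R \<sigma>) ((1/2) *\<^sub>R \<tau>) \<xi> - Y ((1/2) *\<^sub>R \<sigma> - \<rho>) ((1/2) *\<^sub>R \<tau> - \<rho>) \<xi>" for \<xi>
  proof -
    have centres: "\<xi> - x - \<sigma> + (1/2) *\<^sub>R \<sigma> = \<xi> - x - (1/2) *\<^sub>R \<sigma>"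
      "\<xi> - x - \<rho> + (1/2) *\<^sub>R \<sigma> = \<xi> - x + ((1/2) *\<^sub>R \<sigma> - \<rho>)"
      "\<xi> - x + (\<rho> - \<sigma>) + (1/2) *\<^sub>R \<sigma> = \<xi> - x - ((1/2) *\<^sub>R \<sigma> - \<rho>)" for \<sigma>
      by (simp_all add: vec_eq_iff field_simps)
    show ?thesis
      unfolding sum_bool_pair bond_sign_def bond_shift_def Y_def by (simp add: centres)
  qed
  then have "avg (\<lambda>\<xi> p. \<gamma> (base \<rho> \<sigma> \<xi> p + (1/2) *\<^sub>R \<sigma>) (base \<rho> \<tau> \<xi> p + (1/2) *\<^sub>R \<tau>))
      = (\<Sum>\<xi>\<in>nodes. \<zeta> (\<xi> - x) *\<^sub>R Y ((1/2) *\<^sub>R \<sigma>) ((1/2) *\<^sub>R \<tau>) \<xi>)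
        - (\<Sum>\<xi>\<in>nodes. \<zeta> (\<xi> - x) *\<^sub>R Y ((1/2) *\<^sub>R \<sigma> - \<rho>) ((1/2) *\<^sub>R \<tau> - \<rho>) \<xi>)"
    by (simp add: avg_def scaleR_right_diff_distrib sum_subtractf)
  then show ?thesis
    unfolding Y_def kernel_bilinear_cancellation[OF \<zeta> l] by simp
qed

text \<open>The signed sum of the four midpoints is \<open>2 \<rho>\<close>, independently of \<open>\<xi>\<close>.\<close>

lemma avg_linear_part:
  "avg (\<lambda>\<xi> p. linear_part \<sigma> (base \<rho> \<sigma> \<xi> p)) = 2 *\<^sub>R D2 x \<sigma> \<rho>"
proof -
  have "(\<Sum>p\<in>UNIV. bond_sign p *\<^sub>R linear_part \<sigma> (base \<rho> \<sigma> \<xi> p)) = 2 *\<^sub>R D2 x \<sigma> \<rho>" for \<xi>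
  proof -
    have "(\<Sum>p\<in>UNIV. bond_sign p *\<^sub>R linear_part \<sigma> (base \<rho> \<sigma> \<xi> p))
        = D2 x \<sigma> (\<Sum>p\<in>UNIV. bond_sign p *\<^sub>R (base \<rho> \<sigma> \<xi> p + (1/2) *\<^sub>R \<sigma>))"
      by (simp add: linear_sum[OF D2_linear] linear_scale[OF D2_linear])
    also have "(\<Sum>p\<in>UNIV. bond_sign p *\<^sub>R (base \<rho> \<sigma> \<xi> p + (1/2) *\<^sub>R \<sigma>)) = 2 *\<^sub>R \<rho>"
      by (simp add: sum_bool_pair bond_sign_def bond_shift_def vec_eq_iff)
    finally show ?thesis by (simp add: linear_scale[OF D2_linear])
  qed
  then show ?thesis
    by (simp only: avg_def scaleR_sum_left[symmetric] kernel_mass[OF \<zeta>] scaleR_one)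
qed

lemma avg_quadratic_part: "avg (\<lambda>\<xi> p. quadratic_part \<sigma> (base \<rho> \<sigma> \<xi> p)) = 0"
proof -
  have "avg (\<lambda>\<xi> p. quadratic_part \<sigma> (base \<rho> \<sigma> \<xi> p))
      = (1/2) *\<^sub>R (avg (\<lambda>\<xi> p. D3 x \<sigma> (base \<rho> \<sigma> \<xi> p + (1/2) *\<^sub>R \<sigma>) (base \<rho> \<sigma> \<xi> p + (1/2) *\<^sub>R \<sigma>))
        + avg (\<lambda>\<xi> p. (1/12) *\<^sub>R D3 x \<sigma> \<sigma> \<sigma>))"
    unfolding quadratic_part_def
    by (subst avg_linear[where L = "\<lambda>a. (1/2) *\<^sub>R a"]) (simp_all add: avg_add linear_scaleR)
  then show ?thesis
    by (simp only: avg_bilinear[OF D3_linear_left D3_linear_right] avg_const) simp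
qed

definition config :: "real^'n \<Rightarrow> real^'n \<Rightarrow> bool \<times> bool \<Rightarrow> 'n stencil" where
  "config \<rho> \<xi> p = (let g = differences u (\<xi> + (if fst p then (if snd p then \<rho> else - \<rho>) else 0)) in
     if snd p then reflect g else g)"

lemma config_in_S: "config \<rho> \<xi> p \<in> S"
  using differences_in_S by (simp add: config_def Let_def norm_reflect)

lemma entry_config:
  assumes "\<sigma> \<in> lattice_star"
  shows "entry (config \<rho> \<xi> p - G) \<sigma> = strain_defect \<sigma> (base \<rho> \<sigma> \<xi> p)"
  using assms
  by (auto simp: config_def Let_def entry_reflect entry_differences entry_gradient_stencil strain_defect_def
      bond_shift_def algebra_simps)

text \<open>Reflection maps a direction at entry \<open>-\<rho>\<close> to the negative of the same direction at
  entry \<open>\<rho>\<close>.\<close>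

lemma symmetrized_bond_force:
  assumes \<rho>: "\<rho> \<in> lattice_star"
  shows "bond_force i \<rho> + bond_force i (- \<rho>) = avg (\<lambda>\<xi> p. N [single \<rho> (axis i 1)] (config \<rho> \<xi> p))"
proof -
  have neg: "N [single (- \<rho>) (axis i 1)] g = - N [single \<rho> (axis i 1)] (reflect g)" if "g \<in> S" for g
  proof -
    have "reflect (single (- \<rho>) (axis i 1)) = - single \<rho> (axis i 1)"
      by (rule stencil_eqI) (use \<rho> in \<open>auto simp: entry_reflect entry_single minus_equation_iff\<close>)
    then have "N [single (- \<rho>) (axis i 1)] g = N [- single \<rho> (axis i 1)] (reflect g)"
      using nderiv_reflect[OF that, of "single (- \<rho>) (axis i 1)"] by simp
    also have "\<dots> = - N [single \<rho> (axis i 1)] (reflect g)"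
      using linear_neg[OF linear_slot[of "[]" "[]" "reflect g"]] k that by (simp add: norm_reflect)
    finally show ?thesis .
  qed
  show ?thesis
    unfolding bond_force_def avg_def sum.distrib[symmetric]
  proof (intro sum.cong refl)
    fix \<xi>
    show "\<zeta> (\<xi> - x) * (N [single \<rho> (axis i 1)] (differences u \<xi>) - N [single \<rho> (axis i 1)] (differences u (\<xi> - \<rho>)))
      + \<zeta> (\<xi> - x) * (N [single (- \<rho>) (axis i 1)] (differences u \<xi>) - N [single (- \<rho>) (axis i 1)] (differences u (\<xi> - - \<rho>)))
      = \<zeta> (\<xi> - x) *\<^sub>R (\<Sum>p\<in>UNIV. bond_sign p *\<^sub>R N [single \<rho> (axis i 1)] (config \<rho> \<xi> p))"
      using neg[OF differences_in_S]
      by (simp add: sum_bool_pair bond_sign_def config_def Let_def flip: distrib_left)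
  qed
qed

text \<open>One constant for all expansions: distances to \<open>x\<close> are at most \<open>c + 2\<close> times the sum of
  the bond lengths, because lattice bonds have length at least one, and they occur to the
  third power at most.\<close>

definition K where "K = real CARD('n) ^ 4 * (c + 2) ^ 3"

lemma K_ge_1: "1 \<le> K"
  unfolding K_def using mult_mono[OF one_le_power[OF card_index_ge_1] one_le_power, of "c + 2" 4 3] c(1) by simp

abbreviation X where "X j \<rho> \<sigma> \<equiv> local_grad_norm j u c x \<rho> \<sigma>"

context
  fixes \<rho> \<sigma> \<xi> :: "real^'n" and p :: "bool \<times> bool" and s :: real
  assumes \<rho>: "\<rho> \<in> lattice_star" and \<sigma>: "\<sigma> \<in> lattice_star" and \<xi>: "\<xi> \<in> nodes"
    and s: "norm \<rho> + norm \<sigma> \<le> s"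
begin

lemma base_norm: "norm (\<xi> - x) \<le> c"
  using \<xi> c(2) by (simp add: kernel_support_def)

text \<open>All points of the segments from \<open>x\<close> to the four bonds are of the form
  \<open>x + z + a \<rho> + b \<sigma>\<close> with \<open>\<bar>z\<bar> \<le> c\<close> and \<open>\<bar>a\<bar>, \<bar>b\<bar> \<le> 1\<close>,
  hence have distance at least \<open>c\<close> from the complement of the neighbourhood of the rhombus.\<close>

lemma base_region:
  assumes t: "t \<in> {0..1}" and t': "t' \<in> {0..1}"
  shows "cball (x + t *\<^sub>R (base \<rho> \<sigma> \<xi> p + t' *\<^sub>R \<sigma>)) c \<subseteq> (+) x ` nu c \<rho> \<sigma>"
proof (rule nu_contains)
  let ?a = "if fst p then (if snd p then 1 else - 1) else 0 :: real"
  let ?b = "t' - (if snd p then 1 else 0)"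
  show "norm (t *\<^sub>R (\<xi> - x)) \<le> c"
    using base_norm t mult_mono[of t 1 "norm (\<xi> - x)" c] c(1) by simp
  show "\<bar>t * ?a\<bar> \<le> 1" using t by auto
  show "\<bar>t * ?b\<bar> \<le> 1"
    using t t' mult_mono[of t 1 "\<bar>?b\<bar>" 1] by (auto simp: abs_mult)
  have "bond_shift \<rho> \<sigma> p + t' *\<^sub>R \<sigma> = ?a *\<^sub>R \<rho> + ?b *\<^sub>R \<sigma>"
    by (auto simp: bond_shift_def algebra_simps)
  then show "x + t *\<^sub>R (base \<rho> \<sigma> \<xi> p + t' *\<^sub>R \<sigma>)
      = x + t *\<^sub>R (\<xi> - x) + (t * ?a) *\<^sub>R \<rho> + (t * ?b) *\<^sub>R \<sigma>"
    by (simp only: add.assoc scaleR_right_distrib scaleR_scaleR)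
qed

lemma base_length: "norm (base \<rho> \<sigma> \<xi> p) + norm \<sigma> \<le> (c + 2) * s"
proof -
  have "norm (bond_shift \<rho> \<sigma> p) \<le> norm \<rho> + norm \<sigma>"
    using norm_triangle_ineq4[of \<rho> \<sigma>] norm_triangle_ineq4[of "- \<rho>" \<sigma>] by (auto simp: bond_shift_def)
  then have "norm (base \<rho> \<sigma> \<xi> p) + norm \<sigma> \<le> c + (norm \<rho> + norm \<sigma>) + norm \<sigma>"
    using norm_triangle_ineq[of "\<xi> - x" "bond_shift \<rho> \<sigma> p"] base_norm by linarith
  also have "\<dots> \<le> c * s + 2 * s"
  proof -
    have "1 \<le> s" using norm_lattice_star_ge_1[OF \<rho>] s norm_ge_zero[of \<sigma>] by linarith
    then have "c \<le> c * s" using c(1) by simp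
    then show ?thesis using s norm_ge_zero[of \<rho>] by linarith
  qed
  finally show ?thesis by (simp add: distrib_right)
qed

lemma s_pos: "0 < s" using norm_lattice_star_ge_1[OF \<rho>] s norm_ge_zero[of \<sigma>] by linarith

lemma closed_region: "closed ((+) x ` nu c \<rho> \<sigma>)"
  by (rule closed_translation[OF closed_nu])

lemma power_constant_le:
  assumes "n \<le> 3" "0 \<le> B" "r \<le> real CARD('n) ^ 4 * norm \<sigma> * ((c + 2) * s) ^ n * B"
  shows "r \<le> (K * norm \<sigma> * s ^ n) * B"
proof -
  have "(c + 2) ^ n \<le> (c + 2) ^ 3" using assms(1) c(1) by (intro power_increasing) auto
  then have "real CARD('n) ^ 4 * (c + 2) ^ n * (norm \<sigma> * s ^ n * B) \<le> real CARD('n) ^ 4 * (c + 2) ^ 3 * (norm \<sigma> * s ^ n * B)"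
    using assms(2) s_pos by (intro mult_right_mono mult_left_mono) auto
  then show ?thesis using assms(3) by (simp add: K_def power_mult_distrib mult_ac)
qed

lemma constant_pos: "0 < K * norm \<sigma> * s ^ n"
  using K_ge_1 lattice_star_norm_pos[OF \<sigma>] s_pos by simp

lemmas base_bounds = closed_region c(1) base_region base_length

lemma strain_defect_le:
  "ennreal (norm (strain_defect \<sigma> (base \<rho> \<sigma> \<xi> p))) \<le> ennreal (K * norm \<sigma> * s) * X 2 \<rho> \<sigma>"
  unfolding local_grad_norm_def
proof (rule ennreal_le_mult_of_bound)
  show "0 < K * norm \<sigma> * s" using constant_pos[of 1] by simp
  show "norm (strain_defect \<sigma> (base \<rho> \<sigma> \<xi> p)) \<le> K * norm \<sigma> * s * B"
    if "0 \<le> B" "Linf_norm ((+) x ` nu c \<rho> \<sigma>) (grad_norm 2 u) \<le> ennreal B" for B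
    using power_constant_le[of 1 B] strain_defect_bound[OF base_bounds that] that by simp
qed

lemma linear_part_le:
  "ennreal (norm (linear_part \<sigma> (base \<rho> \<sigma> \<xi> p))) \<le> ennreal (K * norm \<sigma> * s) * X 2 \<rho> \<sigma>"
  unfolding local_grad_norm_def
proof (rule ennreal_le_mult_of_bound)
  show "0 < K * norm \<sigma> * s" using constant_pos[of 1] by simp
  show "norm (linear_part \<sigma> (base \<rho> \<sigma> \<xi> p)) \<le> K * norm \<sigma> * s * B"
    if "0 \<le> B" "Linf_norm ((+) x ` nu c \<rho> \<sigma>) (grad_norm 2 u) \<le> ennreal B" for B
    using power_constant_le[of 1 B] strain_defect_linear_bound[OF base_bounds that] that by simp
qed

lemma strain_defect_minus_linear_le:
  "ennreal (norm (strain_defect \<sigma> (base \<rho> \<sigma> \<xi> p) - linear_part \<sigma> (base \<rho> \<sigma> \<xi> p)))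
    \<le> ennreal (K * norm \<sigma> * s ^ 2) * X 3 \<rho> \<sigma>"
  unfolding local_grad_norm_def
  by (rule ennreal_le_mult_of_bound[OF constant_pos])
    (rule power_constant_le, simp, assumption, rule strain_defect_second_order[OF base_bounds])

lemma strain_defect_minus_cubic_le:
  "ennreal (norm (strain_defect \<sigma> (base \<rho> \<sigma> \<xi> p) - linear_part \<sigma> (base \<rho> \<sigma> \<xi> p)
      - quadratic_part \<sigma> (base \<rho> \<sigma> \<xi> p))) \<le> ennreal (K * norm \<sigma> * s ^ 3) * X 4 \<rho> \<sigma>"
  unfolding local_grad_norm_def
  by (rule ennreal_le_mult_of_bound[OF constant_pos])
    (rule power_constant_le, simp, assumption, rule strain_defect_third_order[OF base_bounds])

end

text \<open>The division by \<open>\<bar>\<rho>\<^sub>1\<bar>\<close> removes the only bond length that the expansions do not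
  provide.\<close>

lemma m3_Cons:
  assumes "\<rho> \<in> lattice_star"
  shows "m3 \<kappa> V (\<rho> # \<sigma>s) = ennreal ((\<Prod>\<sigma>\<leftarrow>\<sigma>s. norm \<sigma>) * (\<Sum>\<sigma>\<leftarrow>\<rho> # \<sigma>s. norm \<sigma>) ^ 3) * part_sup (\<rho> # \<sigma>s)"
proof -
  let ?P = "\<Prod>\<sigma>\<leftarrow>\<sigma>s. norm \<sigma>" and ?s = "\<Sum>\<sigma>\<leftarrow>\<rho> # \<sigma>s. norm \<sigma>"
  have P: "0 \<le> ?P" by (induction \<sigma>s) auto
  have s: "0 \<le> ?s" by (intro sum_list_nonneg) auto
  have "m3 \<kappa> V (\<rho> # \<sigma>s) = (ennreal (norm \<rho> * ?P) * ennreal (?s ^ 3 / norm \<rho>)) * part_sup (\<rho> # \<sigma>s)"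
    by (simp add: m3_def m_weight_eq mult_ac)
  also have "ennreal (norm \<rho> * ?P) * ennreal (?s ^ 3 / norm \<rho>) = ennreal (norm \<rho> * ?P * (?s ^ 3 / norm \<rho>))"
    using P s by (intro ennreal_mult[symmetric]) auto
  also have "norm \<rho> * ?P * (?s ^ 3 / norm \<rho>) = ?P * ?s ^ 3"
    using lattice_star_norm_pos[OF assms] by simp
  finally show ?thesis .
qed

text \<open>The summands of the final estimate, the middle one in a form symmetric in its last two
  bonds.\<close>

definition quadruple_term where
  "quadruple_term \<rho>s = m3 \<kappa> V \<rho>s * (X 2 (\<rho>s ! 0) (\<rho>s ! 1) * X 2 (\<rho>s ! 0) (\<rho>s ! 2) * X 2 (\<rho>s ! 0) (\<rho>s ! 3))"

definition triple_term where
  "triple_term \<rho>s = m3 \<kappa> V \<rho>s * (X 3 (\<rho>s ! 0) (\<rho>s ! 1) * X 2 (\<rho>s ! 0) (\<rho>s ! 2) + X 2 (\<rho>s ! 0) (\<rho>s ! 1) * X 3 (\<rho>s ! 0) (\<rho>s ! 2))"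

definition pair_term where
  "pair_term \<rho>s = m3 \<kappa> V \<rho>s * X 4 (\<rho>s ! 0) (\<rho>s ! 1)"

context
  fixes \<rho> :: "real^'n" and i :: 'n
  assumes \<rho>: "\<rho> \<in> lattice_star"
begin

abbreviation e where "e \<equiv> axis i 1 :: real^'n"
abbreviation d where "d \<xi> p \<equiv> config \<rho> \<xi> p - G"

lemma G_config_in_S: "G + d \<xi> p \<in> S"
  using config_in_S by simp

lemma fourth_derivative_le:
  assumes \<xi>: "\<xi> \<in> nodes" and g: "g \<in> S"
  shows "ennreal \<bar>N [single \<rho> e, d \<xi> p, d \<xi> p, d \<xi> p] g\<bar>
    \<le> (\<Sum>\<^sub>\<infinity>\<sigma>s\<in>star_tuples 3. ennreal (K ^ 3) * quadruple_term (\<rho> # \<sigma>s))"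
proof (rule has_sum_ennreal_bound)
  show "((\<lambda>\<sigma>s. V_part \<kappa> V (\<rho> # \<sigma>s) g (e # map2 entry [d \<xi> p, d \<xi> p, d \<xi> p] \<sigma>s)) has_sum
      N [single \<rho> e, d \<xi> p, d \<xi> p, d \<xi> p] g) (star_tuples 3)"
    using has_sum_nderiv_single[OF \<rho> _ g, where w = e and ds = "[d \<xi> p, d \<xi> p, d \<xi> p]"] k
    by (simp add: numeral_3_eq_3)
  fix \<sigma>s :: "(real^'n) list" assume "\<sigma>s \<in> star_tuples 3"
  then obtain \<sigma> \<tau> \<upsilon> where \<sigma>s: "\<sigma>s = [\<sigma>, \<tau>, \<upsilon>]" "\<sigma> \<in> lattice_star" "\<tau> \<in> lattice_star" "\<upsilon> \<in> lattice_star"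
    by (auto simp: star_tuples_def numeral_3_eq_3 length_Suc_conv)
  define s where "s = norm \<rho> + norm \<sigma> + norm \<tau> + norm \<upsilon>"
  have s: "norm \<rho> + norm \<sigma> \<le> s" "norm \<rho> + norm \<tau> \<le> s" "norm \<rho> + norm \<upsilon> \<le> s" "0 \<le> s"
    using norm_ge_zero[of \<sigma>] norm_ge_zero[of \<tau>] norm_ge_zero[of \<upsilon>] norm_ge_zero[of \<rho>] unfolding s_def by linarith+
  have en: "ennreal (norm (entry (d \<xi> p) \<sigma>')) \<le> ennreal (K * norm \<sigma>' * s) * X 2 \<rho> \<sigma>'"
    if "\<sigma>' \<in> lattice_star" "norm \<rho> + norm \<sigma>' \<le> s" for \<sigma>'
    unfolding entry_config[OF that(1)] by (rule strain_defect_le[OF \<rho> that(1) \<xi> that(2)])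
  have "ennreal \<bar>V_part \<kappa> V (\<rho> # \<sigma>s) g (e # map2 entry [d \<xi> p, d \<xi> p, d \<xi> p] \<sigma>s)\<bar>
      \<le> ennreal (norm (entry (d \<xi> p) \<sigma>) * norm (entry (d \<xi> p) \<tau>) * norm (entry (d \<xi> p) \<upsilon>)) * part_sup (\<rho> # \<sigma>s)"
    using abs_V_part_le[of "[e, entry (d \<xi> p) \<sigma>, entry (d \<xi> p) \<tau>, entry (d \<xi> p) \<upsilon>]" "\<rho> # \<sigma>s" g] \<rho> \<sigma>s k g
    by (simp add: mult.assoc del: entry_minus)
  also have "\<dots> = ennreal (norm (entry (d \<xi> p) \<sigma>)) * ennreal (norm (entry (d \<xi> p) \<tau>)) * ennreal (norm (entry (d \<xi> p) \<upsilon>)) * part_sup (\<rho> # \<sigma>s)"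
    by (simp add: ennreal_mult)
  also have "\<dots> \<le> (ennreal (K * norm \<sigma> * s) * X 2 \<rho> \<sigma>) * (ennreal (K * norm \<tau> * s) * X 2 \<rho> \<tau>) * (ennreal (K * norm \<upsilon> * s) * X 2 \<rho> \<upsilon>) * part_sup (\<rho> # \<sigma>s)"
    by (intro mult_right_mono mult_mono en \<sigma>s s) auto
  also have "\<dots> = (ennreal (K * norm \<sigma> * s) * ennreal (K * norm \<tau> * s) * ennreal (K * norm \<upsilon> * s)) * part_sup (\<rho> # \<sigma>s) * (X 2 \<rho> \<sigma> * X 2 \<rho> \<tau> * X 2 \<rho> \<upsilon>)"
    by (simp only: mult_ac)
  also have "ennreal (K * norm \<sigma> * s) * ennreal (K * norm \<tau> * s) * ennreal (K * norm \<upsilon> * s)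
      = ennreal (K ^ 3) * ennreal ((\<Prod>\<sigma>\<leftarrow>\<sigma>s. norm \<sigma>) * (\<Sum>\<sigma>\<leftarrow>\<rho> # \<sigma>s. norm \<sigma>) ^ 3)"
    using K_ge_1 s(4) by (simp add: \<sigma>s s_def[symmetric] ennreal_mult[symmetric] power3_eq_cube mult_ac flip: s_def add.assoc)
  also have "\<dots> * part_sup (\<rho> # \<sigma>s) * (X 2 \<rho> \<sigma> * X 2 \<rho> \<tau> * X 2 \<rho> \<upsilon>) = ennreal (K ^ 3) * quadruple_term (\<rho> # \<sigma>s)"
    unfolding quadruple_term_def m3_Cons[OF \<rho>] by (simp add: \<sigma>s mult_ac)
  finally show "ennreal \<bar>V_part \<kappa> V (\<rho> # \<sigma>s) g (e # map2 entry [d \<xi> p, d \<xi> p, d \<xi> p] \<sigma>s)\<bar>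
      \<le> ennreal (K ^ 3) * quadruple_term (\<rho> # \<sigma>s)" .
qed

lemma taylor_remainder_le:
  assumes \<xi>: "\<xi> \<in> nodes"
  shows "ennreal \<bar>N [single \<rho> e] (config \<rho> \<xi> p) - N [single \<rho> e] G - N [single \<rho> e, d \<xi> p] G - N [single \<rho> e, d \<xi> p, d \<xi> p] G / 2\<bar>
    \<le> (\<Sum>\<^sub>\<infinity>\<sigma>s\<in>star_tuples 3. ennreal (K ^ 3) * quadruple_term (\<rho> # \<sigma>s))"
proof (cases "\<Sum>\<^sub>\<infinity>\<sigma>s\<in>star_tuples 3. ennreal (K ^ 3) * quadruple_term (\<rho> # \<sigma>s)")
  case (real B)
  have "\<bar>N [single \<rho> e] (G + d \<xi> p) - N [single \<rho> e] G - N [single \<rho> e, d \<xi> p] G - N [single \<rho> e, d \<xi> p, d \<xi> p] G / 2\<bar> \<le> B"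
  proof (rule taylor)
    show "\<bar>N [single \<rho> e, d \<xi> p, d \<xi> p, d \<xi> p] g\<bar> \<le> B" if "g \<in> S" for g
      using fourth_derivative_le[OF \<xi> that, of p] real by simp
  qed (use k gradient_stencil_in_S G_config_in_S in auto)
  then show ?thesis using real by (simp add: ennreal_leI)
qed simp

lemma first_order_le:
  "ennreal \<bar>avg (\<lambda>\<xi> p. N [single \<rho> e, d \<xi> p] G) - 2 * N [single \<rho> e, hessian_stencil \<rho>] G\<bar>
    \<le> (\<Sum>\<^sub>\<infinity>\<sigma>s\<in>star_tuples 1. 4 * ennreal K * pair_term (\<rho> # \<sigma>s))"
proof (rule has_sum_ennreal_bound)
  let ?V = "\<lambda>g \<sigma>s. V_part \<kappa> V (\<rho> # \<sigma>s) G (e # map2 entry [g] \<sigma>s)"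
  have h: "(?V g has_sum N [single \<rho> e, g] G) (star_tuples 1)" for g
    using has_sum_nderiv_single[OF \<rho> _ gradient_stencil_in_S, where w = e and ds = "[g]"] k by simp
  have "((\<lambda>\<sigma>s. avg (\<lambda>\<xi> p. ?V (d \<xi> p) \<sigma>s)
      + (- 2) * ?V (hessian_stencil \<rho>) \<sigma>s) has_sum
      avg (\<lambda>\<xi> p. N [single \<rho> e, d \<xi> p] G) + (- 2) * N [single \<rho> e, hessian_stencil \<rho>] G) (star_tuples 1)"
    by (intro has_sum_add avg_has_sum has_sum_cmult_right h)
  then show "((\<lambda>\<sigma>s. avg (\<lambda>\<xi> p. ?V (d \<xi> p) \<sigma>s)
      - 2 * ?V (hessian_stencil \<rho>) \<sigma>s) has_sum
      avg (\<lambda>\<xi> p. N [single \<rho> e, d \<xi> p] G) - 2 * N [single \<rho> e, hessian_stencil \<rho>] G) (star_tuples 1)"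
    by simp
  fix \<sigma>s :: "(real^'n) list" assume "\<sigma>s \<in> star_tuples 1"
  then obtain \<sigma> where \<sigma>s: "\<sigma>s = [\<sigma>]" "\<sigma> \<in> lattice_star"
    by (auto simp: star_tuples_def length_Suc_conv)
  define s where "s = norm \<rho> + norm \<sigma>"
  note l = V_part_2_linear(2)[OF \<rho> \<sigma>s(2) gradient_stencil_in_S[of x], where h = e]
  define R where "R = avg (\<lambda>\<xi> p. strain_defect \<sigma> (base \<rho> \<sigma> \<xi> p)
      - linear_part \<sigma> (base \<rho> \<sigma> \<xi> p) - quadratic_part \<sigma> (base \<rho> \<sigma> \<xi> p))"
  have R: "R = avg (\<lambda>\<xi> p. strain_defect \<sigma> (base \<rho> \<sigma> \<xi> p)) - 2 *\<^sub>R D2 x \<sigma> \<rho>"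
    unfolding R_def avg_diff avg_linear_part avg_quadratic_part by simp
  have "avg (\<lambda>\<xi> p. ?V (d \<xi> p) \<sigma>s)
      = V_part \<kappa> V [\<rho>, \<sigma>] G [e, avg (\<lambda>\<xi> p. strain_defect \<sigma> (base \<rho> \<sigma> \<xi> p))]"
    unfolding avg_linear[OF l, symmetric] using \<sigma>s by (simp add: entry_config del: entry_minus)
  then have "avg (\<lambda>\<xi> p. ?V (d \<xi> p) \<sigma>s)
      - 2 * ?V (hessian_stencil \<rho>) \<sigma>s = V_part \<kappa> V [\<rho>, \<sigma>] G [e, R]"
    using \<sigma>s by (simp add: R linear_diff[OF l] linear_scale[OF l] entry_hessian_stencil)
  then have "ennreal \<bar>avg (\<lambda>\<xi> p. ?V (d \<xi> p) \<sigma>s)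
      - 2 * ?V (hessian_stencil \<rho>) \<sigma>s\<bar> \<le> ennreal (norm R) * part_sup [\<rho>, \<sigma>]"
    using abs_V_part_le[of "[e, R]" "[\<rho>, \<sigma>]" G] \<rho> \<sigma>s k gradient_stencil_in_S by simp
  also have "\<dots> \<le> (4 * (ennreal (K * norm \<sigma> * s ^ 3) * X 4 \<rho> \<sigma>)) * part_sup [\<rho>, \<sigma>]"
    unfolding R_def
    by (intro mult_right_mono ennreal_norm_avg_le strain_defect_minus_cubic_le \<rho> \<sigma>s) (auto simp: s_def)
  also have "ennreal (K * norm \<sigma> * s ^ 3) = ennreal K * ennreal (norm \<sigma> * s ^ 3)"
    using K_ge_1 by (subst ennreal_mult[symmetric]) (auto simp: s_def mult.assoc)
  also have "4 * (ennreal K * ennreal (norm \<sigma> * s ^ 3) * X 4 \<rho> \<sigma>) * part_sup [\<rho>, \<sigma>] = 4 * ennreal K * pair_term (\<rho> # \<sigma>s)"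
    unfolding pair_term_def m3_Cons[OF \<rho>] by (simp add: \<sigma>s s_def mult_ac)
  finally show "ennreal \<bar>avg (\<lambda>\<xi> p. ?V (d \<xi> p) \<sigma>s)
      - 2 * ?V (hessian_stencil \<rho>) \<sigma>s\<bar> \<le> 4 * ennreal K * pair_term (\<rho> # \<sigma>s)" .
qed

lemma second_order_le:
  "ennreal \<bar>avg (\<lambda>\<xi> p. N [single \<rho> e, d \<xi> p, d \<xi> p] G)\<bar>
    \<le> (\<Sum>\<^sub>\<infinity>\<sigma>s\<in>star_tuples 2. 4 * ennreal (K ^ 2) * triple_term (\<rho> # \<sigma>s))"
proof (rule has_sum_ennreal_bound)
  let ?V = "\<lambda>\<xi> p \<sigma>s. V_part \<kappa> V (\<rho> # \<sigma>s) G (e # map2 entry [d \<xi> p, d \<xi> p] \<sigma>s)"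
  have "((\<lambda>\<sigma>s. ?V \<xi> p \<sigma>s) has_sum N [single \<rho> e, d \<xi> p, d \<xi> p] G)
      (star_tuples 2)" for \<xi> p
    using has_sum_nderiv_single[OF \<rho> _ gradient_stencil_in_S, where w = e and ds = "[d \<xi> p, d \<xi> p]"] k
    by (simp add: numeral_2_eq_2)
  then show "((\<lambda>\<sigma>s. avg (\<lambda>\<xi> p. ?V \<xi> p \<sigma>s)) has_sum
      avg (\<lambda>\<xi> p. N [single \<rho> e, d \<xi> p, d \<xi> p] G)) (star_tuples 2)"
    by (rule avg_has_sum)
  fix \<sigma>s :: "(real^'n) list" assume "\<sigma>s \<in> star_tuples 2"
  then obtain \<sigma> \<tau> where \<sigma>s: "\<sigma>s = [\<sigma>, \<tau>]" "\<sigma> \<in> lattice_star" "\<tau> \<in> lattice_star"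
    by (auto simp: star_tuples_def numeral_2_eq_2 length_Suc_conv)
  define s where "s = norm \<rho> + norm \<sigma> + norm \<tau>"
  have s: "norm \<rho> + norm \<sigma> \<le> s" "norm \<rho> + norm \<tau> \<le> s" "0 \<le> s"
    using norm_ge_zero[of \<sigma>] norm_ge_zero[of \<tau>] norm_ge_zero[of \<rho>] unfolding s_def by linarith+
  note l = V_part_3_linear[OF \<rho> \<sigma>s(2,3) gradient_stencil_in_S[of x], where w = e]
  define \<beta> where "\<beta> h h' = V_part \<kappa> V [\<rho>, \<sigma>, \<tau>] G [e, h, h']" for h h'
  have l\<beta>: "linear (\<lambda>h. \<beta> h h')" "linear (\<beta> h)" for h h'
    using l by (simp_all add: \<beta>_def[abs_def])
  have \<beta>_le: "ennreal \<bar>\<beta> h h'\<bar> \<le> ennreal (norm h) * ennreal (norm h') * part_sup (\<rho> # \<sigma>s)" for h h'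
    using abs_V_part_le[of "[e, h, h']" "[\<rho>, \<sigma>, \<tau>]" G] \<rho> \<sigma>s k gradient_stencil_in_S
    by (simp add: \<beta>_def ennreal_mult)
  define a where "a \<sigma> \<xi> p = strain_defect \<sigma> (base \<rho> \<sigma> \<xi> p)" for \<sigma> \<xi> p
  define b where "b \<sigma> \<xi> p = linear_part \<sigma> (base \<rho> \<sigma> \<xi> p)" for \<sigma> \<xi> p
  let ?E = "\<lambda>\<xi> p. \<beta> (a \<sigma> \<xi> p - b \<sigma> \<xi> p) (a \<tau> \<xi> p) + \<beta> (b \<sigma> \<xi> p) (a \<tau> \<xi> p - b \<tau> \<xi> p)"
  have "avg (\<lambda>\<xi> p. \<beta> (b \<sigma> \<xi> p) (b \<tau> \<xi> p)) = 0"
    unfolding b_def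
    by (rule avg_bilinear[where \<gamma> = "\<lambda>w w'. \<beta> (D2 x \<sigma> w) (D2 x \<tau> w')"])
      (use linear_compose[OF D2_linear l\<beta>(1)] linear_compose[OF D2_linear l\<beta>(2)] in \<open>auto simp: o_def\<close>)
  moreover have "avg (\<lambda>\<xi> p. ?V \<xi> p \<sigma>s) = avg (\<lambda>\<xi> p. \<beta> (a \<sigma> \<xi> p) (a \<tau> \<xi> p))"
    using \<sigma>s by (simp add: entry_config \<beta>_def a_def del: entry_minus)
  ultimately have "avg (\<lambda>\<xi> p. ?V \<xi> p \<sigma>s)
      = avg (\<lambda>\<xi> p. \<beta> (a \<sigma> \<xi> p) (a \<tau> \<xi> p) - \<beta> (b \<sigma> \<xi> p) (b \<tau> \<xi> p))"
    by (simp add: avg_diff)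
  also have "\<dots> = avg ?E"
    by (simp add: linear_diff[OF l\<beta>(1)] linear_diff[OF l\<beta>(2)])
  finally have eq: "avg (\<lambda>\<xi> p. ?V \<xi> p \<sigma>s)
      = avg ?E" .
  have "ennreal (norm (?E \<xi> p))
      \<le> ennreal (K ^ 2) * triple_term (\<rho> # \<sigma>s)" if \<xi>: "\<xi> \<in> nodes" for \<xi> p
  proof -
    have "ennreal (norm (?E \<xi> p))
        \<le> ennreal \<bar>\<beta> (a \<sigma> \<xi> p - b \<sigma> \<xi> p) (a \<tau> \<xi> p)\<bar> + ennreal \<bar>\<beta> (b \<sigma> \<xi> p) (a \<tau> \<xi> p - b \<tau> \<xi> p)\<bar>"
      by (simp add: ennreal_leI abs_triangle_ineq flip: ennreal_plus)
    also have "\<dots> \<le> ennreal (norm (a \<sigma> \<xi> p - b \<sigma> \<xi> p)) * ennreal (norm (a \<tau> \<xi> p)) * part_sup (\<rho> # \<sigma>s)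
        + ennreal (norm (b \<sigma> \<xi> p)) * ennreal (norm (a \<tau> \<xi> p - b \<tau> \<xi> p)) * part_sup (\<rho> # \<sigma>s)"
      by (intro add_mono \<beta>_le)
    also have "\<dots> \<le> (ennreal (K * norm \<sigma> * s ^ 2) * X 3 \<rho> \<sigma>) * (ennreal (K * norm \<tau> * s) * X 2 \<rho> \<tau>) * part_sup (\<rho> # \<sigma>s)
        + (ennreal (K * norm \<sigma> * s) * X 2 \<rho> \<sigma>) * (ennreal (K * norm \<tau> * s ^ 2) * X 3 \<rho> \<tau>) * part_sup (\<rho> # \<sigma>s)"
      unfolding a_def b_def
      by (intro add_mono mult_right_mono mult_mono strain_defect_minus_linear_le strain_defect_le linear_part_le \<rho> \<sigma>s \<xi> s) auto
    also have "\<dots> = (ennreal (K * norm \<sigma> * s ^ 2) * ennreal (K * norm \<tau> * s)) * part_sup (\<rho> # \<sigma>s) * (X 3 \<rho> \<sigma> * X 2 \<rho> \<tau>)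
        + (ennreal (K * norm \<sigma> * s) * ennreal (K * norm \<tau> * s ^ 2)) * part_sup (\<rho> # \<sigma>s) * (X 2 \<rho> \<sigma> * X 3 \<rho> \<tau>)"
      by (simp only: mult_ac)
    also have "ennreal (K * norm \<sigma> * s ^ 2) * ennreal (K * norm \<tau> * s) = ennreal (K ^ 2) * ennreal (norm \<sigma> * norm \<tau> * s ^ 3)"
      using K_ge_1 s(3) by (simp add: ennreal_mult[symmetric] power2_eq_square power3_eq_cube mult_ac)
    also have "ennreal (K * norm \<sigma> * s) * ennreal (K * norm \<tau> * s ^ 2) = ennreal (K ^ 2) * ennreal (norm \<sigma> * norm \<tau> * s ^ 3)"
      using K_ge_1 s(3) by (simp add: ennreal_mult[symmetric] power2_eq_square power3_eq_cube mult_ac)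
    also have "ennreal (K ^ 2) * ennreal (norm \<sigma> * norm \<tau> * s ^ 3) * part_sup (\<rho> # \<sigma>s) * (X 3 \<rho> \<sigma> * X 2 \<rho> \<tau>)
        + ennreal (K ^ 2) * ennreal (norm \<sigma> * norm \<tau> * s ^ 3) * part_sup (\<rho> # \<sigma>s) * (X 2 \<rho> \<sigma> * X 3 \<rho> \<tau>)
        = ennreal (K ^ 2) * triple_term (\<rho> # \<sigma>s)"
      unfolding triple_term_def m3_Cons[OF \<rho>] by (simp add: \<sigma>s s_def distrib_left mult_ac add_ac)
    finally show ?thesis .
  qed
  then have "ennreal \<bar>avg ?E\<bar>
      \<le> 4 * (ennreal (K ^ 2) * triple_term (\<rho> # \<sigma>s))"
    unfolding real_norm_def[symmetric] by (rule ennreal_norm_avg_le)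
  then show "ennreal \<bar>avg (\<lambda>\<xi> p. ?V \<xi> p \<sigma>s)\<bar>
      \<le> 4 * ennreal (K ^ 2) * triple_term (\<rho> # \<sigma>s)"
    unfolding eq by (simp only: mult.assoc)
qed

text \<open>The values of \<open>V\<^sub>\<rho>\<close> at \<open>G\<close> itself drop out because the four signs add up to zero.\<close>

lemma symmetrized_bond_force_error:
  "ennreal \<bar>bond_force i \<rho> + bond_force i (- \<rho>) - 2 * N [single \<rho> e, hessian_stencil \<rho>] G\<bar>
    \<le> 4 * ennreal (K ^ 3) * ((\<Sum>\<^sub>\<infinity>\<sigma>s\<in>star_tuples 3. quadruple_term (\<rho> # \<sigma>s))
      + (\<Sum>\<^sub>\<infinity>\<sigma>s\<in>star_tuples 2. triple_term (\<rho> # \<sigma>s)) + (\<Sum>\<^sub>\<infinity>\<sigma>s\<in>star_tuples 1. pair_term (\<rho> # \<sigma>s)))"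
proof -
  define R where "R \<xi> p = N [single \<rho> e] (config \<rho> \<xi> p) - N [single \<rho> e] G - N [single \<rho> e, d \<xi> p] G - N [single \<rho> e, d \<xi> p, d \<xi> p] G / 2" for \<xi> p
  define T1 where "T1 = avg (\<lambda>\<xi> p. N [single \<rho> e, d \<xi> p] G) - 2 * N [single \<rho> e, hessian_stencil \<rho>] G"
  define T2 where "T2 = avg (\<lambda>\<xi> p. N [single \<rho> e, d \<xi> p, d \<xi> p] G)"
  have "bond_force i \<rho> + bond_force i (- \<rho>)
      = avg (\<lambda>\<xi> p. N [single \<rho> e] G + N [single \<rho> e, d \<xi> p] G + (1/2) *\<^sub>R N [single \<rho> e, d \<xi> p, d \<xi> p] G + R \<xi> p)"
    unfolding symmetrized_bond_force[OF \<rho>] by (rule avg_cong) (simp add: R_def)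
  also have "\<dots> = avg (\<lambda>\<xi> p. N [single \<rho> e, d \<xi> p] G) + (1/2) *\<^sub>R T2 + avg R"
    unfolding T2_def avg_add avg_const by (simp add: avg_linear[where L = "\<lambda>a. (1/2) *\<^sub>R a"] linear_scaleR del: real_scaleR_def)
  finally have eq: "bond_force i \<rho> + bond_force i (- \<rho>) - 2 * N [single \<rho> e, hessian_stencil \<rho>] G = T1 + T2 / 2 + avg R"
    by (simp add: T1_def)
  have p1: "K \<le> K ^ 3" "K ^ 2 \<le> K ^ 3"
    using power_increasing[of 1 3 K] power_increasing[of 2 3 K] K_ge_1 by auto
  have "ennreal \<bar>T1 + T2 / 2 + avg R\<bar> \<le> ennreal (norm (avg R) + \<bar>T2\<bar> + \<bar>T1\<bar>)"
    by (intro ennreal_leI) (simp add: abs_if)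
  also have "\<dots> = ennreal (norm (avg R)) + ennreal \<bar>T2\<bar> + ennreal \<bar>T1\<bar>"
    by (simp add: ennreal_plus)
  also have "\<dots> \<le> 4 * (\<Sum>\<^sub>\<infinity>\<sigma>s\<in>star_tuples 3. ennreal (K ^ 3) * quadruple_term (\<rho> # \<sigma>s))
      + (\<Sum>\<^sub>\<infinity>\<sigma>s\<in>star_tuples 2. 4 * ennreal (K ^ 2) * triple_term (\<rho> # \<sigma>s))
      + (\<Sum>\<^sub>\<infinity>\<sigma>s\<in>star_tuples 1. 4 * ennreal K * pair_term (\<rho> # \<sigma>s))"
    unfolding T1_def T2_def
    by (intro add_mono first_order_le second_order_le ennreal_norm_avg_le)
      (use taylor_remainder_le in \<open>simp add: R_def\<close>)
  also have "\<dots> = 4 * ennreal (K ^ 3) * (\<Sum>\<^sub>\<infinity>\<sigma>s\<in>star_tuples 3. quadruple_term (\<rho> # \<sigma>s))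
      + 4 * ennreal (K ^ 2) * (\<Sum>\<^sub>\<infinity>\<sigma>s\<in>star_tuples 2. triple_term (\<rho> # \<sigma>s))
      + 4 * ennreal K * (\<Sum>\<^sub>\<infinity>\<sigma>s\<in>star_tuples 1. pair_term (\<rho> # \<sigma>s))"
    by (simp only: ennreal_infsum_cmult mult.assoc)
  also have "\<dots> \<le> 4 * ennreal (K ^ 3) * (\<Sum>\<^sub>\<infinity>\<sigma>s\<in>star_tuples 3. quadruple_term (\<rho> # \<sigma>s))
      + 4 * ennreal (K ^ 3) * (\<Sum>\<^sub>\<infinity>\<sigma>s\<in>star_tuples 2. triple_term (\<rho> # \<sigma>s))
      + 4 * ennreal (K ^ 3) * (\<Sum>\<^sub>\<infinity>\<sigma>s\<in>star_tuples 1. pair_term (\<rho> # \<sigma>s))"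
    using p1 by (intro add_mono mult_right_mono mult_left_mono ennreal_leI order_refl) auto
  finally show ?thesis unfolding eq by (simp only: distrib_left)
qed

end

text \<open>Interchanging the last two bonds of a triple leaves its weight unchanged, by the
  symmetry of third derivatives, and exchanges the two products.\<close>

lemma triple_term_sum:
  "(\<Sum>\<^sub>\<infinity>\<rho>s\<in>star_tuples 3. triple_term \<rho>s)
    \<le> 2 * (\<Sum>\<^sub>\<infinity>\<rho>s\<in>star_tuples 3. m3 \<kappa> V \<rho>s * (X 3 (\<rho>s ! 0) (\<rho>s ! 1) * X 2 (\<rho>s ! 0) (\<rho>s ! 2)))"
proof -
  let ?t = "\<lambda>\<rho>s. m3 \<kappa> V \<rho>s * (X 3 (\<rho>s ! 0) (\<rho>s ! 1) * X 2 (\<rho>s ! 0) (\<rho>s ! 2))"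
  let ?t' = "\<lambda>\<rho>s. m3 \<kappa> V \<rho>s * (X 2 (\<rho>s ! 0) (\<rho>s ! 1) * X 3 (\<rho>s ! 0) (\<rho>s ! 2))"
  let ?sw = "\<lambda>\<rho>s :: (real^'n) list. [\<rho>s ! 0, \<rho>s ! 2, \<rho>s ! 1]"
  have triple: "\<exists>\<rho> \<sigma> \<tau>. \<rho>s = [\<rho>, \<sigma>, \<tau>] \<and> set [\<rho>, \<sigma>, \<tau>] \<subseteq> lattice_star" if "\<rho>s \<in> star_tuples 3" for \<rho>s :: "(real^'n) list"
    using that by (auto simp: star_tuples_def numeral_3_eq_3 length_Suc_conv)
  have "(\<Sum>\<^sub>\<infinity>\<rho>s\<in>star_tuples 3. ?t' \<rho>s) = (\<Sum>\<^sub>\<infinity>\<rho>s\<in>star_tuples 3. ?t \<rho>s)"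
  proof (rule infsum_reindex_bij_witness[where i = ?sw and j = ?sw])
    fix \<rho>s :: "(real^'n) list" assume "\<rho>s \<in> star_tuples 3"
    then obtain \<rho> \<sigma> \<tau> where *: "\<rho>s = [\<rho>, \<sigma>, \<tau>]" "set [\<rho>, \<sigma>, \<tau>] \<subseteq> lattice_star" using triple by blast
    then show "?sw (?sw \<rho>s) = \<rho>s" "?sw (?sw \<rho>s) = \<rho>s" "?sw \<rho>s \<in> star_tuples 3" "?sw \<rho>s \<in> star_tuples 3"
      by (auto simp: star_tuples_def)
    have "part_sup [\<rho>, \<sigma>, \<tau>] = part_sup [\<rho>, \<tau>, \<sigma>]"
      by (rule antisym; rule part_sup_swap) (use * in auto)
    then show "?t (?sw \<rho>s) = ?t' \<rho>s"
      using * by (simp add: m3_Cons mult_ac add_ac)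
  qed
  then have "(\<Sum>\<^sub>\<infinity>\<rho>s\<in>star_tuples 3. triple_term \<rho>s) = (\<Sum>\<^sub>\<infinity>\<rho>s\<in>star_tuples 3. ?t \<rho>s) + (\<Sum>\<^sub>\<infinity>\<rho>s\<in>star_tuples 3. ?t \<rho>s)"
    unfolding triple_term_def distrib_left by (simp add: infsum_add ennreal_summable)
  then show ?thesis by (simp add: mult_2)
qed

abbreviation error_bound where
  "error_bound \<equiv> (\<Sum>\<^sub>\<infinity>\<rho>s\<in>star_tuples 4. m3 \<kappa> V \<rho>s * (\<Prod>j\<in>{1..3}. X 2 (\<rho>s ! 0) (\<rho>s ! j)))
    + (\<Sum>\<^sub>\<infinity>\<rho>s\<in>star_tuples 3. m3 \<kappa> V \<rho>s * (X 3 (\<rho>s ! 0) (\<rho>s ! 1) * X 2 (\<rho>s ! 0) (\<rho>s ! 2)))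
    + (\<Sum>\<^sub>\<infinity>\<rho>s\<in>star_tuples 2. m3 \<kappa> V \<rho>s * X 4 (\<rho>s ! 0) (\<rho>s ! 1))"

text \<open>Summing the bond forces once over \<open>\<rho>\<close> and once over \<open>-\<rho>\<close> gives twice the atomistic
  divergence, to be compared with twice the Cauchy--Born divergence.\<close>

lemma component_error:
  "ennreal \<bar>div_atomistic_stress \<zeta> \<kappa> V u x $ i - divergence (cauchy_born_stress \<kappa> V u) x $ i\<bar>
    \<le> 8 * ennreal (K ^ 3) * error_bound"
proof -
  let ?a = "div_atomistic_stress \<zeta> \<kappa> V u x $ i" and ?b = "divergence (cauchy_born_stress \<kappa> V u) x $ i"
  let ?c = "\<lambda>\<rho>. N [single \<rho> (axis i 1), hessian_stencil \<rho>] G"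
  have neg: "((\<lambda>\<rho>. bond_force i (- \<rho>)) has_sum ?a) lattice_star"
    by (subst has_sum_reindex_bij_witness[where i = uminus and j = uminus and T = lattice_star and h = "bond_force i"])
      (auto simp: div_atomistic_stress_has_sum)
  have "((\<lambda>\<rho>. bond_force i \<rho> + bond_force i (- \<rho>) + (- 2) * ?c \<rho>) has_sum (?a + ?a + (- 2) * ?b)) lattice_star"
    by (intro has_sum_add has_sum_cmult_right div_atomistic_stress_has_sum neg divergence_cauchy_born_stress_has_sum)
  then have hs: "((\<lambda>\<rho>. bond_force i \<rho> + bond_force i (- \<rho>) - 2 * ?c \<rho>) has_sum 2 * (?a - ?b)) lattice_star"
    by (simp add: algebra_simps)
  have "ennreal \<bar>?a - ?b\<bar> \<le> ennreal \<bar>2 * (?a - ?b)\<bar>" by (intro ennreal_leI) simp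
  also have "\<dots> \<le> (\<Sum>\<^sub>\<infinity>\<rho>\<in>lattice_star. 4 * ennreal (K ^ 3) * ((\<Sum>\<^sub>\<infinity>\<sigma>s\<in>star_tuples 3. quadruple_term (\<rho> # \<sigma>s))
      + (\<Sum>\<^sub>\<infinity>\<sigma>s\<in>star_tuples 2. triple_term (\<rho> # \<sigma>s)) + (\<Sum>\<^sub>\<infinity>\<sigma>s\<in>star_tuples 1. pair_term (\<rho> # \<sigma>s))))"
    by (rule has_sum_ennreal_bound[OF hs symmetrized_bond_force_error])
  also have "\<dots> = 4 * ennreal (K ^ 3) * ((\<Sum>\<^sub>\<infinity>\<rho>\<in>lattice_star. \<Sum>\<^sub>\<infinity>\<sigma>s\<in>star_tuples 3. quadruple_term (\<rho> # \<sigma>s))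
      + (\<Sum>\<^sub>\<infinity>\<rho>\<in>lattice_star. \<Sum>\<^sub>\<infinity>\<sigma>s\<in>star_tuples 2. triple_term (\<rho> # \<sigma>s))
      + (\<Sum>\<^sub>\<infinity>\<rho>\<in>lattice_star. \<Sum>\<^sub>\<infinity>\<sigma>s\<in>star_tuples 1. pair_term (\<rho> # \<sigma>s)))"
    by (simp only: ennreal_infsum_cmult infsum_add[OF ennreal_summable ennreal_summable])
  also have "\<dots> \<le> 4 * ennreal (K ^ 3) * ((\<Sum>\<^sub>\<infinity>\<rho>s\<in>star_tuples (Suc 3). quadruple_term \<rho>s)
      + (\<Sum>\<^sub>\<infinity>\<rho>s\<in>star_tuples (Suc 2). triple_term \<rho>s) + (\<Sum>\<^sub>\<infinity>\<rho>s\<in>star_tuples (Suc 1). pair_term \<rho>s))"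
    by (intro mult_left_mono add_mono infsum_star_tuples_Suc) auto
  also have "\<dots> \<le> 4 * ennreal (K ^ 3) * (2 * error_bound)"
  proof (intro mult_left_mono)
    have "{1..3::nat} = {1, 2, 3}" by auto
    then have q: "(\<Sum>\<^sub>\<infinity>\<rho>s\<in>star_tuples 4. m3 \<kappa> V \<rho>s * (\<Prod>j\<in>{1..3}. X 2 (\<rho>s ! 0) (\<rho>s ! j)))
        = (\<Sum>\<^sub>\<infinity>\<rho>s\<in>star_tuples 4. quadruple_term \<rho>s)"
      by (intro infsum_cong) (simp add: quadruple_term_def mult.assoc)
    have suc: "Suc 3 = 4" "Suc 2 = 3" "Suc 1 = 2" by simp_all
    show "(\<Sum>\<^sub>\<infinity>\<rho>s\<in>star_tuples (Suc 3). quadruple_term \<rho>s) + (\<Sum>\<^sub>\<infinity>\<rho>s\<in>star_tuples (Suc 2). triple_term \<rho>s)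
        + (\<Sum>\<^sub>\<infinity>\<rho>s\<in>star_tuples (Suc 1). pair_term \<rho>s) \<le> 2 * error_bound"
      unfolding q distrib_left suc
    proof (intro add_mono triple_term_sum)
      have "a \<le> 2 * a" for a :: ennreal using mult_right_mono[of 1 2 a] by simp
      then show "(\<Sum>\<^sub>\<infinity>\<rho>s\<in>star_tuples 4. quadruple_term \<rho>s) \<le> 2 * (\<Sum>\<^sub>\<infinity>\<rho>s\<in>star_tuples 4. quadruple_term \<rho>s)"
        "(\<Sum>\<^sub>\<infinity>\<rho>s\<in>star_tuples 2. pair_term \<rho>s) \<le> 2 * (\<Sum>\<^sub>\<infinity>\<rho>s\<in>star_tuples 2. m3 \<kappa> V \<rho>s * X 4 (\<rho>s ! 0) (\<rho>s ! 1))"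
        unfolding pair_term_def by auto
    qed
  qed simp
  also have "\<dots> = 8 * ennreal (K ^ 3) * error_bound"
  proof -
    have "4 * a * (2 * b) = 8 * a * b" for a b :: ennreal
    proof -
      have "4 * a * (2 * b) = (4 * 2) * a * b" by (simp only: mult_ac)
      then show ?thesis by simp
    qed
    then show ?thesis .
  qed
  finally show ?thesis .
qed

lemma stress_divergence_error:
  "ennreal (norm (div_atomistic_stress \<zeta> \<kappa> V u x - divergence (cauchy_born_stress \<kappa> V u) x))
    \<le> ennreal (real CARD('n) * (8 * K ^ 3)) * error_bound"
proof -
  let ?D = "div_atomistic_stress \<zeta> \<kappa> V u x - divergence (cauchy_born_stress \<kappa> V u) x"
  have "ennreal (norm ?D) \<le> ennreal (\<Sum>i\<in>UNIV. \<bar>?D $ i\<bar>)" by (intro ennreal_leI norm_le_l1_cart)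
  also have "\<dots> = (\<Sum>i\<in>UNIV. ennreal \<bar>?D $ i\<bar>)" by simp
  also have "\<dots> \<le> (\<Sum>i\<in>(UNIV :: 'n set). 8 * ennreal (K ^ 3) * error_bound)"
    by (intro sum_mono) (use component_error in simp)
  also have "\<dots> = ennreal (real CARD('n) * (8 * K ^ 3)) * error_bound"
    using K_ge_1 by (simp add: ennreal_mult ennreal_of_nat_eq_real_of_nat mult.assoc)
  finally show ?thesis .
qed

lemmas stress_divergence_error_explicit = stress_divergence_error[unfolded K_def]

end

theorem lemma6p7:
  fixes \<zeta> :: "real^'n::finite \<Rightarrow> real"
  assumes "admissible_kernel \<zeta>"
  shows "\<exists>c C. 0 < c \<and> 0 < C \<and>
    (\<forall>(\<kappa>::real) (k::nat) (V :: 'n stencil \<Rightarrow> ereal) (u :: real^'n \<Rightarrow> real^'n) (x :: real^'n).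
      0 < \<kappa> \<longrightarrow> 4 \<le> k \<longrightarrow> admissible_potential \<kappa> k V \<longrightarrow>
      sobolev_inf_loc 4 u \<longrightarrow> u \<in> K_set \<kappa> \<longrightarrow>
      ennreal (norm (div_atomistic_stress \<zeta> \<kappa> V u x - divergence (cauchy_born_stress \<kappa> V u) x))
      \<le> ennreal C *
        ((\<Sum>\<^sub>\<infinity>\<rho>s\<in>star_tuples 4. m3 \<kappa> V \<rho>s *
            (\<Prod>j\<in>{1..3}. local_grad_norm 2 u c x (\<rho>s ! 0) (\<rho>s ! j)))
         + (\<Sum>\<^sub>\<infinity>\<rho>s\<in>star_tuples 3. m3 \<kappa> V \<rho>s *
              (local_grad_norm 3 u c x (\<rho>s ! 0) (\<rho>s ! 1) * local_grad_norm 2 u c x (\<rho>s ! 0) (\<rho>s ! 2)))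
         + (\<Sum>\<^sub>\<infinity>\<rho>s\<in>star_tuples 2. m3 \<kappa> V \<rho>s *
              local_grad_norm 4 u c x (\<rho>s ! 0) (\<rho>s ! 1))))"
proof -
  obtain c where c: "0 < c" "\<And>y. \<zeta> y \<noteq> 0 \<Longrightarrow> norm y \<le> c"
    using kernel_radius[OF assms] by blast
  have "\<forall>n. \<exists>\<eta> :: real^'n \<Rightarrow> real. mollifier (inverse (real (Suc n))) \<eta>"
    by (intro allI mollifier_exists) simp
  then obtain \<eta> :: "nat \<Rightarrow> real^'n \<Rightarrow> real" where \<eta>: "\<And>n. mollifier (inverse (real (Suc n))) (\<eta> n)"
    by metis
  define C where "C = real CARD('n) * (8 * (real CARD('n) ^ 4 * (c + 2) ^ 3) ^ 3)"
  have model: "model \<kappa> k V \<eta> u \<zeta> c"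
    if "0 < \<kappa>" "4 \<le> k" "admissible_potential \<kappa> k V" "sobolev_inf_loc 4 u" "u \<in> K_set \<kappa>"
    for \<kappa> k u and V :: "'n stencil \<Rightarrow> ereal"
    by unfold_locales (use that assms c \<eta> in \<open>auto simp: K_set_def\<close>)
  note bound = model.stress_divergence_error_explicit[OF model, folded C_def]
  have C: "0 < C" using c by (simp add: C_def)
  show ?thesis
    by (intro exI[of _ c] exI[of _ C] conjI allI impI c(1) C bound)
qed

end
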